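(* Let $K$ be an infinite field and let $D$ be a finite dimensional division algebra over $K$ which has degree $d$ over its center $C$, and suppose that $C$ has reduced degree $c$ over $K$. Then: (a) For any $k\ge1$, the matrix algebra $M_k(D)$ has degree $dkc$ over $K$. (b) For any $k\ge 1$, any character $M_k(D)\to K$ is a nonnegative integer power of the reduced norm $\overline n:M_k(D)\to K$.
   Context: For a finite dimensional $K$-algebra $A$ with $K$-basis $u_1,\dots,u_n$, let $\xi_1,\dots,\xi_n$ be algebraically independent over $K$ and let $a(\xi)=\sum\xi_iu_i\in A\otimes_KK(\xi_1,\dots,\xi_n)$ be the general element. Let $m_{a(\xi)}(\lambda)=\lambda^m+c_1(\xi)\lambda^{m-1}+\cdots+c_m(\xi)$ be its minimal polynomial over $K(\xi)$; the coefficients $c_j(\xi)$ are homogeneous polynomials of degree $j$ in $K[\xi]$. The integer $m$ is the degree of $A$ over $K$ (also called the reduced degree, to avoid confusion with the vector space dimension when $A$ is a field extension). The reduced norm is the polynomial function $\overline n:A\to K$, $\overline n(b)=(-1)^mc_m(b_1,\dots,b_n)$ for $b=\sum b_iu_i$, $b_i\in K$. A character on $A$ is a polynomial function $\chi:A\to K$ with $\chi(ab)=\chi(a)\chi(b)$ for all $a,b\in A$ and $\chi(1)=1$. The degree $d$ of $D$ over its center $C$ satisfies $\dim_CD=d^2$. *)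

theory Defs
  imports
    "Jordan_Normal_Form.VS_Connect"
    "HOL-Library.Poly_Mapping"
    "HOL-Algebra.QuotRing"
    "HOL-Computational_Algebra.Polynomial_Factorial"
begin

text \<open>
  Monomials are finitely supported exponent functions on the variable indices; the variables are
  numbered from 0.
\<close>

type_synonym 'k mpoly = "(nat \<Rightarrow>\<^sub>0 nat) \<Rightarrow>\<^sub>0 'k"

definition mpoly_const :: "'k::comm_ring_1 \<Rightarrow> 'k mpoly" where
  "mpoly_const c = Poly_Mapping.single 0 c"

definition mpoly_var :: "nat \<Rightarrow> 'k::comm_ring_1 mpoly" where
  "mpoly_var i = Poly_Mapping.single (Poly_Mapping.single i 1) 1"

definition mpoly_vars :: "'k::comm_ring_1 mpoly \<Rightarrow> nat set" where
  "mpoly_vars p = (\<Union>m \<in> Poly_Mapping.keys p. Poly_Mapping.keys m)"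

definition mpoly_eval :: "(nat \<Rightarrow> 'k) \<Rightarrow> 'k::comm_ring_1 mpoly \<Rightarrow> 'k" where
  "mpoly_eval x p =
     (\<Sum>m \<in> Poly_Mapping.keys p. Poly_Mapping.lookup p m *
        (\<Prod>i \<in> Poly_Mapping.keys m. x i ^ Poly_Mapping.lookup m i))"

text \<open>
  The type \<open>'k mpoly fract\<close> has infinitely many variables; \<open>ratfun_field n\<close> is its subfield
  \<open>K(\<xi>\<^sub>0, \<dots>, \<xi>\<^sub>n\<^sub>-\<^sub>1)\<close>.
\<close>

definition ratfun_field :: "nat \<Rightarrow> 'k::field mpoly fract set" where
  "ratfun_field n =
     {Fract p q | p q. q \<noteq> 0 \<and> mpoly_vars p \<subseteq> {..<n} \<and> mpoly_vars q \<subseteq> {..<n}}"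

text \<open>
  An algebra is packaged in the record \<open>module\<close>, which extends \<open>ring\<close> by scalar multiplication.
  The library's locale \<open>algebra\<close> is restricted to commutative algebras. When the base field is a
  type \<open>'k\<close>, it enters as \<open>class_ring :: 'k ring\<close>.
\<close>

locale assoc_algebra = vectorspace K A + ring A for K and A (structure) +
  assumes smult_mult_left:
      "c \<in> carrier K \<Longrightarrow> x \<in> carrier A \<Longrightarrow> y \<in> carrier A \<Longrightarrow> (c \<odot> x) \<otimes> y = c \<odot> (x \<otimes> y)"
    and smult_mult_right:
      "c \<in> carrier K \<Longrightarrow> x \<in> carrier A \<Longrightarrow> y \<in> carrier A \<Longrightarrow> x \<otimes> (c \<odot> y) = c \<odot> (x \<otimes> y)"

definition ordered_basis :: "('k::field, 'a) module \<Rightarrow> 'a list \<Rightarrow> bool" where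
  "ordered_basis A us \<longleftrightarrow> distinct us \<and> vectorspace.basis class_ring A (set us)"

definition coords :: "('k::field, 'a) module \<Rightarrow> 'a list \<Rightarrow> 'a \<Rightarrow> 'k vec" where
  "coords A us b =
     (THE x. x \<in> carrier_vec (length us) \<and>
        (\<Oplus>\<^bsub>A\<^esub> i \<in> {..<length us}. (x $ i) \<odot>\<^bsub>A\<^esub> (us ! i)) = b)"

text \<open>
  \<open>A \<otimes>\<^sub>K K(\<xi>)\<close> is realised on the free \<open>K(\<xi>)\<close>-module with basis \<open>us\<close>: the vector \<open>x\<close> stands for
  \<open>\<Sum>i. us!i \<otimes> x$i\<close>, and the multiplication is given by the structure constants of \<open>A\<close> with
  respect to \<open>us\<close>.
\<close>

definition embed_const :: "'k::field \<Rightarrow> 'k mpoly fract" where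
  "embed_const c = to_fract (mpoly_const c)"

definition scalar_extension ::
    "('k::field, 'a) module \<Rightarrow> 'a list \<Rightarrow> ('k mpoly fract, 'k mpoly fract vec) module" where
  "scalar_extension A us = (let n = length us in
     \<lparr> carrier = {x \<in> carrier_vec n. \<forall>i<n. x $ i \<in> ratfun_field n},
       mult = (\<lambda>x y. vec n (\<lambda>l. \<Sum>i<n. \<Sum>j<n.
                 x $ i * y $ j * embed_const (coords A us (us ! i \<otimes>\<^bsub>A\<^esub> us ! j) $ l))),
       one = map_vec embed_const (coords A us \<one>\<^bsub>A\<^esub>),
       zero = 0\<^sub>v n,
       add = (+),
       smult = (\<cdot>\<^sub>v) \<rparr>)"

definition general_element :: "'a list \<Rightarrow> 'k::field mpoly fract vec" where
  "general_element us = vec (length us) (\<lambda>i. to_fract (mpoly_var i))"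

definition alg_eval :: "('f::field, 'b) module \<Rightarrow> 'b \<Rightarrow> 'f poly \<Rightarrow> 'b" where
  "alg_eval B a p = (\<Oplus>\<^bsub>B\<^esub> i \<in> {..degree p}. coeff p i \<odot>\<^bsub>B\<^esub> (a [^]\<^bsub>B\<^esub> i))"

text \<open>Here the base field of \<open>B\<close> is the subfield \<open>F\<close> of the field type \<open>'f\<close>.\<close>

definition is_min_poly ::
    "'f::field set \<Rightarrow> ('f, 'b) module \<Rightarrow> 'b \<Rightarrow> 'f poly \<Rightarrow> bool" where
  "is_min_poly F B a p \<longleftrightarrow>
     lead_coeff p = 1 \<and> (\<forall>i. coeff p i \<in> F) \<and> alg_eval B a p = \<zero>\<^bsub>B\<^esub> \<and>
     (\<forall>q. q \<noteq> 0 \<and> (\<forall>i. coeff q i \<in> F) \<and> alg_eval B a q = \<zero>\<^bsub>B\<^esub> \<longrightarrow> degree p \<le> degree q)"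

definition general_min_poly ::
    "('k::field, 'a) module \<Rightarrow> 'a list \<Rightarrow> 'k mpoly fract poly" where
  "general_min_poly A us =
     (THE p. is_min_poly (ratfun_field (length us)) (scalar_extension A us) (general_element us) p)"

definition alg_degree :: "('k::field, 'a) module \<Rightarrow> 'a list \<Rightarrow> nat" where
  "alg_degree A us = degree (general_min_poly A us)"

text \<open>
  \<open>general_min_poly_coeff A us j\<close> is \<open>c\<^sub>j(\<xi>)\<close> in \<open>\<lambda>\<^sup>m + c\<^sub>1(\<xi>) \<lambda>\<^sup>m\<^sup>-\<^sup>1 + \<dots> + c\<^sub>m(\<xi>)\<close>, as a polynomial
  in \<open>K[\<xi>]\<close>.
\<close>

definition general_min_poly_coeff ::
    "('k::field, 'a) module \<Rightarrow> 'a list \<Rightarrow> nat \<Rightarrow> 'k mpoly" where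
  "general_min_poly_coeff A us j =
     (THE P. mpoly_vars P \<subseteq> {..<length us} \<and>
        to_fract P = coeff (general_min_poly A us) (alg_degree A us - j))"

definition reduced_norm :: "('k::field, 'a) module \<Rightarrow> 'a list \<Rightarrow> 'a \<Rightarrow> 'k" where
  "reduced_norm A us b =
     (-1) ^ alg_degree A us *
     mpoly_eval (\<lambda>i. coords A us b $ i) (general_min_poly_coeff A us (alg_degree A us))"

definition polynomial_function :: "('k::field, 'a) module \<Rightarrow> ('a \<Rightarrow> 'k) \<Rightarrow> bool" where
  "polynomial_function A f \<longleftrightarrow>
     (\<exists>us P. ordered_basis A us \<and> mpoly_vars P \<subseteq> {..<length us} \<and>
        (\<forall>b \<in> carrier A. f b = mpoly_eval (\<lambda>i. coords A us b $ i) P))"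

definition algebra_character :: "('k::field, 'a) module \<Rightarrow> ('a \<Rightarrow> 'k) \<Rightarrow> bool" where
  "algebra_character A \<chi> \<longleftrightarrow>
     polynomial_function A \<chi> \<and>
     (\<forall>a \<in> carrier A. \<forall>b \<in> carrier A. \<chi> (a \<otimes>\<^bsub>A\<^esub> b) = \<chi> a * \<chi> b) \<and>
     \<chi> \<one>\<^bsub>A\<^esub> = 1"

definition type_algebra :: "('k \<Rightarrow> 'd \<Rightarrow> 'd) \<Rightarrow> ('k::field, 'd::ring_1) module" where
  "type_algebra scale =
     \<lparr> carrier = UNIV, mult = (*), one = 1, zero = 0, add = (+), smult = scale \<rparr>"

definition center_algebra :: "('k \<Rightarrow> 'd \<Rightarrow> 'd) \<Rightarrow> ('k::field, 'd::ring_1) module" where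
  "center_algebra scale = (type_algebra scale) \<lparr> carrier := {z. \<forall>x. z * x = x * z} \<rparr>"

definition matrix_algebra ::
    "('k \<Rightarrow> 'd \<Rightarrow> 'd) \<Rightarrow> nat \<Rightarrow> ('k::field, 'd::ring_1 mat) module" where
  "matrix_algebra scale k =
     \<lparr> carrier = carrier_mat k k, mult = (*), one = 1\<^sub>m k, zero = 0\<^sub>m k k, add = (+),
       smult = (\<lambda>c. map_mat (scale c)) \<rparr>"

end

theory Submission
  imports Defs "Berlekamp_Zassenhaus.Unique_Factorization_Poly" "Jordan_Normal_Form.Char_Poly"
    "HOL-Computational_Algebra.Formal_Power_Series"
begin

text \<open>
  For an algebra \<open>A\<close> over the infinite field \<open>K\<close>, specialising the minimal polynomial of the general
  element at \<open>b \<in> A\<close> gives a monic polynomial \<open>M b\<close> of degree \<open>m\<close>, the degree of \<open>A\<close>. Its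
  coefficients are polynomial functions of \<open>b\<close>, and it kills \<open>b\<close>. Elements \<open>b\<close> for which it is even the
  minimal polynomial are called full below; they include the complement of the zero set of some nonzero
  polynomial function. Once \<open>generic_min_poly\<close> has identified this family with the general element over
  \<open>K(\<xi>)\<close>, the rest of the argument only uses the family: identities between the \<open>M b\<close> are checked at
  full elements, where minimal polynomials are unique, and extended to all of \<open>A\<close> by density along
  lines. As \<open>M b\<close> kills \<open>b\<close>, the reduced norm of \<open>b\<close> is \<open>b\<close> times a polynomial expression in \<open>b\<close>, an
  adjoint.

  Part (a) splits into \<open>deg\<^sub>K D = d c\<close> (\<open>degree_tower\<close>) and \<open>deg\<^sub>K M\<^sub>k(D) = k \<cdot> deg\<^sub>K D\<close>
  (\<open>degree_matrix\<close>). Both upper bounds come from one observation (\<open>norm_multiple\<close>): a monic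
  polynomial of degree \<open>q\<close> with coefficients in an algebra \<open>E\<close> of degree \<open>m\<close> divides a polynomial of
  degree \<open>q m\<close> with coefficients in \<open>K\<close>, namely its reduced norm. It is applied to the relation of
  degree \<open>d\<close> of an element of \<open>D\<close> over the center, and to the relation
  \<open>X\<^sup>k e\<^sub>0 = - \<Sum>\<^sub>i\<^sub><\<^sub>k X\<^sup>i e\<^sub>0 f\<^sub>i\<close> of a matrix with cyclic vector \<open>e\<^sub>0\<close>. The lower bound for matrices is
  attained by a companion matrix. For \<open>d c \<le> deg\<^sub>K D\<close>, a general \<open>b \<in> D\<close> has degree \<open>d\<close> over \<open>C\<close>, and it
  has to be shown that \<open>K[b]\<close> is large enough to contain central elements up to a common factor. If
  \<open>M b\<close> is separable, perturbing \<open>b\<close> by a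
  central \<open>z\<close> and differentiating \<open>M (b + t z) (b + t z) = 0\<close> at \<open>t = 0\<close> shows that \<open>z\<close> times the
  derivative of \<open>M b\<close> at \<open>b\<close> lies in \<open>K[b]\<close>. In general one takes the largest power \<open>q\<close> of the
  characteristic such that all \<open>M b\<close> are polynomials in \<open>\<lambda>\<^sup>q\<close> and works with \<open>b\<^sup>q\<close> and \<open>z\<^sup>q\<close>;
  this loses nothing on the side of \<open>C\<close>, because \<open>D\<close> contains elements that are separable of degree
  \<open>d\<close> over \<open>C\<close> (\<open>separable_generic\<close>) and \<open>p\<close>-th powers of these are again such elements.

  For part (b), the quotient of \<open>M X\<close> by \<open>\<lambda> - X\<close> shows that \<open>\<chi>(\<lambda> - X)\<close> divides a power of \<open>M X\<close>,
  where both sides are polynomials in \<open>\<lambda>\<close>. A single \<open>X\<close> is joined to companion matrices by a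
  two-parameter family (\<open>pencil\<close>) whose generic polynomial is irreducible, since it specialises
  to \<open>f(\<lambda>\<^sup>k - s)\<close> with \<open>f\<close> irreducible. As \<open>K[s, u, \<lambda>]\<close> is factorial, \<open>\<chi>(\<lambda> - X)\<close> is a scalar times
  a power of \<open>M X\<close>. Comparison with the companion matrix and with the zero matrix fixes exponent and
  scalar, and \<open>\<lambda> = 0\<close> gives the claim.
\<close>

section \<open>Polynomial functions over an infinite field\<close>

lemma poly_zeroI_infinite:
  fixes p :: "'a::idom poly"
  assumes "infinite S" "\<And>t. t \<in> S \<Longrightarrow> poly p t = 0"
  shows "p = 0"
proof (rule ccontr)
  assume "p \<noteq> 0"
  then have "finite {t. poly p t = 0}" by (rule poly_roots_finite)
  moreover have "S \<subseteq> {t. poly p t = 0}" using assms by auto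
  ultimately show False using assms(1) finite_subset by blast
qed

lemma poly_eqI_infinite:
  fixes p q :: "'a::idom poly"
  assumes "infinite (UNIV :: 'a set)" "\<And>t. poly p t = poly q t"
  shows "p = q"
  using poly_zeroI_infinite[of UNIV "p - q"] assms by auto

text \<open>
  Polynomial functions occur below on \<open>K\<^sup>n\<close>, on lines, and on parameter spaces of dimension two and
  three. All that is needed is closure under the ring operations, so the domain is left abstract.
\<close>

definition fun_ring :: "('p \<Rightarrow> 'k::comm_ring_1) set \<Rightarrow> bool" where
  "fun_ring Q \<longleftrightarrow> (\<forall>c. (\<lambda>_. c) \<in> Q) \<and>
     (\<forall>f\<in>Q. \<forall>g\<in>Q. (\<lambda>p. f p + g p) \<in> Q \<and> (\<lambda>p. f p * g p) \<in> Q)"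

lemma fun_ring_const: "fun_ring Q \<Longrightarrow> (\<lambda>_. c) \<in> Q"
  and fun_ring_add: "fun_ring Q \<Longrightarrow> f \<in> Q \<Longrightarrow> g \<in> Q \<Longrightarrow> (\<lambda>p. f p + g p) \<in> Q"
  and fun_ring_mult: "fun_ring Q \<Longrightarrow> f \<in> Q \<Longrightarrow> g \<in> Q \<Longrightarrow> (\<lambda>p. f p * g p) \<in> Q"
  by (auto simp: fun_ring_def)

lemma fun_ring_uminus: "fun_ring Q \<Longrightarrow> f \<in> Q \<Longrightarrow> (\<lambda>p. - f p) \<in> Q"
  using fun_ring_mult[of Q "\<lambda>_. -1" f] fun_ring_const[of Q "-1"] by simp

lemma fun_ring_diff: "fun_ring Q \<Longrightarrow> f \<in> Q \<Longrightarrow> g \<in> Q \<Longrightarrow> (\<lambda>p. f p - g p) \<in> Q"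
  using fun_ring_add[of Q f "\<lambda>p. - g p"] fun_ring_uminus[of Q g] by simp

lemma fun_ring_sum:
  assumes "fun_ring Q" "\<And>i. i \<in> I \<Longrightarrow> f i \<in> Q"
  shows "(\<lambda>p. \<Sum>i\<in>I. f i p) \<in> Q"
  using assms(2) by (induction I rule: infinite_finite_induct)
    (auto intro: fun_ring_const[OF assms(1)] fun_ring_add[OF assms(1)])

lemma fun_ring_prod:
  assumes "fun_ring Q" "\<And>i. i \<in> I \<Longrightarrow> f i \<in> Q"
  shows "(\<lambda>p. \<Prod>i\<in>I. f i p) \<in> Q"
  using assms(2) by (induction I rule: infinite_finite_induct)
    (auto intro: fun_ring_const[OF assms(1)] fun_ring_mult[OF assms(1)])

lemma fun_ring_power: "fun_ring Q \<Longrightarrow> f \<in> Q \<Longrightarrow> (\<lambda>p. f p ^ k) \<in> Q"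
  by (induction k) (auto intro: fun_ring_const fun_ring_mult)

lemmas fun_ring_intros = fun_ring_const fun_ring_add fun_ring_mult fun_ring_uminus fun_ring_diff
  fun_ring_sum fun_ring_prod fun_ring_power

lemma fun_ring_poly: "fun_ring (range (poly :: 'a::comm_ring_1 poly \<Rightarrow> 'a \<Rightarrow> 'a))"
  unfolding fun_ring_def
proof (intro conjI allI ballI)
  fix c :: 'a show "(\<lambda>_. c) \<in> range poly" by (rule image_eqI[of _ _ "[:c:]"]) auto
next
  fix f g :: "'a \<Rightarrow> 'a" assume "f \<in> range poly" "g \<in> range poly"
  then obtain p q where "f = poly p" "g = poly q" by auto
  then show "(\<lambda>x. f x + g x) \<in> range poly" "(\<lambda>x. f x * g x) \<in> range poly"
    by (auto simp: image_iff fun_eq_iff intro: exI[of _ "p + q"] exI[of _ "p * q"])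
qed

lemma fun_ring_poly_id: "(\<lambda>t. t) \<in> range (poly :: 'a::comm_ring_1 poly \<Rightarrow> 'a \<Rightarrow> 'a)"
  by (rule image_eqI[of _ _ "[:0,1:]"]) auto

definition monom_eval :: "(nat \<Rightarrow> 'k) \<Rightarrow> (nat \<Rightarrow>\<^sub>0 nat) \<Rightarrow> 'k::comm_ring_1" where
  "monom_eval x m = (\<Prod>i \<in> Poly_Mapping.keys m. x i ^ Poly_Mapping.lookup m i)"

lemma monom_eval_superset:
  assumes "finite S" "Poly_Mapping.keys m \<subseteq> S"
  shows "monom_eval x m = (\<Prod>i \<in> S. x i ^ Poly_Mapping.lookup m i)"
  unfolding monom_eval_def
  by (rule prod.mono_neutral_left) (use assms in \<open>auto simp: in_keys_iff\<close>)

lemma monom_eval_add: "monom_eval x (m + m') = monom_eval x m * monom_eval x m'"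
proof -
  let ?S = "Poly_Mapping.keys m \<union> Poly_Mapping.keys m'"
  have "monom_eval x (m + m') = (\<Prod>i \<in> ?S. x i ^ Poly_Mapping.lookup (m + m') i)"
    by (rule monom_eval_superset) (use Poly_Mapping.keys_add[of m m'] in auto)
  also have "\<dots> = monom_eval x m * monom_eval x m'"
    by (simp add: lookup_add power_add prod.distrib
        monom_eval_superset[of ?S m] monom_eval_superset[of ?S m'])
  finally show ?thesis .
qed

lemma mpoly_eval_superset:
  assumes "finite S" "Poly_Mapping.keys p \<subseteq> S"
  shows "mpoly_eval x p = (\<Sum>m \<in> S. Poly_Mapping.lookup p m * monom_eval x m)"
  unfolding mpoly_eval_def monom_eval_def
  by (rule sum.mono_neutral_left) (use assms in \<open>auto simp: in_keys_iff\<close>)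

lemma mpoly_eval_add: "mpoly_eval x (p + q) = mpoly_eval x p + mpoly_eval x q"
proof -
  let ?S = "Poly_Mapping.keys p \<union> Poly_Mapping.keys q"
  have "mpoly_eval x (p + q) = (\<Sum>m \<in> ?S. Poly_Mapping.lookup (p + q) m * monom_eval x m)"
    by (rule mpoly_eval_superset) (use Poly_Mapping.keys_add[of p q] in auto)
  then show ?thesis
    by (simp add: lookup_add distrib_right sum.distrib
        mpoly_eval_superset[of ?S p] mpoly_eval_superset[of ?S q])
qed

lemma mpoly_eval_zero [simp]: "mpoly_eval x 0 = 0"
  by (simp add: mpoly_eval_def)

lemma mpoly_eval_single [simp]: "mpoly_eval x (Poly_Mapping.single m c) = c * monom_eval x m"
  by (subst mpoly_eval_superset[of "{m}"]) auto

lemma mpoly_eval_sum: "mpoly_eval x (\<Sum>i\<in>I. p i) = (\<Sum>i\<in>I. mpoly_eval x (p i))"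
  by (induction I rule: infinite_finite_induct) (auto simp: mpoly_eval_add)

lemma mpoly_as_sum:
  "p = (\<Sum>m\<in>Poly_Mapping.keys p. Poly_Mapping.single m (Poly_Mapping.lookup p m))"
proof (rule poly_mapping_eqI)
  fix k
  show "Poly_Mapping.lookup p k =
    Poly_Mapping.lookup (\<Sum>m\<in>Poly_Mapping.keys p. Poly_Mapping.single m (Poly_Mapping.lookup p m)) k"
    by (auto simp: lookup_sum lookup_single when_def in_keys_iff)
qed

lemma mpoly_eval_mult: "mpoly_eval x (p * q) = mpoly_eval x p * mpoly_eval x q"
proof -
  let ?s = "\<lambda>p m. Poly_Mapping.single m (Poly_Mapping.lookup p m)"
  have "p * q = (\<Sum>m\<in>Poly_Mapping.keys p. ?s p m) * (\<Sum>m\<in>Poly_Mapping.keys q. ?s q m)"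
    by (simp flip: mpoly_as_sum)
  also have "\<dots> = (\<Sum>m\<in>Poly_Mapping.keys p. \<Sum>m'\<in>Poly_Mapping.keys q. ?s p m * ?s q m')"
    by (simp add: sum_product)
  finally have "mpoly_eval x (p * q) =
     (\<Sum>m\<in>Poly_Mapping.keys p. \<Sum>m'\<in>Poly_Mapping.keys q.
        Poly_Mapping.lookup p m * Poly_Mapping.lookup q m' * (monom_eval x m * monom_eval x m'))"
    by (simp add: mpoly_eval_sum mult_single monom_eval_add)
  also have "\<dots> = mpoly_eval x p * mpoly_eval x q"
    by (simp add: mpoly_eval_superset[of "Poly_Mapping.keys p" p]
        mpoly_eval_superset[of "Poly_Mapping.keys q" q] sum_product mult_ac)
  finally show ?thesis .
qed

lemma mpoly_eval_const [simp]: "mpoly_eval x (mpoly_const c) = c"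
  by (simp add: mpoly_const_def monom_eval_def)

lemma mpoly_eval_var [simp]: "mpoly_eval x (mpoly_var i) = x i"
  by (simp add: mpoly_var_def monom_eval_def)

lemma mpoly_vars_const: "mpoly_vars (mpoly_const c) = {}"
  by (simp add: mpoly_const_def mpoly_vars_def)

lemma mpoly_vars_var: "mpoly_vars (mpoly_var i) \<subseteq> {i}"
  by (simp add: mpoly_var_def mpoly_vars_def)

lemma mpoly_vars_add: "mpoly_vars (p + q) \<subseteq> mpoly_vars p \<union> mpoly_vars q"
  using Poly_Mapping.keys_add[of p q] by (fastforce simp: mpoly_vars_def)

lemma mpoly_vars_mult: "mpoly_vars (p * q) \<subseteq> mpoly_vars p \<union> mpoly_vars q"
proof
  fix i assume "i \<in> mpoly_vars (p * q)"
  then obtain m where m: "m \<in> Poly_Mapping.keys (p * q)" "i \<in> Poly_Mapping.keys m"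
    by (auto simp: mpoly_vars_def)
  then obtain a b where ab: "m = a + b" "a \<in> Poly_Mapping.keys p" "b \<in> Poly_Mapping.keys q"
    using keys_mult[of p q] by auto
  then have "i \<in> Poly_Mapping.keys a \<union> Poly_Mapping.keys b"
    using m Poly_Mapping.keys_add[of a b] by auto
  then show "i \<in> mpoly_vars p \<union> mpoly_vars q" using ab by (auto simp: mpoly_vars_def)
qed

lemma fun_ring_mpoly_eval:
  assumes "fun_ring Q" "\<And>i. i \<in> mpoly_vars P \<Longrightarrow> (\<lambda>p. \<phi> p i) \<in> Q"
  shows "(\<lambda>p. mpoly_eval (\<phi> p) P) \<in> Q"
  unfolding mpoly_eval_def
  by (intro fun_ring_intros assms) (auto simp: mpoly_vars_def)

text \<open>
  Functions rather than multivariate polynomials are the objects of most of the arguments; over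
  an infinite field nothing is lost, by \<open>mpoly_eval_eq_0_imp_0\<close>.
\<close>

definition polyfuns :: "nat \<Rightarrow> ((nat \<Rightarrow> 'k::comm_ring_1) \<Rightarrow> 'k) set" where
  "polyfuns n = {\<lambda>x. mpoly_eval x P |P. mpoly_vars P \<subseteq> {..<n}}"

lemma fun_ring_polyfuns: "fun_ring (polyfuns n)"
  unfolding fun_ring_def
proof (intro conjI allI ballI)
  fix c :: 'a
  show "(\<lambda>_. c) \<in> polyfuns n"
    by (auto simp: polyfuns_def mpoly_vars_const intro!: exI[of _ "mpoly_const c"])
next
  fix f g :: "(nat \<Rightarrow> 'a) \<Rightarrow> 'a" assume "f \<in> polyfuns n" "g \<in> polyfuns n"
  then obtain P R where PR: "f = (\<lambda>x. mpoly_eval x P)" "g = (\<lambda>x. mpoly_eval x R)"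
    "mpoly_vars P \<subseteq> {..<n}" "mpoly_vars R \<subseteq> {..<n}" by (auto simp: polyfuns_def)
  have "mpoly_vars (P + R) \<subseteq> {..<n}" "mpoly_vars (P * R) \<subseteq> {..<n}"
    using PR mpoly_vars_add[of P R] mpoly_vars_mult[of P R] by blast+
  then show "(\<lambda>x. f x + g x) \<in> polyfuns n" "(\<lambda>x. f x * g x) \<in> polyfuns n"
    unfolding polyfuns_def PR by (auto simp flip: mpoly_eval_add mpoly_eval_mult)
qed

lemma polyfuns_var: "i < n \<Longrightarrow> (\<lambda>x. x i) \<in> polyfuns n"
  using mpoly_vars_var[of i] by (auto simp: polyfuns_def intro!: exI[of _ "mpoly_var i"])

lemma polyfuns_compose:
  assumes "f \<in> polyfuns n" "fun_ring Q" "\<And>i. i < n \<Longrightarrow> (\<lambda>p. \<phi> p i) \<in> Q"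
  shows "(\<lambda>p. f (\<phi> p)) \<in> Q"
  using assms by (auto simp: polyfuns_def intro!: fun_ring_mpoly_eval)

lemma polyfuns_cong:
  assumes "h \<in> polyfuns n" "\<And>i. i < n \<Longrightarrow> x i = y i" shows "h x = h y"
proof -
  have "mpoly_eval x P = mpoly_eval y P" if "mpoly_vars P \<subseteq> {..<n}" for P
    unfolding mpoly_eval_def
    by (intro sum.cong prod.cong refl arg_cong2[where f = "(*)"] arg_cong2[where f = "(^)"])
      (use that assms(2) in \<open>auto simp: mpoly_vars_def\<close>)
  then show ?thesis using assms(1) by (auto simp: polyfuns_def)
qed

lemma digits_inj:
  fixes m m' :: "nat \<Rightarrow> nat"
  assumes "\<And>i. i < n \<Longrightarrow> m i < N" "\<And>i. i < n \<Longrightarrow> m' i < N"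
    and "(\<Sum>i<n. m i * N ^ i) = (\<Sum>i<n. m' i * N ^ i)" and "i < n"
  shows "m i = m' i"
  using assms
proof (induction n arbitrary: m m' i)
  case (Suc n)
  have eq: "m 0 + N * (\<Sum>i<n. m (Suc i) * N ^ i) = m' 0 + N * (\<Sum>i<n. m' (Suc i) * N ^ i)"
    using Suc.prems(3) by (simp add: sum.lessThan_Suc_shift sum_distrib_left mult_ac del: sum.lessThan_Suc)
  have "(m 0 + N * (\<Sum>i<n. m (Suc i) * N ^ i)) mod N = m 0"
    "(m' 0 + N * (\<Sum>i<n. m' (Suc i) * N ^ i)) mod N = m' 0"
    using Suc.prems(1)[of 0] Suc.prems(2)[of 0] by auto
  with eq have 0: "m 0 = m' 0" by metis
  with eq have "N * (\<Sum>i<n. m (Suc i) * N ^ i) = N * (\<Sum>i<n. m' (Suc i) * N ^ i)" by simp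
  moreover have "N > 0" using Suc.prems(1)[of 0] by auto
  ultimately have eq2: "(\<Sum>i<n. m (Suc i) * N ^ i) = (\<Sum>i<n. m' (Suc i) * N ^ i)" by simp
  show ?case
  proof (cases i)
    case (Suc j)
    show ?thesis unfolding Suc
      by (rule Suc.IH) (use Suc.prems eq2 Suc in auto)
  qed (use 0 in auto)
qed auto

text \<open>
  Kronecker substitution \<open>x\<^sub>i = t\<^bsup>N\<^sup>i\<^esup>\<close> with \<open>N\<close> beyond all exponents keeps the monomials apart
  (\<open>digits_inj\<close>), so that a vanishing polynomial in one variable remains.
\<close>

lemma mpoly_eval_eq_0_imp_0:
  fixes P :: "'k::field mpoly"
  assumes inf: "infinite (UNIV :: 'k set)" and ev: "\<And>x. mpoly_eval x P = 0"
  shows "P = 0"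
proof (rule poly_mapping_eqI)
  fix m0
  let ?K = "Poly_Mapping.keys P"
  have "finite (mpoly_vars P)" by (simp add: mpoly_vars_def)
  then obtain n where n: "mpoly_vars P \<subseteq> {..<n}" by (meson finite_nat_iff_bounded)
  have "finite (\<Union>m\<in>?K. Poly_Mapping.lookup m ` {..<n})" by auto
  then obtain N where N: "(\<Union>m\<in>?K. Poly_Mapping.lookup m ` {..<n}) \<subseteq> {..<N}"
    by (meson finite_nat_iff_bounded)
  define w where "w m = (\<Sum>i<n. Poly_Mapping.lookup m i * N ^ i)" for m :: "nat \<Rightarrow>\<^sub>0 nat"
  have keysn: "Poly_Mapping.keys m \<subseteq> {..<n}" if "m \<in> ?K" for m
    using n that by (auto simp: mpoly_vars_def)
  have inj: "inj_on w ?K"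
  proof (rule inj_onI, rule poly_mapping_eqI)
    fix m m' i assume m: "m \<in> ?K" "m' \<in> ?K" "w m = w m'"
    show "Poly_Mapping.lookup m i = Poly_Mapping.lookup m' i"
    proof (cases "i < n")
      case True
      show ?thesis
        by (rule digits_inj[of n "Poly_Mapping.lookup m" N]) (use m N True in \<open>auto simp: w_def\<close>)
    next
      case False
      then have "i \<notin> Poly_Mapping.keys m" "i \<notin> Poly_Mapping.keys m'" using keysn m by blast+
      then show ?thesis by (simp add: in_keys_iff)
    qed
  qed
  define p where "p = (\<Sum>m\<in>?K. monom (Poly_Mapping.lookup P m) (w m))"
  have "poly p t = 0" for t
  proof -
    have "monom_eval (\<lambda>i. t ^ (N ^ i)) m = t ^ w m" if "m \<in> ?K" for m
      by (subst monom_eval_superset[of "{..<n}"])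
        (use keysn[OF that] in \<open>auto simp: w_def power_sum mult_ac simp flip: power_mult\<close>)
    then have "poly p t = mpoly_eval (\<lambda>i. t ^ (N ^ i)) P"
      by (subst mpoly_eval_superset[of ?K]) (auto simp: p_def poly_sum poly_monom intro!: sum.cong)
    then show ?thesis using ev by simp
  qed
  then have p0: "p = 0" using poly_zeroI_infinite[OF inf] by blast
  show "Poly_Mapping.lookup P m0 = Poly_Mapping.lookup 0 m0"
  proof (cases "m0 \<in> ?K")
    case True
    have "coeff p (w m0) = (\<Sum>m\<in>?K. if m = m0 then Poly_Mapping.lookup P m else 0)"
      unfolding p_def coeff_sum coeff_monom
      by (rule sum.cong) (use inj True in \<open>auto dest: inj_onD\<close>)
    then show ?thesis using p0 True by simp
  qed (simp add: in_keys_iff)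
qed

text \<open>
  The degree bound is uniform in the direction \<open>x\<close>, and each coefficient is again a polynomial
  function of \<open>x\<close>. This is what allows power series in the line parameter to be read as polynomials.
\<close>

lemma polyfuns_line_expansion:
  fixes f :: "(nat \<Rightarrow> 'k::comm_ring_1) \<Rightarrow> 'k"
  assumes "f \<in> polyfuns n"
  obtains \<Phi> :: "(nat \<Rightarrow> 'k) \<Rightarrow> 'k poly" and N where
    "\<And>x t. poly (\<Phi> x) t = f (\<lambda>i. b i + t * x i)"
    "\<And>x. degree (\<Phi> x) \<le> N"
    "\<And>l. (\<lambda>x. coeff (\<Phi> x) l) \<in> polyfuns n"
proof -
  define Q where "Q = {\<lambda>(x,t). poly (\<Phi> x) t |(\<Phi> :: (nat \<Rightarrow> 'k) \<Rightarrow> 'k poly).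
     (\<exists>N. \<forall>x. degree (\<Phi> x) \<le> N) \<and> (\<forall>l. (\<lambda>x. coeff (\<Phi> x) l) \<in> polyfuns n)}"
  note pf = fun_ring_polyfuns[of n]
  have Q: "fun_ring Q"
    unfolding fun_ring_def
  proof (intro conjI allI ballI)
    fix c :: 'k
    show "(\<lambda>_. c) \<in> Q" unfolding Q_def
      by (rule CollectI, rule exI[of _ "\<lambda>_. [:c:]"]) (auto intro!: fun_ring_intros pf)
  next
    fix f g assume "f \<in> Q" "g \<in> Q"
    then obtain \<Phi> \<Psi> N M where *: "f = (\<lambda>(x,t). poly (\<Phi> x) t)" "g = (\<lambda>(x,t). poly (\<Psi> x) t)"
      "\<And>x. degree (\<Phi> x) \<le> N" "\<And>x. degree (\<Psi> x) \<le> M"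
      "\<And>l. (\<lambda>x. coeff (\<Phi> x) l) \<in> polyfuns n" "\<And>l. (\<lambda>x. coeff (\<Psi> x) l) \<in> polyfuns n"
      unfolding Q_def by blast
    have "\<forall>x. degree (\<Phi> x + \<Psi> x) \<le> max N M"
      using *(3,4) by (meson degree_add_le max.cobounded1 max.cobounded2 order_trans)
    then show "(\<lambda>p. f p + g p) \<in> Q" unfolding Q_def
      by (intro CollectI exI[of _ "\<lambda>x. \<Phi> x + \<Psi> x"])
        (use * in \<open>auto simp: intro!: fun_ring_intros pf\<close>)
    have "\<forall>x. degree (\<Phi> x * \<Psi> x) \<le> N + M"
      using *(3,4) by (meson degree_mult_le add_mono order_trans)
    then show "(\<lambda>p. f p * g p) \<in> Q" unfolding Q_def
      by (intro CollectI exI[of _ "\<lambda>x. \<Phi> x * \<Psi> x"])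
        (use * in \<open>auto simp: coeff_mult intro!: fun_ring_intros pf\<close>)
  qed
  have "(\<lambda>(x,t). b i + t * x i) \<in> Q" if "i < n" for i
  proof -
    have "(\<lambda>x. coeff [:b i, x i:] l) \<in> polyfuns n" for l
      by (cases l; cases "l - 1")
        (auto simp: coeff_pCons intro!: fun_ring_intros pf polyfuns_var that split: nat.splits)
    moreover have "\<forall>x. degree [:b i, x i:] \<le> 1" by auto
    ultimately show ?thesis unfolding Q_def
      by (intro CollectI exI[of _ "\<lambda>x. [:b i, x i:]"]) (auto simp del: degree_pCons_eq_if)
  qed
  then have "(\<lambda>p. f (\<lambda>i. b i + snd p * fst p i)) \<in> Q"
    by (intro polyfuns_compose[OF assms Q]) (auto simp: case_prod_unfold)
  then obtain \<Phi> N where *: "(\<lambda>p. f (\<lambda>i. b i + snd p * fst p i)) = (\<lambda>(x,t). poly (\<Phi> x) t)"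
     "\<And>x. degree (\<Phi> x) \<le> N" "\<And>l. (\<lambda>x. coeff (\<Phi> x) l) \<in> polyfuns n"
    unfolding Q_def by blast
  have "poly (\<Phi> x) t = f (\<lambda>i. b i + t * x i)" for x t
    using fun_cong[OF *(1), of "(x,t)"] by simp
  then show ?thesis using that *(2,3) by blast
qed

section \<open>Integrality of generic Krylov relations\<close>

definition indep :: "nat \<Rightarrow> nat \<Rightarrow> (nat \<Rightarrow> nat \<Rightarrow> 'a::comm_ring_1) \<Rightarrow> bool" where
  "indep n m v \<longleftrightarrow> (\<forall>a. (\<forall>l<n. (\<Sum>j<m. a j * v j l) = 0) \<longrightarrow> (\<forall>j<m. a j = 0))"

text \<open>
  Fraction-free Gram--Schmidt: vectors depending polynomially on a parameter that are independent at
  one parameter value admit polynomial dual vectors up to a common factor \<open>g\<close>. The inductive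
  step picks a coordinate \<open>l0\<close> in which the last vector is not a combination of the others.
\<close>

lemma dual_system_exists:
  fixes w :: "nat \<Rightarrow> 'p \<Rightarrow> nat \<Rightarrow> 'k::field"
  assumes Q: "fun_ring Q" and w: "\<And>j l. j < m \<Longrightarrow> l < n \<Longrightarrow> (\<lambda>p. w j p l) \<in> Q"
    and ind: "indep n m (\<lambda>j. w j p0)"
  shows "\<exists>\<psi> g. (\<forall>i<m. \<forall>l<n. (\<lambda>p. \<psi> i p l) \<in> Q) \<and> g \<in> Q \<and> g p0 \<noteq> 0 \<and>
     (\<forall>p. \<forall>i<m. \<forall>j<m. (\<Sum>l<n. \<psi> i p l * w j p l) = (if i = j then g p else 0))"
  using w ind
proof (induction m)
  case 0
  then show ?case by (auto intro!: exI[of _ "\<lambda>_. 1"] fun_ring_const[OF Q])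
next
  case (Suc m)
  have "indep n m (\<lambda>j. w j p0)"
    unfolding indep_def
  proof (intro allI impI)
    fix a j assume a: "\<forall>l<n. (\<Sum>j<m. a j * w j p0 l) = 0" "j < m"
    have "\<forall>l<n. (\<Sum>j<Suc m. (a(m := 0)) j * w j p0 l) = 0" using a by simp
    then have "(a(m := 0)) j = 0"
      using Suc.prems(2)[unfolded indep_def, rule_format, of "a(m := 0)" j] \<open>j < m\<close> by auto
    then show "a j = 0" using \<open>j < m\<close> by simp
  qed
  then have "\<exists>\<psi> g. (\<forall>i<m. \<forall>l<n. (\<lambda>p. \<psi> i p l) \<in> Q) \<and> g \<in> Q \<and> g p0 \<noteq> 0 \<and>
     (\<forall>p. \<forall>i<m. \<forall>j<m. (\<Sum>l<n. \<psi> i p l * w j p l) = (if i = j then g p else 0))"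
    by (intro Suc.IH) (auto intro: Suc.prems(1))
  then obtain \<psi> g where
    \<psi>Q: "\<And>i l. i < m \<Longrightarrow> l < n \<Longrightarrow> (\<lambda>p. \<psi> i p l) \<in> Q" and gQ: "g \<in> Q" and g0: "g p0 \<noteq> 0"
    and dual: "\<And>p i j. i < m \<Longrightarrow> j < m \<Longrightarrow> (\<Sum>l<n. \<psi> i p l * w j p l) = (if i = j then g p else 0)"
    by blast
  \<comment> \<open>The combination of the earlier vectors with coefficients \<open>h i / g\<close> is the only candidate for
    the last vector, so by independence it fails in some coordinate.\<close>
  define h where "h i p = (\<Sum>l<n. \<psi> i p l * w m p l)" for i p
  obtain l0 where l0: "l0 < n" and u: "g p0 * w m p0 l0 - (\<Sum>i<m. h i p0 * w i p0 l0) \<noteq> 0"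
  proof (rule ccontr)
    assume "\<not> thesis"
    then have *: "\<forall>l<n. g p0 * w m p0 l - (\<Sum>i<m. h i p0 * w i p0 l) = 0" using that by blast
    define a where "a j = (if j = m then g p0 else - h j p0)" for j
    have "(\<Sum>j<m. a j * w j p0 l) = - (\<Sum>i<m. h i p0 * w i p0 l)" for l
      by (auto simp: a_def sum_negf[symmetric] intro!: sum.cong)
    then have "\<forall>l<n. (\<Sum>j<Suc m. a j * w j p0 l) = 0" using * by (simp add: a_def)
    then have "a m = 0" using Suc.prems(2) unfolding indep_def by blast
    then show False using g0 by (simp add: a_def)
  qed
  define \<psi>' where "\<psi>' p l = (if l = l0 then g p else 0) - (\<Sum>i<m. w i p l0 * \<psi> i p l)" for p l
  define g' where "g' p = g p * w m p l0 - (\<Sum>i<m. h i p * w i p l0)" for p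
  have expand: "(\<Sum>l<n. \<psi>' p l * v l) = g p * v l0 - (\<Sum>i<m. w i p l0 * (\<Sum>l<n. \<psi> i p l * v l))" for p v
  proof -
    have "(\<Sum>l<n. \<psi>' p l * v l) =
      (\<Sum>l<n. (if l = l0 then g p * v l else 0) - (\<Sum>i<m. w i p l0 * (\<psi> i p l * v l)))"
      by (rule sum.cong) (auto simp: \<psi>'_def left_diff_distrib sum_distrib_right mult.assoc)
    also have "\<dots> = g p * v l0 - (\<Sum>l<n. \<Sum>i<m. w i p l0 * (\<psi> i p l * v l))"
      using l0 by (simp add: sum_subtractf)
    also have "(\<Sum>l<n. \<Sum>i<m. w i p l0 * (\<psi> i p l * v l)) = (\<Sum>i<m. w i p l0 * (\<Sum>l<n. \<psi> i p l * v l))"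
      by (subst sum.swap) (simp add: sum_distrib_left)
    finally show ?thesis .
  qed
  have \<psi>'w: "(\<Sum>l<n. \<psi>' p l * w j p l) = 0" if "j < m" for p j
  proof -
    have "(\<Sum>i<m. w i p l0 * (\<Sum>l<n. \<psi> i p l * w j p l)) = (\<Sum>i<m. if i = j then w j p l0 * g p else 0)"
      by (rule sum.cong) (auto simp: dual that)
    then show ?thesis using that by (simp add: expand)
  qed
  have \<psi>'m: "(\<Sum>l<n. \<psi>' p l * w m p l) = g' p" for p
    by (simp add: expand g'_def h_def[symmetric] mult.commute)
  have hQ: "h i \<in> Q" if "i < m" for i
    unfolding h_def by (intro fun_ring_intros Q \<psi>Q Suc.prems that) auto
  have \<psi>'Q: "(\<lambda>p. \<psi>' p l) \<in> Q" if "l < n" for l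
    unfolding \<psi>'_def using l0 gQ that
    by (cases "l = l0") (auto intro!: fun_ring_intros Q \<psi>Q Suc.prems)
  have g'Q: "g' \<in> Q"
    unfolding g'_def by (intro fun_ring_intros Q gQ hQ Suc.prems) (use l0 in auto)
  define \<Psi> where "\<Psi> i p l = (if i = m then g p * \<psi>' p l else g' p * \<psi> i p l - h i p * \<psi>' p l)" for i p l
  have "(\<lambda>p. \<Psi> i p l) \<in> Q" if "i < Suc m" "l < n" for i l
    using that unfolding \<Psi>_def
    by (cases "i = m") (auto intro!: fun_ring_intros Q gQ g'Q \<psi>Q \<psi>'Q hQ)
  moreover have "(\<Sum>l<n. \<Psi> i p l * w j p l) = (if i = j then g p * g' p else 0)"
    if "i < Suc m" "j < Suc m" for i j p
  proof (cases "i = m")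
    case True
    then have "(\<Sum>l<n. \<Psi> i p l * w j p l) = g p * (\<Sum>l<n. \<psi>' p l * w j p l)"
      by (simp add: \<Psi>_def sum_distrib_left mult.assoc)
    then show ?thesis using True that \<psi>'w[of j p] \<psi>'m[of p] by (cases "j = m") auto
  next
    case False
    then have "(\<Sum>l<n. \<Psi> i p l * w j p l) =
      g' p * (\<Sum>l<n. \<psi> i p l * w j p l) - h i p * (\<Sum>l<n. \<psi>' p l * w j p l)"
      by (simp add: \<Psi>_def sum_distrib_left mult.assoc left_diff_distrib sum_subtractf)
    then show ?thesis using False that \<psi>'w[of j p] \<psi>'m[of p] dual[of i j p]
      by (cases "j = m") (auto simp: h_def)
  qed
  moreover have "g p0 * g' p0 \<noteq> 0" using g0 u by (simp add: g'_def)
  moreover have "(\<lambda>p. g p * g' p) \<in> Q" by (intro fun_ring_intros Q gQ g'Q)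
  ultimately show ?case
    by (intro exI[of _ \<Psi>] exI[of _ "\<lambda>p. g p * g' p"]) blast
qed

definition mat_app :: "nat \<Rightarrow> (nat \<Rightarrow> nat \<Rightarrow> 'a::comm_ring_1) \<Rightarrow> (nat \<Rightarrow> 'a) \<Rightarrow> nat \<Rightarrow> 'a" where
  "mat_app n a v = (\<lambda>i. \<Sum>l<n. a i l * v l)"

lemma mat_app_cong: "(\<And>l. l < n \<Longrightarrow> u l = v l) \<Longrightarrow> mat_app n a u = mat_app n a v"
  by (auto simp: mat_app_def)

lemma funpow_mat_app_cong:
  "(\<And>l. l < n \<Longrightarrow> u l = v l) \<Longrightarrow> i < n \<Longrightarrow> (mat_app n a ^^ j) u i = (mat_app n a ^^ j) v i"
proof (induction j arbitrary: i)
  case (Suc j)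
  then show ?case using mat_app_cong[of n "(mat_app n a ^^ j) u" "(mat_app n a ^^ j) v" a] by simp
qed simp

lemma funpow_mat_app_diff:
  "(mat_app n a ^^ j) (\<lambda>i. u i - v i) = (\<lambda>i. (mat_app n a ^^ j) u i - (mat_app n a ^^ j) v i)"
  by (induction j) (auto simp: mat_app_def right_diff_distrib sum_subtractf)

lemma funpow_mat_app_scale:
  "(mat_app n a ^^ j) (\<lambda>i. c * u i) = (\<lambda>i. c * (mat_app n a ^^ j) u i)"
  by (induction j) (auto simp: mat_app_def sum_distrib_left mult_ac)

lemma funpow_mat_app_zero: "(mat_app n a ^^ j) (\<lambda>i. 0) = (\<lambda>i. 0)"
  by (induction j) (auto simp: mat_app_def)

text \<open>
  The adjugate identity \<open>(\<lambda> - a) B = E\<close>, applied to \<open>y\<close> and compared coefficientwise in \<open>\<lambda>\<close>,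
  telescopes. The coefficients may lie in any commutative ring; below they are polynomials.
\<close>

lemma cayley_hamilton_krylov:
  fixes a :: "nat \<Rightarrow> nat \<Rightarrow> 'a::comm_ring_1"
  obtains E :: "'a poly" where "lead_coeff E = 1"
    "\<And>i. i < n \<Longrightarrow> (\<Sum>j\<le>degree E. coeff E j * (mat_app n a ^^ j) y i) = 0"
proof -
  define A where "A = mat n n (\<lambda>(i,j). a i j)"
  have A: "A \<in> carrier_mat n n" by (simp add: A_def)
  let ?C = "char_poly_matrix A"
  define E where "E = char_poly A"
  define B where "B = adj_mat ?C"
  have C: "?C \<in> carrier_mat n n" using A by simp
  have B: "B \<in> carrier_mat n n" using adj_mat(1)[OF C] by (simp add: B_def)
  have CB: "?C * B = E \<cdot>\<^sub>m 1\<^sub>m n" using adj_mat(2)[OF C] by (simp add: B_def E_def char_poly_def)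
  define z where "z i = (\<Sum>r<n. B $$ (i,r) * [:y r:])" for i
  have Cent: "?C $$ (i,l) = (if i = l then [:0,1:] else 0) + [:- a i l:]" if "i < n" "l < n" for i l
    using that A by (auto simp: char_poly_matrix_def A_def)
  have rel: "[:0,1:] * z i - (\<Sum>l<n. [:a i l:] * z l) = E * [:y i:]" if i: "i < n" for i
  proof -
    have "E * [:y i:] = (\<Sum>r<n. (E \<cdot>\<^sub>m 1\<^sub>m n) $$ (i,r) * [:y r:])"
    proof -
      have "(\<Sum>r<n. (E \<cdot>\<^sub>m 1\<^sub>m n) $$ (i,r) * [:y r:]) = (\<Sum>r<n. if r = i then E * [:y i:] else 0)"
        by (rule sum.cong) (use i in auto)
      then show ?thesis using i by simp
    qed
    also have "\<dots> = (\<Sum>r<n. (\<Sum>l<n. ?C $$ (i,l) * B $$ (l,r)) * [:y r:])"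
      using i C B by (auto simp: CB[symmetric] scalar_prod_def atLeast0LessThan intro!: sum.cong)
    also have "\<dots> = (\<Sum>l<n. ?C $$ (i,l) * z l)"
      unfolding z_def sum_distrib_left sum_distrib_right
      by (subst sum.swap) (simp only: mult.assoc)
    also have "\<dots> = (\<Sum>l<n. (if l = i then [:0,1:] * z i else 0) - [:a i l:] * z l)"
      using i by (intro sum.cong) (auto simp: Cent algebra_simps)
    also have "\<dots> = [:0,1:] * z i - (\<Sum>l<n. [:a i l:] * z l)"
      unfolding sum_subtractf using i by simp
    finally show ?thesis by simp
  qed
  define zc where "zc j = (\<lambda>i. coeff (z i) j)" for j
  define zm where "zm j = (if j = 0 then (\<lambda>i. 0) else zc (j - 1))" for j
  let ?T = "mat_app n a"
  have co: "coeff E j * y i = zm j i - ?T (zc j) i" if "i < n" for i j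
  proof -
    have "coeff E j * y i = coeff ([:0,1:] * z i - (\<Sum>l<n. [:a i l:] * z l)) j"
      using rel[OF that] by (simp add: coeff_mult_0)
    also have "\<dots> = zm j i - ?T (zc j) i"
      by (cases j) (auto simp: zm_def zc_def mat_app_def coeff_sum)
    finally show ?thesis .
  qed
  have tele: "(\<Sum>j\<le>J. coeff E j * (?T ^^ j) y i) = - (?T ^^ Suc J) (zc J) i" if "i < n" for i J
  proof -
    have step: "coeff E j * (?T ^^ j) y i = (?T ^^ j) (zm j) i - (?T ^^ Suc j) (zc j) i" for j
    proof -
      have "coeff E j * (?T ^^ j) y i = (?T ^^ j) (\<lambda>i. coeff E j * y i) i"
        by (simp add: funpow_mat_app_scale)
      also have "\<dots> = (?T ^^ j) (\<lambda>i. zm j i - ?T (zc j) i) i"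
        by (rule funpow_mat_app_cong) (use co that in auto)
      finally show ?thesis by (simp add: funpow_mat_app_diff funpow_swap1)
    qed
    show ?thesis
    proof (induction J)
      case 0
      then show ?case using step[of 0] by (simp add: zm_def)
    next
      case (Suc J)
      have "zm (Suc J) = zc J" by (simp add: zm_def)
      then show ?case using step[of "Suc J"] Suc by (simp del: funpow.simps)
    qed
  qed
  have mon: "lead_coeff E = 1" "degree E = n"
    using degree_monic_char_poly[OF A] by (auto simp: E_def)
  define J where "J = max n (Max ((\<lambda>i. Suc (degree (z i))) ` {..n}))"
  have "zc J i = 0" if "i < n" for i
  proof -
    have "Suc (degree (z i)) \<le> Max ((\<lambda>i. Suc (degree (z i))) ` {..n})"
      by (rule Max_ge) (use that in auto)
    then have "degree (z i) < J" by (simp add: J_def)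
    then show ?thesis by (simp add: zc_def coeff_eq_0)
  qed
  then have "(?T ^^ Suc J) (zc J) i = 0" if "i < n" for i
    using funpow_mat_app_cong[where n = n and u = "zc J" and v = "\<lambda>_. 0" and i = i and a = a and j = "Suc J"] that
    by (simp add: funpow_mat_app_zero del: funpow.simps)
  then have "(\<Sum>j\<le>J. coeff E j * (?T ^^ j) y i) = 0" if "i < n" for i
    using tele[OF that, of J] that by simp
  moreover have "(\<Sum>j\<le>J. coeff E j * (?T ^^ j) y i) = (\<Sum>j\<le>degree E. coeff E j * (?T ^^ j) y i)" for i
    by (rule sum.mono_neutral_right) (auto simp: J_def mon coeff_eq_0)
  ultimately show ?thesis using that mon by auto
qed

text \<open>
  A form of Gauss's lemma: every prime factor of \<open>e\<close> divides \<open>p\<close> or its cofactor and can be cancelled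
  there, until \<open>p\<close> divides a monic polynomial and has a unit as leading coefficient.
\<close>

lemma lead_coeff_dvd_of_monic_multiple:
  fixes e :: "'k::field poly"
  assumes "smult e E = p * w" "lead_coeff E = 1" "e \<noteq> 0"
  shows "lead_coeff p dvd coeff p j"
  using assms
proof (induction "degree e" arbitrary: e p w j rule: less_induct)
  case less
  have lead: "e = lead_coeff p * lead_coeff w"
    using less.prems by (metis lead_coeff_mult lead_coeff_smult mult.right_neutral)
  show ?case
  proof (cases "e dvd 1")
    case True
    then have "lead_coeff p dvd 1" using lead by (metis dvd_mult_left)
    then show ?thesis by (meson dvd_trans one_dvd)
  next
    case False
    then obtain F where F: "mset_factors F e" using mset_factors_exist less.prems(3) by blast
    then obtain \<pi> where "\<pi> \<in># F" unfolding mset_factors_def by (meson multiset_nonemptyE)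
    with F have "irreducible \<pi>" "\<pi> dvd e" by (auto simp: mset_factors_def dvd_prod_mset)
    then have pr: "prime_elem \<pi>" by (simp add: prime_elem_iff_irreducible)
    obtain e1 where e1: "e = \<pi> * e1" using \<open>\<pi> dvd e\<close> by (elim dvdE)
    have deg\<pi>: "degree \<pi> > 0"
      using \<open>irreducible \<pi>\<close> is_unit_iff_degree[of \<pi>] irreducible_not_unit[of \<pi>] by fastforce
    have nz: "\<pi> \<noteq> 0" "e1 \<noteq> 0" using e1 less.prems(3) by auto
    have degle: "degree e1 < degree e" using nz deg\<pi> by (simp add: e1 degree_mult_eq)
    have "[:\<pi>:] dvd p * w" unfolding less.prems(1)[symmetric] e1
      by (rule dvdI[of _ _ "smult e1 E"]) (simp add: mult.commute)
    then have "[:\<pi>:] dvd p \<or> [:\<pi>:] dvd w"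
      using lift_prime_elem_poly[OF pr] by (simp add: prime_elem_dvd_mult_iff)
    then show ?thesis
    proof
      assume "[:\<pi>:] dvd p"
      then obtain p1 where p1: "p = smult \<pi> p1" by (auto elim!: dvdE)
      have "smult \<pi> (smult e1 E) = smult \<pi> (p1 * w)" using less.prems(1) by (simp add: p1 e1)
      then have "smult e1 E = p1 * w" using nz by (metis smult_cancel)
      from less.hyps[OF degle this less.prems(2) nz(2)] show ?thesis
        by (simp add: p1 nz)
    next
      assume "[:\<pi>:] dvd w"
      then obtain w1 where w1: "w = smult \<pi> w1" by (auto elim!: dvdE)
      have "smult \<pi> (smult e1 E) = smult \<pi> (p * w1)" using less.prems(1) by (simp add: w1 e1)
      then have "smult e1 E = p * w1" using nz by (metis smult_cancel)
      from less.hyps[OF degle this less.prems(2) nz(2)] show ?thesis .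
    qed
  qed
qed

lemma krylov_eval_mult_zero:
  fixes a :: "nat \<Rightarrow> nat \<Rightarrow> 'a::comm_ring_1" and y :: "nat \<Rightarrow> 'a" and n :: nat
  defines "ev \<equiv> \<lambda>P i. \<Sum>j\<le>degree P. coeff P j * (mat_app n a ^^ j) y i"
  assumes "\<And>i. i < n \<Longrightarrow> ev p i = 0" "i < n"
  shows "ev (p * q) i = 0"
proof -
  let ?T = "mat_app n a"
  have ev_ge: "ev P i = (\<Sum>j\<le>N. coeff P j * (?T ^^ j) y i)" if "degree P \<le> N" for P N i
    unfolding ev_def by (rule sum.mono_neutral_left) (use that in \<open>auto simp: coeff_eq_0\<close>)
  have add: "ev (P + R) i = ev P i + ev R i" for P R i
  proof -
    let ?N = "max (degree P) (degree R)"
    have "degree (P + R) \<le> ?N" by (rule degree_add_le) auto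
    then show ?thesis using ev_ge[of P ?N] ev_ge[of R ?N] ev_ge[of "P + R" ?N]
      by (simp add: sum.distrib distrib_right)
  qed
  have scale: "ev (smult c P) i = c * ev P i" for c P i
    using ev_ge[of "smult c P" "degree P"] ev_ge[of P "degree P"]
    by (simp add: degree_smult_le sum_distrib_left mult.assoc)
  have shift: "ev (pCons 0 P) i = ?T (ev P) i" for P i
  proof -
    have "ev (pCons 0 P) i = (\<Sum>j\<le>Suc (degree P). coeff (pCons 0 P) j * (?T ^^ j) y i)"
      by (rule ev_ge) (rule degree_pCons_le)
    also have "\<dots> = (\<Sum>j\<le>degree P. coeff P j * (\<Sum>l<n. a i l * (?T ^^ j) y l))"
      by (simp add: sum.atMost_Suc_shift mat_app_def del: sum.atMost_Suc)
    also have "\<dots> = ?T (ev P) i"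
      unfolding mat_app_def[of n a "ev P"]
      unfolding ev_def sum_distrib_left
      by (subst sum.swap) (simp add: mult_ac)
    finally show ?thesis .
  qed
  show ?thesis using assms(3)
  proof (induction q arbitrary: i)
    case 0
    then show ?case by (simp add: ev_def)
  next
    case (pCons c q)
    have "p * pCons c q = smult c p + pCons 0 (p * q)" by (simp add: mult.commute)
    then have "ev (p * pCons c q) i = c * ev p i + ?T (ev (p * q)) i"
      by (simp only: add scale shift)
    moreover have "?T (ev (p * q)) i = 0" using pCons.IH by (simp add: mat_app_def)
    ultimately show ?case using assms(2)[OF pCons.prems] by simp
  qed
qed

text \<open>
  Over \<open>K[t]\<close>, the relation of length \<open>m\<close> between the iterates of \<open>y\<close> has the leading coefficient \<open>G\<close>,
  but pseudo-division exhibits it as a divisor of a multiple of the monic Cayley--Hamilton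
  relation, the remainder being zero since shorter relations are excluded by the dual
  system. Hence \<open>G\<close> can be divided out.
\<close>

lemma krylov_relation_integral:
  fixes a :: "nat \<Rightarrow> nat \<Rightarrow> 'k::field poly" and y :: "nat \<Rightarrow> 'k poly" and n :: nat
  defines "w \<equiv> \<lambda>j. (mat_app n a ^^ j) y"
  assumes G: "G \<noteq> 0"
    and dual: "\<And>i j. i < m \<Longrightarrow> j < m \<Longrightarrow> (\<Sum>l<n. \<psi> i l * w j l) = (if i = j then G else 0)"
    and rel: "\<And>i. i < n \<Longrightarrow> G * w m i = (\<Sum>j<m. f j * w j i)"
    and "j < m"
  shows "G dvd f j"
proof -
  obtain E where E: "lead_coeff E = 1" "\<And>i. i < n \<Longrightarrow> (\<Sum>j\<le>degree E. coeff E j * w j i) = 0"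
    unfolding w_def using cayley_hamilton_krylov[of n a y] by blast
  define p where "p = monom G m - (\<Sum>j<m. monom (f j) j)"
  have cp: "coeff p k = (if k = m then G else if k < m then - f k else 0)" for k
    by (auto simp: p_def coeff_sum coeff_diff)
  have degp: "degree p = m"
  proof (rule antisym)
    show "degree p \<le> m" by (rule degree_le) (auto simp: cp)
    show "m \<le> degree p" by (rule le_degree) (use G in \<open>auto simp: cp\<close>)
  qed
  have evp: "(\<Sum>j\<le>degree p. coeff p j * w j i) = 0" if "i < n" for i
  proof -
    have "(\<Sum>j\<le>degree p. coeff p j * w j i) = (\<Sum>j<m. - f j * w j i) + G * w m i"
      unfolding degp by (simp add: cp lessThan_Suc_atMost[symmetric])
    then show ?thesis using rel[OF that] by (simp add: sum_negf)
  qed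
  obtain q r where qr: "pseudo_divmod E p = (q, r)" by fastforce
  have p0: "p \<noteq> 0" using G cp[of m] by auto
  define e where "e = lead_coeff p ^ (Suc (degree E) - degree p)"
  have div: "smult e E = p * q + r" "r = 0 \<or> degree r < degree p"
    using pseudo_divmod[OF p0 qr] by (auto simp: e_def)
  have e0: "e \<noteq> 0" using G by (simp add: e_def degp cp)
  let ?ev = "\<lambda>P i. \<Sum>j\<le>degree P. coeff P j * w j i"
  have "r = 0"
  proof (rule ccontr)
    assume "r \<noteq> 0"
    then have dr: "degree r < m" using div(2) degp by auto
    have evr: "?ev r i = 0" if i: "i < n" for i
    proof -
      define N where "N = max (degree (smult e E)) (max (degree (p * q)) (degree r))"
      have ext: "(\<Sum>j\<le>N. coeff P j * w j i) = ?ev P i" if "degree P \<le> N" for P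
        by (rule sum.mono_neutral_right) (use that in \<open>auto simp: coeff_eq_0\<close>)
      have "?ev (p * q) i = 0"
        using krylov_eval_mult_zero[of n p a y i q] evp i unfolding w_def by blast
      moreover have "?ev (smult e E) i = 0"
        using E(2)[OF i] e0 by (simp add: mult.assoc flip: sum_distrib_left)
      moreover have "(\<Sum>j\<le>N. coeff (smult e E) j * w j i) =
         (\<Sum>j\<le>N. coeff (p * q) j * w j i) + (\<Sum>j\<le>N. coeff r j * w j i)"
        unfolding div(1) by (simp add: distrib_right sum.distrib)
      ultimately show ?thesis using ext[of r] ext[of "p * q"] ext[of "smult e E"]
        by (simp add: N_def)
    qed
    have "coeff r k = 0" for k
    proof (cases "k \<le> degree r")
      case True
      then have k: "k < m" using dr by simp
      have "0 = (\<Sum>l<n. \<psi> k l * ?ev r l)" using evr by simp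
      also have "\<dots> = (\<Sum>j\<le>degree r. coeff r j * (\<Sum>l<n. \<psi> k l * w j l))"
        unfolding sum_distrib_left by (subst sum.swap) (simp add: mult_ac)
      also have "\<dots> = (\<Sum>j\<le>degree r. if j = k then coeff r k * G else 0)"
        by (rule sum.cong) (use dr k in \<open>auto simp: dual\<close>)
      also have "\<dots> = coeff r k * G" using True by simp
      finally show ?thesis using G by simp
    qed (simp add: coeff_eq_0)
    then have "r = 0" by (simp add: poly_eq_iff)
    then show False using \<open>r \<noteq> 0\<close> by simp
  qed
  then have "smult e E = p * q" using div(1) by simp
  from lead_coeff_dvd_of_monic_multiple[OF this E(1) e0, of j]
  show ?thesis using \<open>j < m\<close> by (simp add: degp cp)
qed

lemma indep_if_dual:
  fixes v :: "nat \<Rightarrow> nat \<Rightarrow> 'a::idom"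
  assumes "\<And>i j. i < m \<Longrightarrow> j < m \<Longrightarrow> (\<Sum>l<n. \<psi> i l * v j l) = (if i = j then g else 0)" "g \<noteq> 0"
  shows "indep n m v"
  unfolding indep_def
proof (intro allI impI)
  fix a i assume a: "\<forall>l<n. (\<Sum>j<m. a j * v j l) = 0" "i < m"
  have "0 = (\<Sum>l<n. \<psi> i l * (\<Sum>j<m. a j * v j l))" using a by simp
  also have "\<dots> = (\<Sum>j<m. a j * (\<Sum>l<n. \<psi> i l * v j l))"
    unfolding sum_distrib_left by (subst sum.swap) (simp add: mult_ac)
  also have "\<dots> = (\<Sum>j<m. if j = i then a i * g else 0)"
    by (rule sum.cong) (use a assms(1) in auto)
  also have "\<dots> = a i * g" using a by simp
  finally show "a i = 0" using assms(2) by simp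
qed

lemma dependent_last_coeffs:
  fixes v :: "nat \<Rightarrow> nat \<Rightarrow> 'k::field"
  assumes dual: "\<And>i j. i < m \<Longrightarrow> j < m \<Longrightarrow> (\<Sum>l<n. \<psi> i l * v j l) = (if i = j then g else 0)"
    and g: "g \<noteq> 0" and dep: "\<not> indep n (Suc m) v" and "i < n"
  shows "g * v m i = (\<Sum>j<m. (\<Sum>l<n. \<psi> j l * v m l) * v j i)"
proof -
  obtain a where a: "\<And>l. l < n \<Longrightarrow> (\<Sum>j<Suc m. a j * v j l) = 0" "\<exists>j<Suc m. a j \<noteq> 0"
    using dep by (auto simp: indep_def)
  have am: "a m \<noteq> 0"
  proof
    assume "a m = 0"
    then have "\<forall>l<n. (\<Sum>j<m. a j * v j l) = 0" using a(1) by auto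
    moreover have "indep n m v"
      by (rule indep_if_dual[where m = m and n = n and \<psi> = \<psi> and v = v and g = g]) (use dual g in auto)
    ultimately have "\<forall>j<m. a j = 0" unfolding indep_def by blast
    then show False using a(2) \<open>a m = 0\<close> by (auto simp: less_Suc_eq)
  qed
  define b where "b j = - a j / a m" for j
  have vm: "v m l = (\<Sum>j<m. b j * v j l)" if "l < n" for l
  proof -
    have "a m * v m l = - (\<Sum>j<m. a j * v j l)" using a(1)[OF that] by (simp add: eq_neg_iff_add_eq_0 add.commute)
    also have "\<dots> = a m * (\<Sum>j<m. b j * v j l)"
      using am by (auto simp: b_def sum_distrib_left sum_negf[symmetric] intro!: sum.cong)
    finally show ?thesis using am by simp
  qed
  have "(\<Sum>l<n. \<psi> j l * v m l) = b j * g" if "j < m" for j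
  proof -
    have "(\<Sum>l<n. \<psi> j l * v m l) = (\<Sum>l<n. \<psi> j l * (\<Sum>k<m. b k * v k l))" using vm by simp
    also have "\<dots> = (\<Sum>k<m. b k * (\<Sum>l<n. \<psi> j l * v k l))"
      unfolding sum_distrib_left by (subst sum.swap) (simp add: mult_ac)
    also have "\<dots> = (\<Sum>k<m. if k = j then b j * g else 0)"
      by (rule sum.cong) (use that dual in auto)
    finally show ?thesis using that by simp
  qed
  then show ?thesis using vm[OF \<open>i < n\<close>] by (simp add: sum_distrib_left mult_ac)
qed

text \<open>
  The dual system expresses the coefficients of the relation between the first \<open>m + 1\<close> iterates as
  rational functions \<open>f j / g\<close> with \<open>g b0 \<noteq> 0\<close>. On each line through \<open>b0\<close> the quotient is a polynomial
  in the line parameter by \<open>krylov_relation_integral\<close>. Its power series coefficients at \<open>b0\<close> are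
  polynomial in the direction of the line because only \<open>g b0\<close> is inverted, and only boundedly many of
  them are nonzero; their sum is the value at the end of the line.
\<close>

theorem generic_krylov_relation:
  fixes a :: "nat \<Rightarrow> nat \<Rightarrow> (nat \<Rightarrow> 'k::field) \<Rightarrow> 'k" and y :: "nat \<Rightarrow> 'k" and n :: nat
  defines "w \<equiv> \<lambda>j x. (mat_app n (\<lambda>i l. a i l x) ^^ j) y"
  assumes inf: "infinite (UNIV :: 'k set)"
    and a: "\<And>i l. a i l \<in> polyfuns N"
    and ind: "indep n m (\<lambda>j. w j b0)"
    and dep: "\<And>x. \<not> indep n (Suc m) (\<lambda>j. w j x)"
  shows "\<exists>c g. (\<forall>j<m. c j \<in> polyfuns N) \<and> g \<in> polyfuns N \<and> g b0 \<noteq> 0 \<and>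
    (\<forall>x. \<forall>i<n. w m x i = (\<Sum>j<m. c j x * w j x i)) \<and>
    (\<forall>x. g x \<noteq> 0 \<longrightarrow> indep n m (\<lambda>j. w j x))"
proof -
  note pf = fun_ring_polyfuns[of N]
  have wpf: "(\<lambda>x. w j x l) \<in> polyfuns N" for j l
    by (induction j arbitrary: l) (auto simp: w_def mat_app_def intro!: fun_ring_intros pf a)
  have "\<exists>\<psi> g. (\<forall>i<m. \<forall>l<n. (\<lambda>p. \<psi> i p l) \<in> polyfuns N) \<and> g \<in> polyfuns N \<and> g b0 \<noteq> 0 \<and>
     (\<forall>p. \<forall>i<m. \<forall>j<m. (\<Sum>l<n. \<psi> i p l * w j p l) = (if i = j then g p else 0))"
    by (rule dual_system_exists[where w = w and ?p0.0 = b0, OF pf _ ind]) (rule wpf)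
  then obtain \<psi> g where \<psi>: "\<And>i l. i < m \<Longrightarrow> l < n \<Longrightarrow> (\<lambda>x. \<psi> i x l) \<in> polyfuns N"
    and g: "g \<in> polyfuns N" "g b0 \<noteq> 0"
    and dual: "\<And>x i j. i < m \<Longrightarrow> j < m \<Longrightarrow> (\<Sum>l<n. \<psi> i x l * w j x l) = (if i = j then g x else 0)"
    by blast
  define f where "f j x = (\<Sum>l<n. \<psi> j x l * w m x l)" for j x
  have fpf: "f j \<in> polyfuns N" if "j < m" for j
    unfolding f_def by (intro fun_ring_intros pf wpf \<psi> that) auto
  have rel: "g x * w m x i = (\<Sum>j<m. f j x * w j x i)" if "g x \<noteq> 0" "i < n" for x i
    unfolding f_def by (rule dependent_last_coeffs[where m = m and n = n and \<psi> = "\<lambda>i. \<psi> i x" and v = "\<lambda>j. w j x" and g = "g x"])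
      (use dual dep that in auto)
  let ?line = "\<lambda>x t i. b0 i + t * x i"
  define P where "P h \<Phi> N' \<longleftrightarrow> (\<forall>x t. poly (\<Phi> x) t = h (?line x t)) \<and> (\<forall>x. degree (\<Phi> x) \<le> N') \<and>
     (\<forall>l. (\<lambda>x. coeff (\<Phi> x) l) \<in> polyfuns N)" for h and \<Phi> :: "(nat \<Rightarrow> 'k) \<Rightarrow> 'k poly" and N' :: nat
  \<comment> \<open>A choice, for each polynomial function \<open>h\<close>, of its expansion along the lines through \<open>b0\<close> and of
    a degree bound for it.\<close>
  define L where "L h = (SOME \<Phi>. \<exists>N'. P h \<Phi> N')" for h
  define D where "D h = (SOME N'. P h (L h) N')" for h
  have PL: "P h (L h) (D h)" if h: "h \<in> polyfuns N" for h
  proof (rule polyfuns_line_expansion[OF h, where b = b0])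
    fix \<Phi> N' assume "\<And>x t. poly (\<Phi> x) t = h (?line x t)" "\<And>x. degree (\<Phi> x) \<le> N'"
      "\<And>l. (\<lambda>x. coeff (\<Phi> x) l) \<in> polyfuns N"
    then have "P h \<Phi> N'" by (simp add: P_def)
    then have "\<exists>\<Phi> N'. P h \<Phi> N'" by blast
    then have "\<exists>N'. P h (L h) N'" unfolding L_def by (rule someI_ex)
    then show ?thesis unfolding D_def by (rule someI_ex)
  qed
  have L: "poly (L h x) t = h (?line x t)"
    and D: "degree (L h x) \<le> D h"
    and Lc: "(\<lambda>x. coeff (L h x) l) \<in> polyfuns N" if "h \<in> polyfuns N" for h x t l
    using PL[OF that] by (auto simp: P_def)
  define W where "W x j = (mat_app n (\<lambda>i l. L (a i l) x) ^^ j) (\<lambda>i. [:y i:])" for x j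
  have W: "poly (W x j i) t = w j (?line x t) i" for x j i t
    by (induction j arbitrary: i) (auto simp: W_def w_def mat_app_def poly_sum L a)
  have Gnz: "L g x \<noteq> 0" for x
  proof -
    have "poly (L g x) 0 = g b0" using L[OF g(1), of x 0] by simp
    then show ?thesis using g(2) by auto
  qed
  have relL: "L g x * W x m i = (\<Sum>j<m. L (f j) x * W x j i)" if "i < n" for x i
  proof -
    have "L g x * (L g x * W x m i - (\<Sum>j<m. L (f j) x * W x j i)) = 0"
    proof (rule poly_zeroI_infinite[OF inf])
      fix t
      show "poly (L g x * (L g x * W x m i - (\<Sum>j<m. L (f j) x * W x j i))) t = 0"
        using rel[of "?line x t" i] that by (auto simp: poly_sum L g fpf W)
    qed
    then show ?thesis using Gnz[of x] by simp
  qed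
  have dvd: "L g x dvd L (f j) x" if "j < m" for x j
  proof (rule krylov_relation_integral[where ?n = n and ?m = m and ?f = "\<lambda>j. L (f j) x"])
    show "L g x \<noteq> 0" by (rule Gnz)
    show "(\<Sum>l<n. L (\<lambda>x. \<psi> i x l) x * (mat_app n (\<lambda>i l. L (a i l) x) ^^ j) (\<lambda>i. [:y i:]) l) =
        (if i = j then L g x else 0)" if "i < m" "j < m" for i j
    proof (rule poly_eqI_infinite[OF inf])
      fix t
      show "poly (\<Sum>l<n. L (\<lambda>x. \<psi> i x l) x * (mat_app n (\<lambda>i l. L (a i l) x) ^^ j) (\<lambda>i. [:y i:]) l) t =
         poly (if i = j then L g x else 0) t"
        using dual[OF that, of "?line x t"]
        by (auto simp: poly_sum L \<psi> that g W[unfolded W_def])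
    qed
  qed (use relL that in \<open>auto simp: W_def\<close>)
  \<comment> \<open>The quotient restricted to the line from \<open>b0\<close> in direction \<open>x\<close>.\<close>
  define C where "C j x = L (f j) x div L g x" for j x
  have GC: "L (f j) x = L g x * C j x" if "j < m" for j x
    using dvd[OF that, of x] by (simp add: C_def)
  have coeffG0: "coeff (L g x) 0 = g b0" for x
    using L[OF g(1), of x 0] by (simp add: poly_0_coeff_0)
  have Cpf: "(\<lambda>x. coeff (C j x) l) \<in> polyfuns N" if "j < m" for j l
  proof (induction l rule: less_induct)
    case (less l)
    have "coeff (C j x) l = inverse (g b0) * (coeff (L (f j) x) l -
       (\<Sum>i<l. coeff (L g x) (Suc i) * coeff (C j x) (l - Suc i)))" for x
    proof -
      have "coeff (L (f j) x) l = (\<Sum>i\<le>l. coeff (L g x) i * coeff (C j x) (l - i))"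
        by (simp add: GC[OF that] coeff_mult)
      also have "\<dots> = g b0 * coeff (C j x) l + (\<Sum>i<l. coeff (L g x) (Suc i) * coeff (C j x) (l - Suc i))"
        by (simp add: sum.atMost_shift coeffG0)
      finally show ?thesis using g(2) by (simp add: field_simps)
    qed
    moreover have "(\<lambda>x. inverse (g b0) * (coeff (L (f j) x) l -
       (\<Sum>i<l. coeff (L g x) (Suc i) * coeff (C j x) (l - Suc i)))) \<in> polyfuns N"
      by (intro fun_ring_intros pf Lc g fpf that less) auto
    ultimately show ?case by simp
  qed
  have Cdeg: "degree (C j x) \<le> D (f j)" if "j < m" for j x
  proof (cases "C j x = 0")
    case False
    then have "degree (L (f j) x) = degree (L g x) + degree (C j x)"
      using Gnz[of x] by (simp add: GC[OF that] degree_mult_eq)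
    then show ?thesis using D[OF fpf[OF that], of x] by simp
  qed simp
  define c where "c j x = (\<Sum>l\<le>D (f j). coeff (C j (\<lambda>i. x i - b0 i)) l)" for j x
  have cpoly: "c j x = poly (C j (\<lambda>i. x i - b0 i)) 1" if "j < m" for j x
    unfolding c_def poly_altdef using Cdeg[OF that]
    by (auto simp: coeff_eq_0 intro!: sum.mono_neutral_right le_degree)
  have "c j \<in> polyfuns N" if "j < m" for j
    unfolding c_def
    by (intro fun_ring_sum[OF pf] polyfuns_compose[OF Cpf[OF that] pf, where \<phi> = "\<lambda>x i. x i - b0 i"])
      (intro fun_ring_diff[OF pf] polyfuns_var fun_ring_const[OF pf])
  moreover have "w m x i = (\<Sum>j<m. c j x * w j x i)" if i: "i < n" for x i
  proof -
    let ?x = "\<lambda>i. x i - b0 i"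
    have "L g ?x * W ?x m i = L g ?x * (\<Sum>j<m. C j ?x * W ?x j i)"
      unfolding relL[OF i] sum_distrib_left by (rule sum.cong) (auto simp: GC)
    then have "W ?x m i = (\<Sum>j<m. C j ?x * W ?x j i)" using Gnz[of ?x] by simp
    then have "poly (W ?x m i) 1 = poly (\<Sum>j<m. C j ?x * W ?x j i) 1" by simp
    then show ?thesis by (simp add: poly_sum W cpoly)
  qed
  moreover have "indep n m (\<lambda>j. w j x)" if "g x \<noteq> 0" for x
    by (rule indep_if_dual[where m = m and n = n and \<psi> = "\<lambda>i. \<psi> i x" and g = "g x"]) (use dual that in auto)
  ultimately show ?thesis using g by blast
qed

section \<open>Algebras with a chosen basis\<close>

lemma homogeneous_system_nontrivial:
  fixes v :: "'j \<Rightarrow> 'l \<Rightarrow> 'k::field"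
  assumes "finite L" "finite J" "card L < card J"
  shows "\<exists>a. (\<exists>j\<in>J. a j \<noteq> 0) \<and> (\<forall>l\<in>L. (\<Sum>j\<in>J. a j * v j l) = 0)"
  using assms
proof (induction L arbitrary: J v rule: finite_induct)
  case empty
  then have "J \<noteq> {}" by auto
  then show ?case by (intro exI[of _ "\<lambda>_. 1"]) auto
next
  case (insert l0 L)
  show ?case
  proof (cases "\<forall>j\<in>J. v j l0 = 0")
    case True
    have "card L < card J" using insert by simp
    with insert.IH[of J v] insert.prems(1) True show ?thesis by auto
  next
    case False
    then obtain j0 where j0: "j0 \<in> J" "v j0 l0 \<noteq> 0" by auto
    let ?J = "J - {j0}"
    define v' where "v' j l = v j l - v j l0 / v j0 l0 * v j0 l" for j l
    have "card L < card ?J" using insert j0 by simp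
    from insert.IH[OF _ this, of v'] insert.prems obtain a where
      a: "\<exists>j\<in>?J. a j \<noteq> 0" "\<And>l. l \<in> L \<Longrightarrow> (\<Sum>j\<in>?J. a j * v' j l) = 0" by auto
    define b where "b = a(j0 := - (\<Sum>j\<in>?J. a j * v j l0) / v j0 l0)"
    have split: "(\<Sum>j\<in>J. b j * v j l) = b j0 * v j0 l + (\<Sum>j\<in>?J. a j * v j l)" for l
      using j0 insert.prems(1) by (auto simp: b_def sum.remove intro!: sum.cong)
    have "(\<Sum>j\<in>J. b j * v j l) = 0" if "l \<in> insert l0 L" for l
    proof (cases "l = l0")
      case True
      then show ?thesis unfolding split using j0 by (simp add: b_def)
    next
      case False
      have "(\<Sum>j\<in>?J. a j * v' j l) = (\<Sum>j\<in>?J. a j * v j l) - (\<Sum>j\<in>?J. a j * v j l0) / v j0 l0 * v j0 l"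
        by (simp add: v'_def right_diff_distrib sum_subtractf sum_distrib_right sum_divide_distrib mult.assoc)
      then show ?thesis unfolding split using a(2)[of l] that False by (simp add: b_def)
    qed
    moreover have "\<exists>j\<in>J. b j \<noteq> 0" using a(1) by (auto simp: b_def)
    ultimately show ?thesis by blast
  qed
qed

lemma indep_le:
  fixes v :: "nat \<Rightarrow> nat \<Rightarrow> 'k::field"
  assumes "indep n m v" shows "m \<le> n"
proof (rule ccontr)
  assume "\<not> m \<le> n"
  then have "\<exists>a. (\<exists>j\<in>{..<m}. a j \<noteq> 0) \<and> (\<forall>l\<in>{..<n}. (\<Sum>j\<in>{..<m}. a j * v j l) = 0)"
    by (intro homogeneous_system_nontrivial) auto
  then obtain a j where a: "j < m" "a j \<noteq> 0" "\<And>l. l < n \<Longrightarrow> (\<Sum>j<m. a j * v j l) = 0" by auto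
  then show False using assms[unfolded indep_def, rule_format, of a j] by blast
qed

text \<open>
  For \<open>m\<close> the degree of \<open>A\<close> these are the elements whose minimal polynomial has the maximal degree.
\<close>

definition full :: "('k::field, 'a) module \<Rightarrow> nat \<Rightarrow> 'a \<Rightarrow> bool" where
  "full A m b \<longleftrightarrow> (\<forall>p. alg_eval A b p = \<zero>\<^bsub>A\<^esub> \<longrightarrow> degree p < m \<longrightarrow> p = 0)"

locale based_algebra = assoc_algebra "class_ring :: 'k::field ring" A
  for A :: "('k::field, 'a) module" (structure) +
  fixes us :: "'a list"
  assumes basis: "ordered_basis A us"
begin

abbreviation "n \<equiv> length us"
abbreviation "cf b i \<equiv> coords A us b $ i"

text \<open>
  The inverse of the coordinate map.
\<close>

definition elem :: "(nat \<Rightarrow> 'k) \<Rightarrow> 'a" where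
  "elem x = finsum A (\<lambda>i. x i \<odot> us ! i) {..<n}"

lemma AM: "abelian_monoid A"
  by (rule abelian_group.axioms(1)) (rule ring.axioms(1), rule ring_axioms)

lemmas fs_insert = abelian_monoid.finsum_insert[OF AM]
  and fs_closed = abelian_monoid.finsum_closed[OF AM]
  and fs_cong = abelian_monoid.finsum_cong'[OF AM]
  and fs_addf = abelian_monoid.finsum_addf[OF AM]
  and fs_empty = abelian_monoid.finsum_empty[OF AM]
  and fs_reindex = abelian_monoid.finsum_reindex[OF AM]

lemma sm_closed [simp, intro]: "x \<in> carrier A \<Longrightarrow> c \<odot> x \<in> carrier A"
  using smult_closed[of c x] by simp

lemma sm_add: "x \<in> carrier A \<Longrightarrow> (c + d) \<odot> x = c \<odot> x \<oplus> d \<odot> x"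
  using smult_l_distr[of c d x] by simp

lemma sm_add2: "x \<in> carrier A \<Longrightarrow> y \<in> carrier A \<Longrightarrow> c \<odot> (x \<oplus> y) = c \<odot> x \<oplus> c \<odot> y"
  using smult_r_distr[of c x y] by simp

lemma sm_assoc: "x \<in> carrier A \<Longrightarrow> (c * d) \<odot> x = c \<odot> (d \<odot> x)"
  using smult_assoc1[of c d x] by simp

lemma sm_zero: "x \<in> carrier A \<Longrightarrow> 0 \<odot> x = \<zero>"
  using smult_l_null[of x] by simp

lemma sm_one: "x \<in> carrier A \<Longrightarrow> 1 \<odot> x = x"
  using smult_one[of x] by simp

lemma sm_mult1: "x \<in> carrier A \<Longrightarrow> y \<in> carrier A \<Longrightarrow> (c \<odot> x) \<otimes> y = c \<odot> (x \<otimes> y)"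
  using smult_mult_left[of c x y] by simp

lemma sm_mult2: "x \<in> carrier A \<Longrightarrow> y \<in> carrier A \<Longrightarrow> x \<otimes> (c \<odot> y) = c \<odot> (x \<otimes> y)"
  using smult_mult_right[of c x y] by simp

lemma basis_facts: "distinct us" "lin_indpt (set us)" "span (set us) = carrier A" "set us \<subseteq> carrier A"
  using basis by (auto simp: ordered_basis_def basis_def)

lemma us_closed [simp, intro]: "i < n \<Longrightarrow> us ! i \<in> carrier A"
  using basis_facts(4) by auto

lemma elem_closed [simp, intro]: "elem x \<in> carrier A"
  unfolding elem_def by (rule fs_closed) auto

lemma elem_cong: "(\<And>i. i < n \<Longrightarrow> x i = y i) \<Longrightarrow> elem x = elem y"
  unfolding elem_def by (rule fs_cong) auto

lemma elem_add: "elem (\<lambda>i. x i + y i) = elem x \<oplus> elem y"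
proof -
  have "elem (\<lambda>i. x i + y i) = finsum A (\<lambda>i. x i \<odot> us ! i \<oplus> y i \<odot> us ! i) {..<n}"
    unfolding elem_def by (rule fs_cong) (auto simp: sm_add)
  also have "\<dots> = elem x \<oplus> elem y"
    unfolding elem_def by (rule fs_addf) auto
  finally show ?thesis .
qed

lemma elem_smult: "elem (\<lambda>i. c * x i) = c \<odot> elem x"
proof -
  have "finsum A (\<lambda>i. (c * x i) \<odot> us ! i) S = c \<odot> finsum A (\<lambda>i. x i \<odot> us ! i) S" if "finite S" "S \<subseteq> {..<n}" for S
    using that
  proof (induction S rule: finite_induct)
    case empty
    then show ?case using smult_r_null[of c] by (simp add: fs_empty)
  next
    case (insert i S)
    have 1: "(\<lambda>i. (c * x i) \<odot> us ! i) \<in> S \<rightarrow> carrier A" "(\<lambda>i. x i \<odot> us ! i) \<in> S \<rightarrow> carrier A"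
      "us ! i \<in> carrier A" using insert.prems by auto
    have "finsum A (\<lambda>i. (c * x i) \<odot> us ! i) (insert i S) = (c * x i) \<odot> us ! i \<oplus> finsum A (\<lambda>i. (c * x i) \<odot> us ! i) S"
      by (rule fs_insert) (use insert 1 in auto)
    also have "\<dots> = c \<odot> (x i \<odot> us ! i) \<oplus> c \<odot> finsum A (\<lambda>i. x i \<odot> us ! i) S"
      using insert 1 by (simp add: sm_assoc)
    also have "\<dots> = c \<odot> (x i \<odot> us ! i \<oplus> finsum A (\<lambda>i. x i \<odot> us ! i) S)"
      using 1 fs_closed[of "\<lambda>i. x i \<odot> us ! i" S] by (simp add: sm_add2)
    also have "x i \<odot> us ! i \<oplus> finsum A (\<lambda>i. x i \<odot> us ! i) S = finsum A (\<lambda>i. x i \<odot> us ! i) (insert i S)"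
      by (rule fs_insert[symmetric]) (use insert 1 in auto)
    finally show ?case .
  qed
  then show ?thesis unfolding elem_def by simp
qed

lemma lincomb_elem: "lincomb a (set us) = elem (\<lambda>i. a (us ! i))"
proof -
  have img: "(!) us ` {..<n} = set us" by (auto simp: set_conv_nth)
  have "inj_on ((!) us) {..<n}" using basis_facts(1) by (auto simp: inj_on_def nth_eq_iff_index_eq)
  then have "finsum A (\<lambda>v. a v \<odot> v) ((!) us ` {..<n}) = finsum A (\<lambda>i. a (us ! i) \<odot> us ! i) {..<n}"
    by (intro fs_reindex) auto
  then show ?thesis unfolding lincomb_def elem_def img .
qed

lemma elem_eq_zero: 
  assumes "elem x = \<zero>" "i < n" shows "x i = 0"
proof (rule ccontr)
  assume ne: "x i \<noteq> 0"
  define a where "a v = x (the_inv_into {..<n} ((!) us) v)" for v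
  have inj: "inj_on ((!) us) {..<n}" using basis_facts(1) by (auto simp: inj_on_def nth_eq_iff_index_eq)
  have a: "a (us ! i) = x i" if "i < n" for i
    using the_inv_into_f_f[OF inj, of i] that by (simp add: a_def)
  have "lincomb a (set us) = elem x"
    unfolding lincomb_elem by (rule elem_cong) (rule a)
  then have "lincomb a (set us) = \<zero>" using assms by simp
  then have "lin_dep (set us)"
    by (intro lin_dep_crit[of "set us" "set us" a "us ! i"]) (use assms ne a in auto)
  then show False using basis_facts(2) by simp
qed

lemma elem_surj: assumes "b \<in> carrier A" obtains x where "elem x = b"
proof -
  have "b \<in> span (set us)" using assms basis_facts(3) by simp
  then obtain a where "b = lincomb a (set us)"
    using finite_span[of "set us"] basis_facts(4) by auto
  then show ?thesis using that lincomb_elem by metis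
qed

lemma elem_inj: assumes "elem x = elem y" "i < n" shows "x i = y i"
proof -
  have "elem (\<lambda>i. x i + (-1) * y i) = elem x \<oplus> (-1) \<odot> elem y"
    by (simp only: elem_add elem_smult)
  also have "\<dots> = 1 \<odot> elem y \<oplus> (-1) \<odot> elem y" by (simp add: assms(1) sm_one)
  also have "\<dots> = (1 + (-1)) \<odot> elem y" by (rule sm_add[symmetric]) simp
  also have "\<dots> = \<zero>" by (simp add: sm_zero)
  finally show ?thesis using elem_eq_zero[of "\<lambda>i. x i + (-1) * y i" i] assms(2) by simp
qed

lemma coords_spec:
  assumes "b \<in> carrier A"
  shows "coords A us b \<in> carrier_vec n" "elem (\<lambda>i. cf b i) = b"
proof -
  obtain x where x: "elem x = b" using elem_surj[OF assms] .
  have "\<exists>!x. x \<in> carrier_vec n \<and> (\<Oplus> i \<in> {..<n}. (x $ i) \<odot> (us ! i)) = b"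
  proof (rule ex1I[of _ "vec n x"])
    have "elem (\<lambda>i. vec n x $ i) = b" unfolding x[symmetric] by (rule elem_cong) simp
    then show "vec n x \<in> carrier_vec n \<and> (\<Oplus> i \<in> {..<n}. (vec n x $ i) \<odot> (us ! i)) = b"
      by (simp add: elem_def)
  next
    fix y assume y: "y \<in> carrier_vec n \<and> (\<Oplus> i \<in> {..<n}. (y $ i) \<odot> (us ! i)) = b"
    then have "elem (\<lambda>i. y $ i) = elem x" by (simp add: elem_def x[unfolded elem_def])
    then have "y $ i = x i" if "i < n" for i using elem_inj that by blast
    then show "y = vec n x" using y by (intro eq_vecI) auto
  qed
  from theI'[OF this] show "coords A us b \<in> carrier_vec n" "elem (\<lambda>i. cf b i) = b"
    unfolding coords_def elem_def by auto
qed

lemma elem_cf: "b \<in> carrier A \<Longrightarrow> elem (\<lambda>i. cf b i) = b"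
  by (rule coords_spec)

lemma cf_elem: "i < n \<Longrightarrow> cf (elem x) i = x i"
  using elem_inj[OF elem_cf[OF elem_closed]] by blast

lemma cf_eqI: "a \<in> carrier A \<Longrightarrow> b \<in> carrier A \<Longrightarrow> (\<And>i. i < n \<Longrightarrow> cf a i = cf b i) \<Longrightarrow> a = b"
  using elem_cong[of "\<lambda>i. cf a i" "\<lambda>i. cf b i"] by (simp add: elem_cf)

lemma cf_add: "a \<in> carrier A \<Longrightarrow> b \<in> carrier A \<Longrightarrow> i < n \<Longrightarrow> cf (a \<oplus> b) i = cf a i + cf b i"
  using cf_elem[of i "\<lambda>i. cf a i + cf b i"] by (simp add: elem_add elem_cf)

lemma cf_smult: "a \<in> carrier A \<Longrightarrow> i < n \<Longrightarrow> cf (c \<odot> a) i = c * cf a i"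
  using cf_elem[of i "\<lambda>i. c * cf a i"] by (simp add: elem_smult elem_cf)

lemma cf_zero: "i < n \<Longrightarrow> cf \<zero> i = 0"
  using cf_smult[of \<zero> i 0] sm_zero[of \<zero>] by simp

lemma cf_finsum:
  assumes "finite S" "f \<in> S \<rightarrow> carrier A" "i < n"
  shows "cf (finsum A f S) i = (\<Sum>s\<in>S. cf (f s) i)"
  using assms(1,2)
proof (induction S rule: finite_induct)
  case empty
  then show ?case using assms(3) by (simp add: fs_empty cf_zero)
next
  case (insert s S)
  have "finsum A f (insert s S) = f s \<oplus> finsum A f S" by (rule fs_insert) (use insert in auto)
  moreover have "finsum A f S \<in> carrier A" by (rule fs_closed) (use insert in auto)
  ultimately show ?case using insert assms(3) by (simp add: cf_add)
qed

definition sc :: "nat \<Rightarrow> nat \<Rightarrow> nat \<Rightarrow> 'k" where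
  "sc i j l = cf (us ! i \<otimes> us ! j) l"

lemma cf_mult_left:
  assumes "a \<in> carrier A" "b \<in> carrier A" "l < n"
  shows "cf (a \<otimes> b) l = (\<Sum>i<n. cf a i * cf (us ! i \<otimes> b) l)"
proof -
  have "a \<otimes> b = finsum A (\<lambda>i. cf a i \<odot> us ! i) {..<n} \<otimes> b"
    using elem_cf[OF assms(1)] by (simp add: elem_def)
  also have "\<dots> = finsum A (\<lambda>i. (cf a i \<odot> us ! i) \<otimes> b) {..<n}"
    by (rule finsum_ldistr) (use assms in auto)
  finally have "cf (a \<otimes> b) l = (\<Sum>i<n. cf ((cf a i \<odot> us ! i) \<otimes> b) l)"
    using cf_finsum[of "{..<n}" "\<lambda>i. (cf a i \<odot> us ! i) \<otimes> b" l] assms by simp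
  also have "\<dots> = (\<Sum>i<n. cf a i * cf (us ! i \<otimes> b) l)"
    by (rule sum.cong) (use assms in \<open>auto simp: sm_mult1 cf_smult\<close>)
  finally show ?thesis .
qed

lemma cf_mult_right:
  assumes "a \<in> carrier A" "b \<in> carrier A" "l < n"
  shows "cf (a \<otimes> b) l = (\<Sum>j<n. cf b j * cf (a \<otimes> us ! j) l)"
proof -
  have "a \<otimes> b = a \<otimes> finsum A (\<lambda>i. cf b i \<odot> us ! i) {..<n}"
    using elem_cf[OF assms(2)] by (simp add: elem_def)
  also have "\<dots> = finsum A (\<lambda>i. a \<otimes> (cf b i \<odot> us ! i)) {..<n}"
    by (rule finsum_rdistr) (use assms in auto)
  finally have "cf (a \<otimes> b) l = (\<Sum>i<n. cf (a \<otimes> (cf b i \<odot> us ! i)) l)"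
    using cf_finsum[of "{..<n}" "\<lambda>i. a \<otimes> (cf b i \<odot> us ! i)" l] assms by simp
  also have "\<dots> = (\<Sum>j<n. cf b j * cf (a \<otimes> us ! j) l)"
    by (rule sum.cong) (use assms in \<open>auto simp: sm_mult2 cf_smult\<close>)
  finally show ?thesis .
qed

lemma cf_mult:
  assumes "a \<in> carrier A" "b \<in> carrier A" "l < n"
  shows "cf (a \<otimes> b) l = (\<Sum>i<n. \<Sum>j<n. cf a i * cf b j * sc i j l)"
  unfolding cf_mult_left[OF assms]
  by (intro sum.cong refl, subst cf_mult_right)
    (use assms in \<open>auto simp: sc_def sum_distrib_left mult.assoc\<close>)

text \<open>
  The matrix of multiplication by the element with coordinates \<open>x\<close> from the right.
\<close>

definition rmat :: "(nat \<Rightarrow> 'k) \<Rightarrow> nat \<Rightarrow> nat \<Rightarrow> 'k" where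
  "rmat x l i = (\<Sum>j<n. x j * sc i j l)"

lemma cf_mult_rmat:
  assumes "a \<in> carrier A" "b \<in> carrier A" "l < n"
  shows "cf (a \<otimes> b) l = mat_app n (rmat (\<lambda>i. cf b i)) (\<lambda>i. cf a i) l"
  unfolding cf_mult[OF assms] mat_app_def rmat_def sum_distrib_right
  by (intro sum.cong refl) (simp add: mult_ac)

text \<open>
  The coordinates of the \<open>j\<close>-th power of the element with coordinates \<open>x\<close>, as the \<open>j\<close>-th iterate of a
  linear map that depends polynomially on \<open>x\<close>.
\<close>

definition krylov :: "nat \<Rightarrow> (nat \<Rightarrow> 'k) \<Rightarrow> nat \<Rightarrow> 'k" where
  "krylov j x = (mat_app n (\<lambda>i l. rmat x i l) ^^ j) (\<lambda>i. cf \<one> i)"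

lemma cf_pow:
  assumes "b \<in> carrier A" "l < n"
  shows "cf (b [^] j) l = krylov j (\<lambda>i. cf b i) l"
  using assms(2)
proof (induction j arbitrary: l)
  case (Suc j)
  have "cf (b [^] Suc j) l = mat_app n (rmat (\<lambda>i. cf b i)) (\<lambda>i. cf (b [^] j) i) l"
    using cf_mult_rmat[of "b [^] j" b l] assms Suc.prems by simp
  also have "\<dots> = mat_app n (rmat (\<lambda>i. cf b i)) (krylov j (\<lambda>i. cf b i)) l"
    using mat_app_cong[of n "\<lambda>i. cf (b [^] j) i" "krylov j (\<lambda>i. cf b i)"] Suc.IH by simp
  finally show ?case by (simp add: krylov_def)
qed (simp add: krylov_def)

lemma krylov_cong:
  assumes "\<And>i. i < n \<Longrightarrow> x i = y i" shows "krylov j x = krylov j y"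
proof -
  have "rmat x = rmat y" using assms by (auto simp: rmat_def fun_eq_iff intro!: sum.cong)
  then show ?thesis by (simp add: krylov_def)
qed

lemma cf_pow_elem: "l < n \<Longrightarrow> cf (elem x [^] j) l = krylov j x l"
  using cf_pow[of "elem x" l j] krylov_cong[of "\<lambda>i. cf (elem x) i" x j] by (simp add: cf_elem)

lemma alg_eval_closed [simp, intro]: "b \<in> carrier A \<Longrightarrow> alg_eval A b p \<in> carrier A"
  unfolding alg_eval_def by (rule fs_closed) auto

lemma cf_alg_eval:
  assumes "b \<in> carrier A" "l < n" "degree p \<le> N"
  shows "cf (alg_eval A b p) l = (\<Sum>i\<le>N. coeff p i * cf (b [^] i) l)"
proof -
  have "cf (alg_eval A b p) l = (\<Sum>i\<le>degree p. coeff p i * cf (b [^] i) l)"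
    unfolding alg_eval_def
    using cf_finsum[of "{..degree p}" "\<lambda>i. coeff p i \<odot> b [^] i" l] assms by (simp add: cf_smult)
  also have "\<dots> = (\<Sum>i\<le>N. coeff p i * cf (b [^] i) l)"
    by (rule sum.mono_neutral_left) (use assms in \<open>auto simp: coeff_eq_0\<close>)
  finally show ?thesis .
qed

lemma alg_eval_add:
  assumes "b \<in> carrier A" shows "alg_eval A b (p + q) = alg_eval A b p \<oplus> alg_eval A b q"
proof (rule cf_eqI)
  fix l assume l: "l < n"
  let ?N = "max (degree p) (degree q)"
  have "degree (p + q) \<le> ?N" by (rule degree_add_le) auto
  then show "cf (alg_eval A b (p + q)) l = cf (alg_eval A b p \<oplus> alg_eval A b q) l"
    using assms l by (simp add: cf_add cf_alg_eval[where N = ?N] distrib_right sum.distrib)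
qed (use assms in auto)

lemma alg_eval_smult:
  assumes "b \<in> carrier A" shows "alg_eval A b (Polynomial.smult c p) = c \<odot> alg_eval A b p"
proof (rule cf_eqI)
  fix l assume l: "l < n"
  show "cf (alg_eval A b (Polynomial.smult c p)) l = cf (c \<odot> alg_eval A b p) l"
    using assms l degree_smult_le[of c p]
    by (simp add: cf_smult cf_alg_eval[where N = "degree p"] sum_distrib_left mult.assoc)
qed (use assms in auto)

lemma alg_eval_0: "b \<in> carrier A \<Longrightarrow> alg_eval A b 0 = \<zero>"
  using alg_eval_smult[of b 0 0] sm_zero[of "alg_eval A b 0"] by simp

lemma alg_eval_pCons:
  assumes "b \<in> carrier A" shows "alg_eval A b (pCons c p) = c \<odot> \<one> \<oplus> alg_eval A b p \<otimes> b"
proof (rule cf_eqI)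
  fix l assume l: "l < n"
  have "cf (alg_eval A b (pCons c p)) l = (\<Sum>i\<le>Suc (degree p). coeff (pCons c p) i * cf (b [^] i) l)"
    by (rule cf_alg_eval[OF assms l]) (rule degree_pCons_le)
  also have "\<dots> = c * cf \<one> l + (\<Sum>i\<le>degree p. coeff p i * cf (b [^] i \<otimes> b) l)"
    by (simp add: sum.atMost_Suc_shift del: sum.atMost_Suc)
  also have "(\<Sum>i\<le>degree p. coeff p i * cf (b [^] i \<otimes> b) l) = cf (alg_eval A b p \<otimes> b) l"
  proof -
    have "(\<Sum>i\<le>degree p. coeff p i * cf (b [^] i \<otimes> b) l) =
       (\<Sum>i\<le>degree p. \<Sum>j<n. coeff p i * cf (b [^] i) j * cf (us ! j \<otimes> b) l)"
      using assms l by (intro sum.cong refl) (subst cf_mult_left, auto simp: sum_distrib_left mult.assoc)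
    also have "\<dots> = (\<Sum>j<n. cf (alg_eval A b p) j * cf (us ! j \<otimes> b) l)"
      by (subst sum.swap) (use assms in \<open>auto simp: cf_alg_eval[where N = "degree p"] sum_distrib_right\<close>)
    also have "\<dots> = cf (alg_eval A b p \<otimes> b) l"
      using cf_mult_left[of "alg_eval A b p" b l] assms l by simp
    finally show ?thesis .
  qed
  finally show "cf (alg_eval A b (pCons c p)) l = cf (c \<odot> \<one> \<oplus> alg_eval A b p \<otimes> b) l"
    using assms l by (simp add: cf_add cf_smult)
qed (use assms in auto)

lemma alg_eval_const: "b \<in> carrier A \<Longrightarrow> alg_eval A b [:c:] = c \<odot> \<one>"
  by (simp add: alg_eval_pCons alg_eval_0)

lemma alg_eval_1: "b \<in> carrier A \<Longrightarrow> alg_eval A b 1 = \<one>"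
  using alg_eval_const[of b 1] by (simp add: sm_one)

lemma alg_eval_commute: "b \<in> carrier A \<Longrightarrow> alg_eval A b p \<otimes> b = b \<otimes> alg_eval A b p"
proof (induction p)
  case 0
  then show ?case by (simp add: alg_eval_0)
next
  case (pCons c p)
  then show ?case
    by (simp add: alg_eval_pCons l_distr r_distr sm_mult1 sm_mult2 m_assoc)
qed

lemma alg_eval_mult:
  assumes b: "b \<in> carrier A"
  shows "alg_eval A b (p * q) = alg_eval A b p \<otimes> alg_eval A b q"
proof (induction p)
  case 0
  then show ?case using b by (simp add: alg_eval_0)
next
  case (pCons c p)
  have "alg_eval A b (pCons c p * q) = alg_eval A b (Polynomial.smult c q + pCons 0 (p * q))"
    by simp
  also have "\<dots> = c \<odot> alg_eval A b q \<oplus> alg_eval A b p \<otimes> alg_eval A b q \<otimes> b"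
    by (simp add: alg_eval_add[OF b] alg_eval_smult[OF b] alg_eval_pCons[OF b] pCons.IH sm_zero b)
  also have "\<dots> = (c \<odot> \<one> \<oplus> alg_eval A b p \<otimes> b) \<otimes> alg_eval A b q"
    using b by (simp add: l_distr sm_mult1 m_assoc alg_eval_commute[OF b, of q])
  finally show ?case by (simp add: alg_eval_pCons[OF b])
qed

lemma alg_eval_uminus: "b \<in> carrier A \<Longrightarrow> alg_eval A b (- p) = (-1) \<odot> alg_eval A b p"
  using alg_eval_smult[of b "-1" p] by simp

lemma alg_eval_diff_zero:
  assumes "b \<in> carrier A" "alg_eval A b p = alg_eval A b q"
  shows "alg_eval A b (p - q) = \<zero>"
proof -
  have "alg_eval A b (p - q) = 1 \<odot> alg_eval A b q \<oplus> (-1) \<odot> alg_eval A b q"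
    using alg_eval_add[OF assms(1), of p "-q"] assms by (simp add: alg_eval_uminus sm_one)
  also have "\<dots> = (1 + (-1)) \<odot> alg_eval A b q" by (rule sm_add[symmetric]) (use assms in auto)
  finally show ?thesis using assms by (simp add: sm_zero)
qed

lemma alg_eval_pcompose:
  assumes b: "b \<in> carrier A"
  shows "alg_eval A b (pcompose p q) = alg_eval A (alg_eval A b q) p"
proof (induction p)
  case 0
  then show ?case using b by (simp add: alg_eval_0)
next
  case (pCons c p)
  then show ?case using b
    by (simp add: pcompose_pCons alg_eval_add alg_eval_const alg_eval_mult alg_eval_pCons alg_eval_0
        mult.commute[of q "pcompose p q"] del: pCons_eq_0_iff)
qed

lemma full_iff_indep:
  assumes b: "b \<in> carrier A"
  shows "full A m b \<longleftrightarrow> indep n m (\<lambda>j. krylov j (\<lambda>i. cf b i))"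
proof
  assume F: "full A m b"
  show "indep n m (\<lambda>j. krylov j (\<lambda>i. cf b i))"
    unfolding indep_def
  proof (intro allI impI)
    fix a j assume a: "\<forall>l<n. (\<Sum>j<m. a j * krylov j (\<lambda>i. cf b i) l) = 0" and j: "j < m"
    define p where "p = (\<Sum>j<m. monom (a j) j)"
    have cp: "coeff p i = (if i < m then a i else 0)" for i by (auto simp: p_def coeff_sum)
    have deg: "degree p \<le> m - 1" by (rule degree_le) (auto simp: cp)
    have "alg_eval A b p = \<zero>"
    proof (rule cf_eqI)
      fix l assume l: "l < n"
      have "cf (alg_eval A b p) l = (\<Sum>i\<le>m - 1. coeff p i * cf (b [^] i) l)"
        by (rule cf_alg_eval[OF b l deg])
      also have "{..m - 1} = {..<m}" using j by auto
      finally show "cf (alg_eval A b p) l = cf \<zero> l"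
        using a l b by (simp add: cp cf_pow cf_zero)
    qed (use b in auto)
    moreover have "degree p < m" using deg j by linarith
    ultimately have "p = 0" using F by (auto simp: full_def)
    then show "a j = 0" using cp[of j] j by simp
  qed
next
  assume I: "indep n m (\<lambda>j. krylov j (\<lambda>i. cf b i))"
  show "full A m b" unfolding full_def
  proof (intro allI impI)
    fix p assume p: "alg_eval A b p = \<zero>" "degree p < m"
    have "(\<Sum>j<m. coeff p j * krylov j (\<lambda>i. cf b i) l) = 0" if l: "l < n" for l
    proof -
      have "cf (alg_eval A b p) l = (\<Sum>i\<le>m - 1. coeff p i * cf (b [^] i) l)"
        by (rule cf_alg_eval[OF b l]) (use p in auto)
      also have "{..m - 1} = {..<m}" using p(2) by auto
      finally show ?thesis using p(1) l b by (simp add: cf_pow cf_zero)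
    qed
    then have "\<forall>j<m. coeff p j = 0"
      using I[unfolded indep_def, rule_format, of "coeff p"] by blast
    then show "p = 0" using p(2) by (metis coeff_eq_0 leading_coeff_0_iff)
  qed
qed

text \<open>
  For the largest \<open>m\<close> such that \<open>1, b, \<dots>, b\<^bsup>m-1\<^esup>\<close> are independent for some \<open>b\<close>, the theorem
  \<open>generic_krylov_relation\<close> applies to the multiplication map.
\<close>

theorem generic_family_exists:
  assumes inf: "infinite (UNIV :: 'k set)"
  shows "\<exists>m c g. g \<in> polyfuns n \<and> (\<exists>b\<in>carrier A. g (\<lambda>i. cf b i) \<noteq> 0) \<and>
     (\<forall>b\<in>carrier A. g (\<lambda>i. cf b i) \<noteq> 0 \<longrightarrow> full A m b) \<and> (\<forall>j<m. c j \<in> polyfuns n) \<and>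
     (\<forall>b\<in>carrier A. alg_eval A b (monom 1 m - (\<Sum>j<m. monom (c j (\<lambda>i. cf b i)) j)) = \<zero>)"
proof -
  define P where "P m \<longleftrightarrow> (\<exists>b0. indep n m (\<lambda>j. krylov j b0))" for m
  have P0: "P 0" by (simp add: P_def indep_def)
  have Ple: "m \<le> n" if "P m" for m using that indep_le by (auto simp: P_def)
  define m where "m = Greatest P"
  have Pm: "P m" unfolding m_def by (rule GreatestI_nat[where k = 0 and b = n]) (use P0 Ple in auto)
  have nP: "\<not> P (Suc m)" using Greatest_le_nat[of P "Suc m" n] Ple by (auto simp: m_def)
  obtain b0 where b0: "indep n m (\<lambda>j. krylov j b0)" using Pm by (auto simp: P_def)
  have "(\<lambda>x. rmat x i l) \<in> polyfuns n" for i l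
    unfolding rmat_def by (intro fun_ring_intros fun_ring_polyfuns polyfuns_var) auto
  from generic_krylov_relation[OF inf this b0[unfolded krylov_def] nP[unfolded P_def krylov_def, simplified, rule_format]]
  obtain c g where cg: "\<forall>j<m. c j \<in> polyfuns n" "g \<in> polyfuns n" "g b0 \<noteq> 0"
    "\<And>x i. i < n \<Longrightarrow> krylov m x i = (\<Sum>j<m. c j x * krylov j x i)"
    "\<And>x. g x \<noteq> 0 \<Longrightarrow> indep n m (\<lambda>j. krylov j x)"
    unfolding krylov_def by blast
  have "g (\<lambda>i. cf (elem b0) i) \<noteq> 0"
    using polyfuns_cong[OF cg(2), of "\<lambda>i. cf (elem b0) i" b0] cg(3) by (simp add: cf_elem)
  moreover have "full A m b" if "b \<in> carrier A" "g (\<lambda>i. cf b i) \<noteq> 0" for b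
    using that cg(5) by (simp add: full_iff_indep)
  moreover have "alg_eval A b (monom 1 m - (\<Sum>j<m. monom (c j (\<lambda>i. cf b i)) j)) = \<zero>"
    if b: "b \<in> carrier A" for b
  proof (rule cf_eqI)
    fix l assume l: "l < n"
    let ?p = "monom 1 m - (\<Sum>j<m. monom (c j (\<lambda>i. cf b i)) j)"
    have cp: "coeff ?p k = (if k = m then 1 else if k < m then - c k (\<lambda>i. cf b i) else 0)" for k
      by (auto simp: coeff_sum coeff_diff)
    have "degree ?p \<le> m" by (rule degree_le, intro allI impI, subst cp) simp
    then have "cf (alg_eval A b ?p) l = (\<Sum>i\<le>m. coeff ?p i * krylov i (\<lambda>i. cf b i) l)"
      using cf_alg_eval[OF b l] b l by (simp add: cf_pow)
    also have "\<dots> = krylov m (\<lambda>i. cf b i) l - (\<Sum>j<m. c j (\<lambda>i. cf b i) * krylov j (\<lambda>i. cf b i) l)"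
      unfolding cp by (simp add: lessThan_Suc_atMost[symmetric] sum_negf)
    finally show "cf (alg_eval A b ?p) l = cf \<zero> l" using cg(4)[OF l] l by (simp add: cf_zero)
  qed (use b in auto)
  ultimately show ?thesis using cg(1,2) by blast
qed

end

section \<open>The minimal polynomial of the general element\<close>

lemma to_fract_sum: "to_fract (\<Sum>i\<in>I. f i) = (\<Sum>i\<in>I. to_fract (f i))"
  by (induction I rule: infinite_finite_induct) auto

lemma ratfun_field_to_fract: "mpoly_vars P \<subseteq> {..<n} \<Longrightarrow> to_fract P \<in> ratfun_field n"
proof -
  assume "mpoly_vars P \<subseteq> {..<n}"
  moreover have "mpoly_vars (1 :: 'a mpoly) \<subseteq> {..<n}" by (simp add: mpoly_vars_def)
  ultimately show ?thesis unfolding ratfun_field_def to_fract_def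
    by (intro CollectI exI[of _ P] exI[of _ 1]) simp
qed

lemma ratfun_field_add:
  assumes "x \<in> ratfun_field n" "y \<in> ratfun_field n" shows "x + y \<in> ratfun_field n"
proof -
  obtain a b c d where *: "x = Fract a b" "y = Fract c d" "b \<noteq> 0" "d \<noteq> 0"
    "mpoly_vars a \<subseteq> {..<n}" "mpoly_vars b \<subseteq> {..<n}" "mpoly_vars c \<subseteq> {..<n}" "mpoly_vars d \<subseteq> {..<n}"
    using assms by (auto simp: ratfun_field_def)
  have "mpoly_vars (a * d + c * b) \<subseteq> {..<n}" "mpoly_vars (b * d) \<subseteq> {..<n}"
    using mpoly_vars_add[of "a * d" "c * b"] mpoly_vars_mult[of a d] mpoly_vars_mult[of c b]
      mpoly_vars_mult[of b d] * by blast+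
  then show ?thesis using * unfolding ratfun_field_def
    by (intro CollectI exI[of _ "a * d + c * b"] exI[of _ "b * d"]) simp
qed

lemma ratfun_field_mult:
  assumes "x \<in> ratfun_field n" "y \<in> ratfun_field n" shows "x * y \<in> ratfun_field n"
proof -
  obtain a b c d where *: "x = Fract a b" "y = Fract c d" "b \<noteq> 0" "d \<noteq> 0"
    "mpoly_vars a \<subseteq> {..<n}" "mpoly_vars b \<subseteq> {..<n}" "mpoly_vars c \<subseteq> {..<n}" "mpoly_vars d \<subseteq> {..<n}"
    using assms by (auto simp: ratfun_field_def)
  have "mpoly_vars (a * c) \<subseteq> {..<n}" "mpoly_vars (b * d) \<subseteq> {..<n}"
    using mpoly_vars_mult[of a c] mpoly_vars_mult[of b d] * by blast+
  then show ?thesis using * unfolding ratfun_field_def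
    by (intro CollectI exI[of _ "a * c"] exI[of _ "b * d"]) simp
qed

lemma ratfun_field_0: "0 \<in> ratfun_field n"
  using ratfun_field_to_fract[of 0 n] by (simp add: mpoly_vars_def)

lemma ratfun_field_diff:
  fixes x y :: "'a::field mpoly fract"
  assumes "x \<in> ratfun_field n" "y \<in> ratfun_field n" shows "x - y \<in> ratfun_field n"
proof -
  have "to_fract (mpoly_const (-1) :: 'a mpoly) \<in> ratfun_field n"
    by (rule ratfun_field_to_fract) (simp add: mpoly_vars_const)
  moreover have "mpoly_const (-1) = (-1 :: 'a mpoly)"
    by (simp add: mpoly_const_def single_uminus)
  ultimately have "- 1 \<in> (ratfun_field n :: 'a mpoly fract set)" by simp
  then show ?thesis using ratfun_field_add[of x n "(-1) * y"] ratfun_field_mult[of "-1" n y] assms by simp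
qed

lemma mpoly_vars_sum: "(\<And>i. i \<in> I \<Longrightarrow> mpoly_vars (f i) \<subseteq> S) \<Longrightarrow> mpoly_vars (\<Sum>i\<in>I. f i) \<subseteq> S"
proof (induction I rule: infinite_finite_induct)
  case (insert i I)
  then show ?case using mpoly_vars_add[of "f i" "\<Sum>i\<in>I. f i"] by auto
qed (auto simp: mpoly_vars_def)

lemma common_denominator:
  fixes f :: "nat \<Rightarrow> 'a::idom fract"
  shows "\<exists>D. D \<noteq> 0 \<and> (\<forall>j<N. \<exists>Q. to_fract D * f j = to_fract Q)"
proof (induction N)
  case (Suc N)
  then obtain D where D: "D \<noteq> 0" "\<And>j. j < N \<Longrightarrow> \<exists>Q. to_fract D * f j = to_fract Q" by auto
  obtain a b where ab: "f N = Fract a b" "b \<noteq> 0" by (cases "f N") auto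
  have N: "to_fract (D * b) * f N = to_fract (D * a)"
    using ab by (simp add: to_fract_def eq_fract mult_ac)
  have "\<exists>Q. to_fract (D * b) * f j = to_fract Q" if j: "j < Suc N" for j
  proof (cases "j = N")
    case True
    then show ?thesis using N by blast
  next
    case False
    then have j: "j < N" using j by simp
    obtain Q where "to_fract D * f j = to_fract Q" using D(2)[OF j] by auto
    then have "to_fract (D * b) * f j = to_fract (b * Q)" by (metis mult.assoc mult.commute to_fract_mult)
    then show ?thesis by blast
  qed
  moreover have "D * b \<noteq> 0" using D(1) ab(2) by simp
  ultimately show ?case by blast
qed (auto intro: exI[of _ 1])

definition polyfun_on :: "('k::field, 'a) module \<Rightarrow> 'a list \<Rightarrow> ('a \<Rightarrow> 'k) \<Rightarrow> bool" where
  "polyfun_on A us f \<longleftrightarrow> (\<exists>h \<in> polyfuns (length us). \<forall>b\<in>carrier A. f b = h (\<lambda>i. coords A us b $ i))"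

text \<open>
  The specialisations of the minimal polynomial of the general element, characterised without
  reference to the field \<open>K(\<xi>)\<close>.
\<close>

definition generic_family :: "('k::field, 'a) module \<Rightarrow> 'a list \<Rightarrow> nat \<Rightarrow> ('a \<Rightarrow> 'k poly) \<Rightarrow> bool" where
  "generic_family A us m M \<longleftrightarrow>
     (\<forall>b\<in>carrier A. lead_coeff (M b) = 1 \<and> degree (M b) = m \<and> alg_eval A b (M b) = \<zero>\<^bsub>A\<^esub>) \<and>
     (\<forall>k. polyfun_on A us (\<lambda>b. coeff (M b) k)) \<and>
     (\<exists>g. polyfun_on A us g \<and> (\<exists>b\<in>carrier A. g b \<noteq> 0) \<and> (\<forall>b\<in>carrier A. g b \<noteq> 0 \<longrightarrow> full A m b))"

context based_algebra
begin

abbreviation "B \<equiv> scalar_extension A us"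

lemma B_simps:
  "carrier B = {x \<in> carrier_vec n. \<forall>i<n. x $ i \<in> ratfun_field n}"
  "x \<otimes>\<^bsub>B\<^esub> y = vec n (\<lambda>l. \<Sum>i<n. \<Sum>j<n. x $ i * y $ j * embed_const (sc i j l))"
  "\<one>\<^bsub>B\<^esub> = map_vec embed_const (coords A us \<one>)" "\<zero>\<^bsub>B\<^esub> = 0\<^sub>v n"
  "x \<oplus>\<^bsub>B\<^esub> y = x + y" "c \<odot>\<^bsub>B\<^esub> x = c \<cdot>\<^sub>v x"
  by (simp_all add: scalar_extension_def Let_def sc_def)

lemma B_add_monoid: "abelian_monoid B"
proof (rule abelian_monoid.intro, rule comm_monoidI)
  fix x y assume "x \<in> carrier (add_monoid B)" "y \<in> carrier (add_monoid B)"
  then show "x \<otimes>\<^bsub>add_monoid B\<^esub> y \<in> carrier (add_monoid B)"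
    by (auto simp: B_simps intro!: ratfun_field_add)
  show "x \<otimes>\<^bsub>add_monoid B\<^esub> y = y \<otimes>\<^bsub>add_monoid B\<^esub> x"
    using \<open>x \<in> carrier (add_monoid B)\<close> \<open>y \<in> carrier (add_monoid B)\<close>
    by (auto simp: B_simps intro!: comm_add_vec)
qed (auto simp: B_simps ratfun_field_0 intro!: assoc_add_vec)

lemma B_finsum:
  assumes "finite S" "f \<in> S \<rightarrow> carrier B" 
  shows "finsum B f S = vec n (\<lambda>l. \<Sum>s\<in>S. f s $ l)"
  using assms
proof (induction S rule: finite_induct)
  case empty
  then show ?case using abelian_monoid.finsum_empty[OF B_add_monoid]
    by (auto simp: B_simps zero_vec_def)
next
  case (insert s S)
  have "finsum B f (insert s S) = f s \<oplus>\<^bsub>B\<^esub> finsum B f S"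
    by (rule abelian_monoid.finsum_insert[OF B_add_monoid]) (use insert in auto)
  moreover have "f s \<in> carrier_vec n" using insert by (auto simp: B_simps)
  ultimately show ?case using insert by (auto simp: B_simps)
qed

text \<open>
  The coordinates of the powers of the general element.
\<close>

primrec W :: "nat \<Rightarrow> nat \<Rightarrow> 'k mpoly" where
  "W 0 = (\<lambda>l. mpoly_const (cf \<one> l))"
| "W (Suc i) = (\<lambda>l. \<Sum>r<n. \<Sum>s<n. W i r * mpoly_var s * mpoly_const (sc r s l))"

lemma W_eval: "mpoly_eval x (W i l) = krylov i x l"
  by (induction i arbitrary: l)
    (auto simp: krylov_def mat_app_def rmat_def mpoly_eval_sum mpoly_eval_mult
      sum_distrib_right mult_ac intro!: sum.cong)

lemma W_vars: "mpoly_vars (W i l) \<subseteq> {..<n}"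
proof (induction i arbitrary: l)
  case (Suc i)
  have "mpoly_vars (W i r * mpoly_var s * mpoly_const (sc r s l)) \<subseteq> {..<n}" if "s < n" for r s
    using mpoly_vars_mult[of "W i r * mpoly_var s" "mpoly_const (sc r s l)"]
      mpoly_vars_mult[of "W i r" "mpoly_var s"] Suc[of r] mpoly_vars_var[of s, where ?'a = 'k] that
    by (force simp: mpoly_vars_const)
  then show ?case by (auto intro!: mpoly_vars_sum)
qed (simp add: mpoly_vars_const)

lemma B_pow: "general_element us [^]\<^bsub>B\<^esub> i = vec n (\<lambda>l. to_fract (W i l))"
proof (induction i)
  case 0
  show ?case using coords_spec(1)[of \<one>]
    by (auto simp: Group.nat_pow_def B_simps embed_const_def intro!: eq_vecI)
next
  case (Suc i)
  have "general_element us [^]\<^bsub>B\<^esub> Suc i = (general_element us [^]\<^bsub>B\<^esub> i) \<otimes>\<^bsub>B\<^esub> general_element us"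
    by (simp add: Group.nat_pow_def)
  then show ?case unfolding Suc
    by (auto simp: B_simps general_element_def embed_const_def to_fract_sum intro!: eq_vecI sum.cong)
qed

lemma B_alg_eval:
  assumes "\<And>i. coeff p i \<in> ratfun_field n" "degree p \<le> N"
  shows "alg_eval B (general_element us) p = vec n (\<lambda>l. \<Sum>i\<le>N. coeff p i * to_fract (W i l))"
proof -
  have "alg_eval B (general_element us) p =
    vec n (\<lambda>l. \<Sum>i\<le>degree p. (coeff p i \<odot>\<^bsub>B\<^esub> (general_element us [^]\<^bsub>B\<^esub> i)) $ l)"
    unfolding alg_eval_def
    by (rule B_finsum) (auto simp: B_pow B_simps intro!: ratfun_field_mult assms ratfun_field_to_fract W_vars)
  also have "\<dots> = vec n (\<lambda>l. \<Sum>i\<le>degree p. coeff p i * to_fract (W i l))"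
    by (auto simp: B_simps B_pow)
  also have "\<dots> = vec n (\<lambda>l. \<Sum>i\<le>N. coeff p i * to_fract (W i l))"
    using assms(2) by (auto simp: coeff_eq_0 intro!: eq_vecI sum.mono_neutral_left le_degree)
  finally show ?thesis .
qed

text \<open>
  The polynomial \<open>P0\<close> with the generic coefficients kills the general element because it does so at
  every point. A relation of smaller degree over \<open>K(\<xi>)\<close> could be cleared of denominators and
  specialised to a full element at which its leading coefficient does not vanish.
\<close>

theorem generic_min_poly:
  assumes inf: "infinite (UNIV :: 'k set)"
  shows "\<exists>M. generic_family A us (alg_degree A us) M \<and>
    (\<forall>b\<in>carrier A. reduced_norm A us b = (-1) ^ alg_degree A us * coeff (M b) 0)"
proof -
  obtain m c g where g: "g \<in> polyfuns n" "\<exists>b\<in>carrier A. g (\<lambda>i. cf b i) \<noteq> 0"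
    "\<And>b. b \<in> carrier A \<Longrightarrow> g (\<lambda>i. cf b i) \<noteq> 0 \<Longrightarrow> full A m b"
    and c: "\<And>j. j < m \<Longrightarrow> c j \<in> polyfuns n"
    and kill: "\<And>b. b \<in> carrier A \<Longrightarrow> alg_eval A b (monom 1 m - (\<Sum>j<m. monom (c j (\<lambda>i. cf b i)) j)) = \<zero>"
    using generic_family_exists[OF inf] by blast
  have "\<exists>P. \<forall>j<m. mpoly_vars (P j) \<subseteq> {..<n} \<and> c j = (\<lambda>x. mpoly_eval x (P j))"
  proof -
    have "\<forall>j. \<exists>P. j < m \<longrightarrow> mpoly_vars P \<subseteq> {..<n} \<and> c j = (\<lambda>x. mpoly_eval x P)"
      using c by (force simp: polyfuns_def)
    then show ?thesis by metis
  qed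
  then obtain P where P: "\<And>j. j < m \<Longrightarrow> mpoly_vars (P j) \<subseteq> {..<n}"
    "\<And>j. j < m \<Longrightarrow> c j = (\<lambda>x. mpoly_eval x (P j))" by blast
  obtain G where G: "mpoly_vars G \<subseteq> {..<n}" "g = (\<lambda>x. mpoly_eval x G)"
    using g(1) by (auto simp: polyfuns_def)
  define CP where "CP k = (if k = m then 1 else if k < m then mpoly_const (-1) * P k else 0)" for k
  have CP_vars: "mpoly_vars (CP k) \<subseteq> {..<n}" for k
    using mpoly_vars_mult[of "mpoly_const (-1)" "P k"] P(1)[of k]
    by (auto simp: CP_def mpoly_vars_const) (auto simp: mpoly_vars_def)
  define M where "M b = monom 1 m - (\<Sum>j<m. monom (c j (\<lambda>i. cf b i)) j)" for b
  have one_eval: "mpoly_eval x 1 = 1" for x :: "nat \<Rightarrow> 'k"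
    using mpoly_eval_const[of x 1] by (simp add: mpoly_const_def del: mpoly_eval_const)
  have cM: "coeff (M b) k = mpoly_eval (\<lambda>i. cf b i) (CP k)" for b k
    by (auto simp: M_def CP_def coeff_sum coeff_diff P(2) mpoly_eval_mult one_eval)
  have degM: "degree (M b) = m" for b
  proof (rule antisym)
    show "degree (M b) \<le> m" by (rule degree_le) (auto simp: cM CP_def)
    show "m \<le> degree (M b)" by (rule le_degree) (simp add: cM CP_def one_eval)
  qed
  have leadM: "lead_coeff (M b) = 1" for b by (simp add: degM) (simp add: cM CP_def one_eval)
  have relx: "(\<Sum>k\<le>m. mpoly_eval x (CP k) * krylov k x l) = 0" if l: "l < n" for x l
  proof -
    let ?b = "elem x"
    have "0 = cf (alg_eval A ?b (M ?b)) l"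
      using kill[of ?b] l by (simp add: M_def cf_zero)
    also have "\<dots> = (\<Sum>k\<le>m. coeff (M ?b) k * cf (?b [^] k) l)"
      by (rule cf_alg_eval) (use l degM in auto)
    also have "\<dots> = (\<Sum>k\<le>m. mpoly_eval x (CP k) * krylov k x l)"
    proof (rule sum.cong)
      fix k
      have "(\<lambda>x. mpoly_eval x (CP k)) \<in> polyfuns n" using CP_vars by (auto simp: polyfuns_def)
      from polyfuns_cong[OF this, of "\<lambda>i. cf ?b i" x]
      show "coeff (M ?b) k * cf (?b [^] k) l = mpoly_eval x (CP k) * krylov k x l"
        using l by (simp add: cM cf_elem cf_pow_elem)
    qed simp
    finally show ?thesis by simp
  qed
  define P0 where "P0 = (\<Sum>k\<le>m. monom (to_fract (CP k)) k)"
  have cP0: "coeff P0 k = to_fract (CP k)" for k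
    by (auto simp: P0_def coeff_sum CP_def)
  have degP0: "degree P0 = m"
  proof (rule antisym)
    show "degree P0 \<le> m" by (rule degree_le) (auto simp: cP0 CP_def)
    show "m \<le> degree P0" by (rule le_degree) (simp add: cP0 CP_def)
  qed
  have P0F: "coeff P0 k \<in> ratfun_field n" for k
    unfolding cP0 by (rule ratfun_field_to_fract) (rule CP_vars)
  have P0kill: "alg_eval B (general_element us) P0 = \<zero>\<^bsub>B\<^esub>"
  proof -
    have "(\<Sum>k\<le>m. CP k * W k l) = 0" if "l < n" for l
      by (rule mpoly_eval_eq_0_imp_0[OF inf])
        (use relx[OF that] in \<open>simp add: mpoly_eval_sum mpoly_eval_mult W_eval\<close>)
    then have "(\<Sum>k\<le>m. coeff P0 k * to_fract (W k l)) = 0" if "l < n" for l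
      using that by (metis (no_types, lifting) cP0 sum.cong to_fract_0 to_fract_mult to_fract_sum)
    then show ?thesis
      using B_alg_eval[OF P0F, of m] degP0 by (auto simp: B_simps intro!: eq_vecI)
  qed
  have minimal: "m \<le> degree q"
    if q: "q \<noteq> 0" "\<And>i. coeff q i \<in> ratfun_field n" "alg_eval B (general_element us) q = \<zero>\<^bsub>B\<^esub>" for q
  proof (rule ccontr)
    assume "\<not> m \<le> degree q"
    then have dq: "degree q < m" by simp
    obtain D where D: "D \<noteq> 0" "\<forall>j<Suc (degree q). \<exists>Q. to_fract D * coeff q j = to_fract Q"
      using common_denominator[where f = "coeff q"] by blast
    obtain Q where Q: "\<And>j. j \<le> degree q \<Longrightarrow> to_fract D * coeff q j = to_fract (Q j)"
      using D(2) by (metis less_Suc_eq_le)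
    have Qe: "Q (degree q) \<noteq> 0" 
      using Q[of "degree q"] D(1) q(1) by auto
    have zero: "(\<Sum>j\<le>degree q. Q j * W j l) = 0" if l: "l < n" for l
    proof -
      have "to_fract (\<Sum>j\<le>degree q. Q j * W j l) = to_fract D * (\<Sum>j\<le>degree q. coeff q j * to_fract (W j l))"
        unfolding sum_distrib_left to_fract_sum by (rule sum.cong) (auto simp: Q[symmetric] mult.assoc)
      also have "(\<Sum>j\<le>degree q. coeff q j * to_fract (W j l)) = alg_eval B (general_element us) q $ l"
        using B_alg_eval[OF q(2), of "degree q"] l by simp
      also have "\<dots> = 0" using q(3) l by (simp add: B_simps)
      finally have "to_fract (\<Sum>j\<le>degree q. Q j * W j l) = 0" by (simp only: mult_zero_right)
      then show ?thesis by (simp only: to_fract_eq_0_iff)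
    qed
    have "G \<noteq> 0" using g(2) G(2) by auto
    then have "Q (degree q) * G \<noteq> 0" using Qe by simp
    then obtain x where "mpoly_eval x (Q (degree q) * G) \<noteq> 0"
      using mpoly_eval_eq_0_imp_0[OF inf] by blast
    then have x: "mpoly_eval x (Q (degree q)) \<noteq> 0" "g x \<noteq> 0" by (auto simp: mpoly_eval_mult G(2))
    have "g (\<lambda>i. cf (elem x) i) = g x" by (rule polyfuns_cong[OF g(1)]) (simp add: cf_elem)
    then have F: "full A m (elem x)" using g(3)[of "elem x"] x(2) by simp
    define r where "r = (\<Sum>j\<le>degree q. monom (mpoly_eval x (Q j)) j)"
    have cr: "coeff r k = (if k \<le> degree q then mpoly_eval x (Q k) else 0)" for k
      by (auto simp: r_def coeff_sum)
    have degr: "degree r \<le> degree q" by (rule degree_le) (auto simp: cr)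
    have "alg_eval A (elem x) r = \<zero>"
    proof (rule cf_eqI)
      fix l assume l: "l < n"
      have "cf (alg_eval A (elem x) r) l = (\<Sum>j\<le>degree q. coeff r j * cf (elem x [^] j) l)"
        by (rule cf_alg_eval) (use l degr in auto)
      also have "\<dots> = mpoly_eval x (\<Sum>j\<le>degree q. Q j * W j l)"
        by (auto simp: cr cf_pow_elem l mpoly_eval_sum mpoly_eval_mult W_eval intro!: sum.cong)
      finally show "cf (alg_eval A (elem x) r) l = cf \<zero> l" using zero[OF l] l by (simp add: cf_zero)
    qed auto
    then have "r = 0" using F degr dq by (auto simp: full_def)
    then show False using cr[of "degree q"] x(1) by simp
  qed
  have isP0: "is_min_poly (ratfun_field n) B (general_element us) P0"
    unfolding is_min_poly_def
    using P0F P0kill minimal degP0 cP0[of m] by (auto simp: CP_def)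
  have unique: "p = P0" if p: "is_min_poly (ratfun_field n) B (general_element us) p" for p
  proof (rule ccontr)
    assume ne: "p \<noteq> P0"
    have pF: "\<And>i. coeff p i \<in> ratfun_field n" and pk: "alg_eval B (general_element us) p = \<zero>\<^bsub>B\<^esub>"
      and p1: "lead_coeff p = 1" using p by (auto simp: is_min_poly_def)
    have "P0 \<noteq> 0" using cP0[of m] by (auto simp: CP_def)
    then have "degree p \<le> m" using p P0F P0kill degP0 unfolding is_min_poly_def by blast
    moreover have "m \<le> degree p" by (rule minimal) (use pF pk p1 in auto)
    ultimately have dp: "degree p = m" by simp
    let ?q = "p - P0"
    have dq: "degree ?q \<le> m" using degree_diff_le[of p m P0] dp degP0 by simp
    have qF: "\<And>i. coeff ?q i \<in> ratfun_field n" using pF P0F by (simp add: ratfun_field_diff)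
    have "alg_eval B (general_element us) ?q = \<zero>\<^bsub>B\<^esub>"
    proof -
      have "(\<Sum>i\<le>m. coeff p i * to_fract (W i l)) = 0 \<and> (\<Sum>i\<le>m. coeff P0 i * to_fract (W i l)) = 0" if "l < n" for l
        using B_alg_eval[OF pF, of m] B_alg_eval[OF P0F, of m] dp degP0 pk P0kill that
        by (auto simp: B_simps vec_eq_iff)
      then show ?thesis using B_alg_eval[OF qF dq]
        by (auto simp: B_simps left_diff_distrib sum_subtractf intro!: eq_vecI)
    qed
    then have "m \<le> degree ?q" using minimal[of ?q] qF ne by auto
    then have "degree ?q = m" using dq by simp
    moreover have "coeff ?q m = 0" using p1 dp cP0[of m] by (simp add: CP_def)
    ultimately show False using ne by (metis leading_coeff_0_iff right_minus_eq)
  qed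
  have gmp: "general_min_poly A us = P0"
    unfolding general_min_poly_def using isP0 unique by (rule the_equality)
  have deg: "alg_degree A us = m" by (simp add: alg_degree_def gmp degP0)
  have gc: "general_min_poly_coeff A us m = CP 0"
    unfolding general_min_poly_coeff_def deg gmp
    by (rule the_equality) (use CP_vars in \<open>auto simp: cP0\<close>)
  have norm: "reduced_norm A us b = (-1) ^ m * coeff (M b) 0" for b
    by (simp add: reduced_norm_def deg gc cM)
  have "polyfun_on A us (\<lambda>b. coeff (M b) k)" for k
    unfolding polyfun_on_def cM
    by (intro bexI[of _ "\<lambda>x. mpoly_eval x (CP k)"]) (use CP_vars in \<open>auto simp: polyfuns_def\<close>)
  moreover have "polyfun_on A us (\<lambda>b. g (\<lambda>i. cf b i))"
    unfolding polyfun_on_def using g(1) by blast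
  ultimately have "generic_family A us m M"
    unfolding generic_family_def using leadM degM kill g by (auto simp: M_def)
  then show ?thesis using norm deg by auto
qed

text \<open>
  Despite the name the parameter space is arbitrary: a family of elements whose coordinates lie in
  a given ring of functions.
\<close>

definition poly_path :: "('p \<Rightarrow> 'k) set \<Rightarrow> ('p \<Rightarrow> 'a) \<Rightarrow> bool" where
  "poly_path Q \<phi> \<longleftrightarrow> (\<forall>t. \<phi> t \<in> carrier A) \<and> (\<forall>i<n. (\<lambda>t. cf (\<phi> t) i) \<in> Q)"

lemma poly_path_closed: "poly_path Q \<phi> \<Longrightarrow> \<phi> t \<in> carrier A"
  by (simp add: poly_path_def)

lemma poly_path_const: "fun_ring Q \<Longrightarrow> a \<in> carrier A \<Longrightarrow> poly_path Q (\<lambda>_. a)"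
  by (simp add: poly_path_def fun_ring_const)

lemma poly_path_add: "fun_ring Q \<Longrightarrow> poly_path Q \<phi> \<Longrightarrow> poly_path Q \<psi> \<Longrightarrow> poly_path Q (\<lambda>t. \<phi> t \<oplus> \<psi> t)"
  by (simp add: poly_path_def cf_add fun_ring_add)

lemma poly_path_smult: "fun_ring Q \<Longrightarrow> q \<in> Q \<Longrightarrow> poly_path Q \<phi> \<Longrightarrow> poly_path Q (\<lambda>t. q t \<odot> \<phi> t)"
  by (simp add: poly_path_def cf_smult fun_ring_mult)

lemma poly_path_mult: "fun_ring Q \<Longrightarrow> poly_path Q \<phi> \<Longrightarrow> poly_path Q \<psi> \<Longrightarrow> poly_path Q (\<lambda>t. \<phi> t \<otimes> \<psi> t)"
  by (auto simp: poly_path_def cf_mult intro!: fun_ring_intros)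

lemma poly_path_pow: "fun_ring Q \<Longrightarrow> poly_path Q \<phi> \<Longrightarrow> poly_path Q (\<lambda>t. \<phi> t [^] (j::nat))"
proof (induction j)
  case 0
  then show ?case by (simp add: poly_path_const)
next
  case (Suc j)
  then show ?case using poly_path_mult[of Q "\<lambda>t. \<phi> t [^] j" \<phi>] by simp
qed

lemma poly_path_alg_eval:
  assumes Q: "fun_ring Q" and \<phi>: "poly_path Q \<phi>" and P: "\<And>i. (\<lambda>t. coeff (P t) i) \<in> Q" "\<And>t. degree (P t) \<le> N"
  shows "poly_path Q (\<lambda>t. alg_eval A (\<phi> t) (P t))"
  unfolding poly_path_def
proof (intro conjI allI impI)
  fix t show "alg_eval A (\<phi> t) (P t) \<in> carrier A" using poly_path_closed[OF \<phi>] by simp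
next
  fix l assume l: "l < n"
  have "cf (alg_eval A (\<phi> t) (P t)) l = (\<Sum>i\<le>N. coeff (P t) i * cf (\<phi> t [^] i) l)" for t
    by (rule cf_alg_eval) (use poly_path_closed[OF \<phi>] l P in auto)
  moreover have "(\<lambda>t. \<Sum>i\<le>N. coeff (P t) i * cf (\<phi> t [^] i) l) \<in> Q"
    using poly_path_pow[OF Q \<phi>] l by (intro fun_ring_intros Q P) (auto simp: poly_path_def)
  ultimately show "(\<lambda>t. cf (alg_eval A (\<phi> t) (P t)) l) \<in> Q" by simp
qed

lemma polyfun_on_path:
  assumes "polyfun_on A us f" "fun_ring Q" "poly_path Q \<phi>"
  shows "(\<lambda>t. f (\<phi> t)) \<in> Q"
proof -
  obtain h where h: "h \<in> polyfuns n" "\<And>b. b \<in> carrier A \<Longrightarrow> f b = h (\<lambda>i. cf b i)"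
    using assms(1) by (auto simp: polyfun_on_def)
  have "(\<lambda>t. h (\<lambda>i. cf (\<phi> t) i)) \<in> Q"
    by (rule polyfuns_compose[OF h(1) assms(2)]) (use assms(3) in \<open>simp add: poly_path_def\<close>)
  then show ?thesis using h(2) poly_path_closed[OF assms(3)] by simp
qed

text \<open>
  Polynomial functions are given with respect to a basis of their own; the change of coordinates is
  linear, so that they still compose with paths.
\<close>

lemma polynomial_function_path:
  assumes "polynomial_function A f" "fun_ring Q" "poly_path Q \<phi>"
  shows "(\<lambda>t. f (\<phi> t)) \<in> Q"
proof -
  obtain us' P where *: "ordered_basis A us'" "mpoly_vars P \<subseteq> {..<length us'}"
     "\<And>b. b \<in> carrier A \<Longrightarrow> f b = mpoly_eval (\<lambda>i. coords A us' b $ i) P"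
    using assms(1) by (auto simp: polynomial_function_def)
  interpret A': based_algebra A us' by unfold_locales (rule *(1))
  have "(\<lambda>t. coords A us' (\<phi> t) $ i) \<in> Q" if i: "i < length us'" for i
  proof -
    have "coords A us' (\<phi> t) $ i = (\<Sum>j<n. cf (\<phi> t) j * coords A us' (us ! j) $ i)" for t
    proof -
      have "coords A us' (elem (\<lambda>i. cf (\<phi> t) i)) $ i = (\<Sum>j<n. coords A us' (cf (\<phi> t) j \<odot> us ! j) $ i)"
        unfolding elem_def by (rule A'.cf_finsum) (use i in auto)
      then show ?thesis using poly_path_closed[OF assms(3), of t] i by (simp add: elem_cf A'.cf_smult)
    qed
    moreover have "(\<lambda>t. \<Sum>j<n. cf (\<phi> t) j * coords A us' (us ! j) $ i) \<in> Q"
      using assms(3) by (intro fun_ring_intros assms(2)) (auto simp: poly_path_def)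
    ultimately show ?thesis by simp
  qed
  then have "(\<lambda>t. mpoly_eval (\<lambda>i. coords A us' (\<phi> t) $ i) P) \<in> Q"
    using *(2) by (intro fun_ring_mpoly_eval[OF assms(2)]) auto
  then show ?thesis using *(3) poly_path_closed[OF assms(3)] by simp
qed

end

section \<open>Specialised minimal polynomials and the adjoint\<close>

lemma pcompose_linear_top:
  fixes p :: "'k::comm_ring_1 poly"
  assumes "degree p \<le> N"
  shows "degree (pcompose p [:x, t:]) \<le> N \<and> coeff (pcompose p [:x, t:]) N = coeff p N * t ^ N"
  using assms
proof (induction p arbitrary: N)
  case (pCons c p)
  show ?case
  proof (cases N)
    case 0
    then have "p = 0" using pCons.prems by (cases "p = 0") auto
    then show ?thesis using 0 by (simp add: pcompose_pCons)
  next
    case (Suc k)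
    have "degree p \<le> k" using pCons.prems Suc by (cases "p = 0") auto
    from pCons.IH[OF this] have IH: "degree (pcompose p [:x, t:]) \<le> k"
      "coeff (pcompose p [:x, t:]) k = coeff p k * t ^ k" by auto
    have eq: "pcompose (pCons c p) [:x, t:] =
      [:c:] + (Polynomial.smult x (pcompose p [:x, t:]) + pCons 0 (Polynomial.smult t (pcompose p [:x, t:])))"
      by (simp add: pcompose_pCons)
    have z: "coeff (pcompose p [:x, t:]) j = 0" if "k < j" for j
      using IH(1) that by (simp add: coeff_eq_0)
    have "coeff (pcompose (pCons c p) [:x, t:]) i = 0" if "Suc k < i" for i
      unfolding eq using z[of i] z[of "i - 1"] that by (cases i) (auto simp: coeff_pCons split: nat.splits)
    then have "degree (pcompose (pCons c p) [:x, t:]) \<le> N" unfolding Suc by (intro degree_le) auto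
    moreover have "coeff (pcompose (pCons c p) [:x, t:]) N = coeff (pCons c p) N * t ^ N"
      unfolding eq Suc using z[of "Suc k"] IH(2) by (simp add: mult_ac)
    ultimately show ?thesis by blast
  qed
qed auto

text \<open>
  The formula makes visible that the coefficients of the quotient are polynomial in those of \<open>p\<close>
  and in \<open>c\<close>.
\<close>

lemma coeff_synthetic_div:
  fixes p :: "'k::comm_ring_1 poly"
  assumes "degree p \<le> N"
  shows "coeff (synthetic_div p c) i = (\<Sum>j\<le>N. coeff p (Suc i + j) * c ^ j)"
  using assms
proof (induction p arbitrary: i)
  case (pCons a p)
  have dp: "degree p \<le> N" using pCons.prems by (cases "p = 0") auto
  show ?case
  proof (cases i)
    case 0
    have "poly p c = (\<Sum>j\<le>N. coeff p j * c ^ j)"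
      unfolding poly_altdef by (rule sum.mono_neutral_left) (use dp in \<open>auto simp: coeff_eq_0\<close>)
    then show ?thesis using 0 by simp
  next
    case (Suc k)
    then show ?thesis using pCons.IH[OF dp, of k] by simp
  qed
qed auto

context based_algebra
begin

lemma alg_eval_linear: "b \<in> carrier A \<Longrightarrow> alg_eval A b [:x, t:] = x \<odot> \<one> \<oplus> t \<odot> b"
  by (simp add: alg_eval_pCons alg_eval_0 alg_eval_const sm_mult1 del: alg_eval_const)

lemma line_path:
  assumes "a \<in> carrier A" "x \<in> carrier A"
  shows "poly_path (range poly) (\<lambda>t. a \<oplus> t \<odot> x)"
  by (intro poly_path_add poly_path_smult poly_path_const fun_ring_poly fun_ring_poly_id assms)

lemma line_end:
  assumes "a \<in> carrier A" "b \<in> carrier A"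
  shows "a \<oplus> 0 \<odot> (b \<oplus> (-1) \<odot> a) = a" "a \<oplus> 1 \<odot> (b \<oplus> (-1) \<odot> a) = b"
proof -
  show "a \<oplus> 0 \<odot> (b \<oplus> (-1) \<odot> a) = a" using assms by (simp add: sm_zero)
  show "a \<oplus> 1 \<odot> (b \<oplus> (-1) \<odot> a) = b"
    by (rule cf_eqI) (use assms in \<open>auto simp: cf_add cf_smult\<close>)
qed

lemma path_expansion:
  assumes "poly_path (range poly) \<phi>"
  shows "\<exists>f L. (\<forall>s. f s \<in> carrier A) \<and> (\<forall>s>L. f s = \<zero>) \<and>
    (\<forall>t. \<phi> t = finsum A (\<lambda>s. t ^ s \<odot> f s) {..L})"
proof -
  have "\<forall>i. \<exists>p. i < n \<longrightarrow> (\<lambda>t. cf (\<phi> t) i) = poly p" using assms by (force simp: poly_path_def)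
  then obtain p where p: "\<And>i. i < n \<Longrightarrow> (\<lambda>t. cf (\<phi> t) i) = poly (p i)" by metis
  define L where "L = Max (insert 0 ((\<lambda>i. degree (p i)) ` {..<n}))"
  have L: "degree (p i) \<le> L" if "i < n" for i unfolding L_def by (rule Max_ge) (use that in auto)
  define f where "f s = elem (\<lambda>i. coeff (p i) s)" for s
  have "f s = \<zero>" if "s > L" for s
    by (rule cf_eqI) (use that L in \<open>auto simp: f_def cf_elem cf_zero intro!: coeff_eq_0 dest!: L\<close>)
  moreover have "\<phi> t = finsum A (\<lambda>s. t ^ s \<odot> f s) {..L}" for t
  proof (rule cf_eqI)
    fix i assume i: "i < n"
    have "cf (\<phi> t) i = poly (p i) t" using fun_cong[OF p[OF i], of t] .
    also have "\<dots> = (\<Sum>s\<le>L. coeff (p i) s * t ^ s)"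
      unfolding poly_altdef by (rule sum.mono_neutral_left) (use L[OF i] in \<open>auto simp: coeff_eq_0\<close>)
    also have "\<dots> = cf (finsum A (\<lambda>s. t ^ s \<odot> f s) {..L}) i"
      by (subst cf_finsum) (use i in \<open>auto simp: f_def cf_smult cf_elem mult.commute\<close>)
    finally show "cf (\<phi> t) i = cf (finsum A (\<lambda>s. t ^ s \<odot> f s) {..L}) i" .
  qed (use poly_path_closed[OF assms] in \<open>auto simp: f_def intro!: fs_closed\<close>)
  ultimately show ?thesis by (intro exI[of _ f] exI[of _ L]) (auto simp: f_def)
qed

lemma vector_poly_zero:
  assumes S: "infinite S" and f: "\<And>s. f s \<in> carrier A"
    and z: "\<And>t. t \<in> S \<Longrightarrow> finsum A (\<lambda>s. t ^ s \<odot> f s) {..L} = \<zero>" and "s \<le> L"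
  shows "f s = \<zero>"
proof (rule cf_eqI)
  fix i assume i: "i < n"
  define p where "p = (\<Sum>s\<le>L. monom (cf (f s) i) s)"
  have "poly p t = 0" if "t \<in> S" for t
  proof -
    have "poly p t = (\<Sum>s\<le>L. t ^ s * cf (f s) i)" by (simp add: p_def poly_sum poly_monom mult.commute)
    also have "\<dots> = cf (finsum A (\<lambda>s. t ^ s \<odot> f s) {..L}) i"
      by (subst cf_finsum) (use i f in \<open>auto simp: cf_smult\<close>)
    finally show ?thesis using z[OF that] i by (simp add: cf_zero)
  qed
  then have "p = 0" by (rule poly_zeroI_infinite[OF S])
  then have "coeff p s = 0" by simp
  then show "cf (f s) i = cf \<zero> i" using \<open>s \<le> L\<close> i by (simp add: p_def coeff_sum cf_zero)
qed (use f in auto)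

end

locale generic_algebra = based_algebra A us
  for A :: "('k::field, 'a) module" (structure) and us +
  fixes m :: nat and M :: "'a \<Rightarrow> 'k poly"
  assumes inf: "infinite (UNIV :: 'k set)" and family: "generic_family A us m M"
begin

lemma M_monic: "b \<in> carrier A \<Longrightarrow> lead_coeff (M b) = 1"
  and M_degree: "b \<in> carrier A \<Longrightarrow> degree (M b) = m"
  and M_kill: "b \<in> carrier A \<Longrightarrow> alg_eval A b (M b) = \<zero>"
  and M_coeff_polyfun: "polyfun_on A us (\<lambda>b. coeff (M b) k)"
  using family by (auto simp: generic_family_def)

lemma M_top: "b \<in> carrier A \<Longrightarrow> coeff (M b) m = 1"
  using M_monic M_degree by metis

lemma M_coeff_path:
  "fun_ring Q \<Longrightarrow> poly_path Q \<phi> \<Longrightarrow> (\<lambda>t. coeff (M (\<phi> t)) k) \<in> Q"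
  using polyfun_on_path[OF M_coeff_polyfun] .

lemma poly_M_path:
  assumes "fun_ring Q" "poly_path Q \<phi>" "l \<in> Q"
  shows "(\<lambda>t. poly (M (\<phi> t)) (l t)) \<in> Q"
proof -
  have "poly (M (\<phi> t)) (l t) = (\<Sum>i\<le>m. coeff (M (\<phi> t)) i * l t ^ i)" for t
    using M_degree[OF poly_path_closed[OF assms(2)]] by (simp add: poly_altdef)
  moreover have "(\<lambda>t. \<Sum>i\<le>m. coeff (M (\<phi> t)) i * l t ^ i) \<in> Q"
    by (intro fun_ring_intros assms M_coeff_path)
  ultimately show ?thesis by simp
qed

lemma full_witness:
  "\<exists>g b1. polyfun_on A us g \<and> b1 \<in> carrier A \<and> g b1 \<noteq> 0 \<and>
    (\<forall>b\<in>carrier A. g b \<noteq> 0 \<longrightarrow> full A m b)"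
  using family unfolding generic_family_def by blast

lemma full_exists: "\<exists>b\<in>carrier A. full A m b"
  using full_witness by blast

lemma full_unique:
  assumes b: "b \<in> carrier A" "full A m b" and p: "alg_eval A b p = \<zero>" "degree p \<le> m"
  shows "p = Polynomial.smult (coeff p m) (M b)"
proof -
  let ?q = "p - Polynomial.smult (coeff p m) (M b)"
  have k: "alg_eval A b ?q = \<zero>"
  proof -
    have "alg_eval A b (Polynomial.smult (coeff p m) (M b)) = \<zero>"
      using b by (simp add: alg_eval_smult M_kill smult_r_null)
    then show ?thesis using alg_eval_diff_zero[OF b(1), of p "Polynomial.smult (coeff p m) (M b)"] p by simp
  qed
  have c: "coeff ?q m = 0" using M_top[OF b(1)] by simp
  have d: "degree ?q \<le> m"
    by (rule degree_diff_le) (use p M_degree[OF b(1)] in \<open>auto intro: order_trans[OF degree_smult_le]\<close>)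
  have "?q = 0"
  proof (rule ccontr)
    assume ne: "?q \<noteq> 0"
    then have "degree ?q \<noteq> m" using c by (metis leading_coeff_0_iff)
    then have "degree ?q < m" using d by simp
    then show False using ne k b(2) by (auto simp: full_def)
  qed
  then show ?thesis by simp
qed

lemma degree_pos: 
  assumes "\<one> \<noteq> \<zero>" shows "0 < m"
proof (rule ccontr)
  assume m: "\<not> 0 < m"
  obtain b where b: "b \<in> carrier A" "full A m b" using full_exists by blast
  have "M b = 1" using M_degree[OF b(1)] M_monic[OF b(1)] m
    by (metis degree_0_id gr0I one_pCons)
  then show False using M_kill[OF b(1)] b assms by (simp add: alg_eval_1)
qed

text \<open>
  Full elements are Zariski dense: on the line from \<open>a\<close> to a full element where \<open>g\<close> is nonzero, all
  but finitely many points are full.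
\<close>

lemma polynomial_identity:
  assumes f: "\<And>a x. a \<in> carrier A \<Longrightarrow> x \<in> carrier A \<Longrightarrow> (\<lambda>t. f (a \<oplus> t \<odot> x)) \<in> range poly"
    and h: "\<And>a x. a \<in> carrier A \<Longrightarrow> x \<in> carrier A \<Longrightarrow> (\<lambda>t. h (a \<oplus> t \<odot> x)) \<in> range poly"
    and eq: "\<And>b. b \<in> carrier A \<Longrightarrow> full A m b \<Longrightarrow> f b = h b"
    and a: "a \<in> carrier A"
  shows "f a = h a"
proof -
  obtain g b1 where g: "polyfun_on A us g" "b1 \<in> carrier A" "g b1 \<noteq> 0"
    "\<And>b. b \<in> carrier A \<Longrightarrow> g b \<noteq> 0 \<Longrightarrow> full A m b" using full_witness by blast
  let ?x = "b1 \<oplus> (-1) \<odot> a"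
  let ?l = "\<lambda>t. a \<oplus> t \<odot> ?x"
  have x: "?x \<in> carrier A" using a g by auto
  obtain pf ph where p: "(\<lambda>t. f (?l t)) = poly pf" "(\<lambda>t. h (?l t)) = poly ph" using f[OF a x] h[OF a x] by auto
  obtain pg where pg: "(\<lambda>t. g (?l t)) = poly pg"
    using polyfun_on_path[OF g(1) fun_ring_poly line_path[OF a x]] by auto
  have "pg * (pf - ph) = 0"
  proof (rule poly_zeroI_infinite[OF inf])
    fix t
    have lt: "?l t \<in> carrier A" using a x by auto
    have "g (?l t) = 0 \<or> f (?l t) = h (?l t)" using g(4)[OF lt] eq[OF lt] by blast
    then show "poly (pg * (pf - ph)) t = 0"
      using fun_cong[OF p(1), of t] fun_cong[OF p(2), of t] fun_cong[OF pg, of t] by auto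
  qed
  moreover have "pg \<noteq> 0"
    using fun_cong[OF pg, of 1] line_end(2)[OF a g(2)] g(3) by auto
  ultimately have "pf = ph" by simp
  then show ?thesis
    using fun_cong[OF p(1), of 0] fun_cong[OF p(2), of 0] line_end(1)[OF a g(2)] by simp
qed

text \<open>
  Substituting \<open>x + t \<lambda>\<close> into \<open>M (x + t b)\<close> gives a polynomial of degree at most \<open>m\<close> that kills \<open>b\<close>,
  with coefficient \<open>t\<^sup>m\<close> at \<open>\<lambda>\<^sup>m\<close>. For full \<open>b\<close> it is therefore \<open>t\<^sup>m M b\<close>, and the general case follows
  by density.
\<close>

lemma M_affine:
  assumes a: "a \<in> carrier A"
  shows "poly (M (x \<odot> \<one> \<oplus> t \<odot> a)) (x + t * l) = t ^ m * poly (M a) l"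
proof (rule polynomial_identity[where f = "\<lambda>b. poly (M (x \<odot> \<one> \<oplus> t \<odot> b)) (x + t * l)"
      and h = "\<lambda>b. t ^ m * poly (M b) l", OF _ _ _ a])
  fix a y assume ay: "a \<in> carrier A" "y \<in> carrier A"
  show "(\<lambda>s. poly (M (x \<odot> \<one> \<oplus> t \<odot> (a \<oplus> s \<odot> y))) (x + t * l)) \<in> range poly"
    by (intro poly_M_path fun_ring_poly poly_path_add poly_path_smult poly_path_const fun_ring_const[OF fun_ring_poly]
        line_path ay) auto
  show "(\<lambda>s. t ^ m * poly (M (a \<oplus> s \<odot> y)) l) \<in> range poly"
    by (intro fun_ring_mult[OF fun_ring_poly] poly_M_path fun_ring_poly fun_ring_const[OF fun_ring_poly]
        line_path ay)
next
  fix b assume b: "b \<in> carrier A" "full A m b"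
  let ?y = "x \<odot> \<one> \<oplus> t \<odot> b"
  have y: "?y \<in> carrier A" using b by auto
  let ?p = "pcompose (M ?y) [:x, t:]"
  have "alg_eval A b ?p = \<zero>"
    using b y by (simp add: alg_eval_pcompose alg_eval_linear M_kill)
  moreover have "degree ?p \<le> m" "coeff ?p m = t ^ m"
    using pcompose_linear_top[of "M ?y" m x t] M_degree[OF y] M_top[OF y] by auto
  ultimately have "?p = Polynomial.smult (t ^ m) (M b)" using full_unique[OF b, of ?p] by simp
  then have "poly ?p l = poly (Polynomial.smult (t ^ m) (M b)) l" by simp
  then show "poly (M ?y) (x + t * l) = t ^ m * poly (M b) l"
    by (simp add: poly_pcompose mult.commute)
qed

text \<open>
  By \<open>M_affine\<close> the polynomial is homogeneous, and it is monic.
\<close>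

lemma M_zero: "poly (M \<zero>) l = l ^ m"
proof -
  define c where "c = poly (M \<zero>) 1"
  have e: "poly (M \<zero>) t = t ^ m * c" for t
    using M_affine[of \<zero> 0 t 1] smult_r_null by (simp add: sm_zero c_def)
  have "M \<zero> = monom c m"
    by (rule poly_eqI_infinite[OF inf]) (simp add: poly_monom e mult.commute)
  then have "coeff (M \<zero>) m = c" by simp
  then have "c = 1" using M_top[of \<zero>] by simp
  then show ?thesis using e by simp
qed

lemma M_const_scale: "a \<in> carrier A \<Longrightarrow> poly (M (t \<odot> a)) 0 = t ^ m * poly (M a) 0"
  using M_affine[of a 0 t 0] by (simp add: sm_zero)

lemma M_const_one: "poly (M \<one>) 0 = (-1) ^ m"
proof -
  have "1 \<odot> \<one> \<oplus> 1 \<odot> \<zero> = \<one>" using smult_r_null by (simp add: sm_one)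
  then show ?thesis using M_affine[OF zero_closed, of 1 1 "-1"] M_zero[of "-1"] by simp
qed

text \<open>
  The factorisation \<open>M X = (\<lambda> - l) \<cdot> Q + M X l\<close> evaluated at \<open>\<lambda> = X\<close>, where the left hand side is zero.
\<close>

lemma M_quotient:
  assumes X: "X \<in> carrier A"
  shows "(l \<odot> \<one> \<oplus> (-1) \<odot> X) \<otimes> alg_eval A X (synthetic_div (M X) l) = poly (M X) l \<odot> \<one>"
proof -
  have "[:l, -1:] * synthetic_div (M X) l = [:poly (M X) l:] - M X"
  proof -
    have "M X = [:- l, 1:] * synthetic_div (M X) l + [:poly (M X) l:]"
      by (rule synthetic_div_correct'[symmetric])
    then have "[:poly (M X) l:] - M X = - ([:- l, 1:] * synthetic_div (M X) l)"
      by (metis add_diff_cancel_right' minus_diff_eq)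
    also have "\<dots> = (- [:- l, 1:]) * synthetic_div (M X) l" by (simp only: mult_minus_left)
    finally show ?thesis by simp
  qed
  then have "alg_eval A X ([:l, -1:] * synthetic_div (M X) l) = alg_eval A X ([:poly (M X) l:] - M X)" by simp
  also have "\<dots> = alg_eval A X [:poly (M X) l:] \<oplus> alg_eval A X (- M X)"
    using alg_eval_add[OF X, of "[:poly (M X) l:]" "- M X"] by simp
  also have "\<dots> = poly (M X) l \<odot> \<one>"
    using X by (simp add: alg_eval_const alg_eval_uminus M_kill smult_r_null)
  finally show ?thesis unfolding alg_eval_mult[OF X] alg_eval_linear[OF X] .
qed

lemma quotient_path:
  assumes "fun_ring Q" "poly_path Q \<phi>" "l \<in> Q"
  shows "poly_path Q (\<lambda>t. alg_eval A (\<phi> t) (synthetic_div (M (\<phi> t)) (l t)))"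
proof (rule poly_path_alg_eval[OF assms(1,2)])
  fix i
  have "coeff (synthetic_div (M (\<phi> t)) (l t)) i = (\<Sum>j\<le>m. coeff (M (\<phi> t)) (Suc i + j) * l t ^ j)" for t
    by (rule coeff_synthetic_div) (simp add: M_degree[OF poly_path_closed[OF assms(2)]])
  moreover have "(\<lambda>t. \<Sum>j\<le>m. coeff (M (\<phi> t)) (Suc i + j) * l t ^ j) \<in> Q"
    by (intro fun_ring_intros assms M_coeff_path)
  ultimately show "(\<lambda>t. coeff (synthetic_div (M (\<phi> t)) (l t)) i) \<in> Q" by simp
next
  fix t show "degree (synthetic_div (M (\<phi> t)) (l t)) \<le> m"
    using M_degree[OF poly_path_closed[OF assms(2)], of t] by (simp add: degree_synthetic_div)
qed

text \<open>
  The polynomial \<open>(M X - M X 0) / \<lambda>\<close>, evaluated at \<open>X\<close> and negated.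
\<close>

definition adjoint :: "'a \<Rightarrow> 'a" where
  "adjoint X = (-1) \<odot> alg_eval A X (synthetic_div (M X) 0)"

lemma adjoint_closed [simp, intro]: "X \<in> carrier A \<Longrightarrow> adjoint X \<in> carrier A"
  by (simp add: adjoint_def)

lemma mult_adjoint:
  assumes X: "X \<in> carrier A" shows "X \<otimes> adjoint X = poly (M X) 0 \<odot> \<one>"
proof -
  have "(0 \<odot> \<one> \<oplus> (-1) \<odot> X) \<otimes> alg_eval A X (synthetic_div (M X) 0) = X \<otimes> adjoint X"
    using X by (simp add: adjoint_def sm_zero sm_mult1 sm_mult2)
  then show ?thesis using M_quotient[OF X, of 0] by simp
qed

lemma adjoint_path: "fun_ring Q \<Longrightarrow> poly_path Q \<phi> \<Longrightarrow> poly_path Q (\<lambda>t. adjoint (\<phi> t))"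
  unfolding adjoint_def
  by (intro poly_path_smult fun_ring_const quotient_path)

end

section \<open>Norms down from a subalgebra\<close>

lemma assoc_algebraI:
  fixes A :: "('k::field, 'a) module" (structure)
  assumes "ring A"
    and "\<And>c x. x \<in> carrier A \<Longrightarrow> c \<odot> x \<in> carrier A"
    and "\<And>c d x. x \<in> carrier A \<Longrightarrow> (c + d) \<odot> x = c \<odot> x \<oplus> d \<odot> x"
    and "\<And>c x y. x \<in> carrier A \<Longrightarrow> y \<in> carrier A \<Longrightarrow> c \<odot> (x \<oplus> y) = c \<odot> x \<oplus> c \<odot> y"
    and "\<And>c d x. x \<in> carrier A \<Longrightarrow> (c * d) \<odot> x = c \<odot> (d \<odot> x)"
    and "\<And>x. x \<in> carrier A \<Longrightarrow> 1 \<odot> x = x"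
    and "\<And>c x y. x \<in> carrier A \<Longrightarrow> y \<in> carrier A \<Longrightarrow> (c \<odot> x) \<otimes> y = c \<odot> (x \<otimes> y)"
    and "\<And>c x y. x \<in> carrier A \<Longrightarrow> y \<in> carrier A \<Longrightarrow> x \<otimes> (c \<odot> y) = c \<odot> (x \<otimes> y)"
  shows "assoc_algebra class_ring A"
proof -
  interpret ring A by fact
  interpret K: field "class_ring :: 'k ring" by (rule class_field)
  show ?thesis
    by unfold_locales (use assms(2-) in auto)
qed

lemma type_algebra_simps [simp]:
  "carrier (type_algebra scale) = UNIV" "x \<otimes>\<^bsub>type_algebra scale\<^esub> y = x * y" "\<one>\<^bsub>type_algebra scale\<^esub> = 1"
  "\<zero>\<^bsub>type_algebra scale\<^esub> = 0" "x \<oplus>\<^bsub>type_algebra scale\<^esub> y = x + y" "c \<odot>\<^bsub>type_algebra scale\<^esub> x = scale c x"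
  by (simp_all add: type_algebra_def)

lemma type_algebra_UNIV: "(type_algebra scale)\<lparr>carrier := UNIV\<rparr> = type_algebra scale"
  by (simp add: type_algebra_def)

locale scalar_ring =
  fixes scale :: "'k::field \<Rightarrow> 'd::ring_1 \<Rightarrow> 'd"
  assumes asc: "assoc_algebra class_ring (type_algebra scale)"
begin

lemma scale_add_left: "scale (a + b) x = scale a x + scale b x"
  and scale_add_right: "scale a (x + y) = scale a x + scale a y"
  and scale_mult: "scale (a * b) x = scale a (scale b x)"
  and scale_one: "scale 1 x = x"
  and scale_mult_left: "scale a x * y = scale a (x * y)"
  and scale_mult_right: "x * scale a y = scale a (x * y)"
proof -
  interpret assoc_algebra class_ring "type_algebra scale" by (rule asc)
  show "scale (a + b) x = scale a x + scale b x" using smult_l_distr[of a b x] by simp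
  show "scale a (x + y) = scale a x + scale a y" using smult_r_distr[of a x y] by simp
  show "scale (a * b) x = scale a (scale b x)" using smult_assoc1[of a b x] by simp
  show "scale 1 x = x" using smult_one[of x] by simp
  show "scale a x * y = scale a (x * y)" using smult_mult_left[of a x y] by simp
  show "x * scale a y = scale a (x * y)" using smult_mult_right[of a x y] by simp
qed

lemma scale_zero_left [simp]: "scale 0 x = 0"
  using scale_add_left[of 0 0 x] by simp

lemma scale_zero_right [simp]: "scale a 0 = 0"
  using scale_add_right[of a 0 0] by simp

lemma scale_minus_right: "scale a (- x) = - scale a x"
  using scale_add_right[of a x "- x"] by (simp add: eq_neg_iff_add_eq_0 add.commute)

lemma scale_diff_right: "scale a (x - y) = scale a x - scale a y"
  using scale_add_right[of a x "- y"] by (simp add: scale_minus_right)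

lemma scale_minus_left: "scale (- a) x = - scale a x"
  using scale_add_left[of a "- a" x] by (simp add: eq_neg_iff_add_eq_0 add.commute)

lemma scale_sum_right: "scale a (\<Sum>i\<in>I. f i) = (\<Sum>i\<in>I. scale a (f i))"
  by (induction I rule: infinite_finite_induct) (auto simp: scale_add_right)

lemma scale_sum_left: "scale (\<Sum>i\<in>I. f i) x = (\<Sum>i\<in>I. scale (f i) x)"
  by (induction I rule: infinite_finite_induct) (auto simp: scale_add_left)

lemma scale_commute: "scale a (scale b x) = scale b (scale a x)"
  by (metis scale_mult mult.commute)

lemma scale_as_mult: "scale a x = scale a 1 * x"
  by (simp add: scale_mult_left)

lemma scale_power: "scale a x ^ j = scale (a ^ j) (x ^ j)"
  by (induction j) (auto simp: scale_one scale_mult_left scale_mult_right scale_mult intro: scale_commute)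

lemma scale_eq_0: "scale a x = 0 \<Longrightarrow> a \<noteq> 0 \<Longrightarrow> x = 0"
  by (metis scale_mult scale_one scale_zero_right left_inverse)

end

lemma sum_convolution:
  fixes \<phi> :: "nat \<Rightarrow> nat \<Rightarrow> 'a::comm_monoid_add"
  assumes "\<And>i l. i > N \<or> l > N \<Longrightarrow> \<phi> i l = 0"
  shows "(\<Sum>i\<le>N. \<Sum>l\<le>N. \<phi> i l) = (\<Sum>s\<le>2*N. \<Sum>i\<le>s. \<phi> i (s - i))"
proof -
  have "(\<Sum>i\<le>N. \<Sum>l\<le>N. \<phi> i l) = (\<Sum>(i,l)\<in>{..N}\<times>{..N}. \<phi> i l)"
    by (rule sum.cartesian_product)
  also have "\<dots> = (\<Sum>(i,l)\<in>{(i,l). i + l \<le> 2*N}. \<phi> i l)"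
  proof (rule sum.mono_neutral_left)
    show "finite {(i, l). i + l \<le> 2 * N}"
      by (rule finite_subset[of _ "{..2*N} \<times> {..2*N}"]) auto
    show "\<forall>p\<in>{(i, l). i + l \<le> 2 * N} - {..N} \<times> {..N}. (case p of (i, l) \<Rightarrow> \<phi> i l) = 0"
    proof
      fix p assume p: "p \<in> {(i, l). i + l \<le> 2 * N} - {..N} \<times> {..N}"
      obtain i l where il: "p = (i, l)" by fastforce
      have "i > N \<or> l > N" using p il by auto
      then show "(case p of (i, l) \<Rightarrow> \<phi> i l) = 0" using il assms[of i l] by simp
    qed
  qed auto
  also have "\<dots> = (\<Sum>s\<le>2*N. \<Sum>i\<le>s. \<phi> i (s - i))"
    by (rule sum.triangle_reindex_eq)
  finally show ?thesis .
qed

text \<open>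
  A \<open>K\<close>-subalgebra \<open>E\<close> of the ring type \<open>'d\<close> with its generic family. It covers both the whole ring
  and its center.
\<close>

locale subalgebra_family = scalar_ring scale +
  generic_algebra "(type_algebra scale)\<lparr>carrier := E\<rparr>" us m M
  for scale :: "'k::field \<Rightarrow> 'd::ring_1 \<Rightarrow> 'd" and E us m M
begin

abbreviation "AE \<equiv> (type_algebra scale)\<lparr>carrier := E\<rparr>"

lemma E_closed: "1 \<in> E" "0 \<in> E" "x \<in> E \<Longrightarrow> y \<in> E \<Longrightarrow> x + y \<in> E" "x \<in> E \<Longrightarrow> y \<in> E \<Longrightarrow> x * y \<in> E"
  "x \<in> E \<Longrightarrow> scale c x \<in> E"
  using one_closed zero_closed a_closed[of x y] m_closed[of x y] sm_closed[of x c] by auto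

lemma E_finsum: "finite S \<Longrightarrow> f \<in> S \<rightarrow> E \<Longrightarrow> finsum AE f S = sum f S"
proof (induction S rule: finite_induct)
  case empty
  then show ?case using fs_empty[of f] by simp
next
  case (insert s S)
  have "finsum AE f (insert s S) = f s \<oplus>\<^bsub>AE\<^esub> finsum AE f S" by (rule fs_insert) (use insert in auto)
  then show ?case using insert by simp
qed

lemma E_pow: "b [^]\<^bsub>AE\<^esub> (j::nat) = b ^ j"
  by (induction j) (auto simp: Group.nat_pow_def power_commutes)

lemma E_power_closed: "b \<in> E \<Longrightarrow> b ^ j \<in> E"
  by (induction j) (auto intro: E_closed)

lemma E_alg_eval_superset:
  assumes "b \<in> E" "degree p \<le> N"
  shows "alg_eval AE b p = (\<Sum>i\<le>N. scale (coeff p i) (b ^ i))"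
proof -
  have "alg_eval AE b p = (\<Sum>i\<le>degree p. scale (coeff p i) (b ^ i))"
    unfolding alg_eval_def
    by (subst E_finsum) (use assms in \<open>auto simp: E_pow intro!: E_closed E_power_closed\<close>)
  also have "\<dots> = (\<Sum>i\<le>N. scale (coeff p i) (b ^ i))"
    by (rule sum.mono_neutral_left) (use assms in \<open>auto simp: coeff_eq_0\<close>)
  finally show ?thesis .
qed

lemma poly_path_sum:
  assumes "fun_ring Q" "finite I" "\<And>i. i \<in> I \<Longrightarrow> poly_path Q (\<phi> i)"
  shows "poly_path Q (\<lambda>t. \<Sum>i\<in>I. \<phi> i t)"
  using assms(2,3)
proof (induction I rule: finite_induct)
  case empty
  then show ?case using poly_path_const[OF assms(1), of 0] E_closed by simp
next
  case (insert i I)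
  then show ?case using poly_path_add[OF assms(1), of "\<phi> i" "\<lambda>t. \<Sum>i\<in>I. \<phi> i t"] by simp
qed

lemma M_const_scale': "x \<in> E \<Longrightarrow> poly (M (scale t x)) 0 = t ^ m * poly (M x) 0"
  using M_const_scale[of x t] by simp

text \<open>
  The function \<open>f\<close> lists the coefficients of a monic polynomial \<open>F\<close> of degree \<open>q\<close> over \<open>E\<close>, and \<open>h\<close>
  and \<open>g\<close> are the coefficients of \<open>F\<close> times its adjoint, computed at each
  \<open>t \<in> K\<close> and interpolated. The polynomial \<open>h\<close> is the reduced norm of \<open>F\<close> up to sign; its degree is exactly
  \<open>q m\<close> because the reversed polynomial \<open>F'\<close> takes the invertible value \<open>1\<close> at \<open>0\<close>.
  The product is stated coefficientwise since \<open>E\<close> may be noncommutative.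
\<close>

lemma norm_multiple:
  assumes f: "\<And>i. f i \<in> E" "f q = 1" "\<And>i. i > q \<Longrightarrow> f i = 0"
  shows "\<exists>(h::'k poly) g. h \<noteq> 0 \<and> degree h = q * m \<and> (\<forall>l. g l \<in> E) \<and> finite {l. g l \<noteq> 0} \<and>
    (\<forall>s. scale (coeff h s) 1 = (\<Sum>i\<le>s. f i * g (s - i)))"
proof -
  define F where "F t = (\<Sum>i\<le>q. scale (t ^ i) (f i))" for t
  note fr = fun_ring_poly[where ?'a = 'k]
  have tm: "poly_path (range poly) (\<lambda>t. scale (t ^ k) (f i))" for i k
  proof -
    have 1: "poly_path (range poly) (\<lambda>_. f i)" by (rule poly_path_const[OF fr]) (simp add: f)
    have 2: "(\<lambda>t::'k. t ^ k) \<in> range poly" by (rule fun_ring_power[OF fr fun_ring_poly_id])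
    show ?thesis using poly_path_smult[OF fr 2 1] by simp
  qed
  have Fpath: "poly_path (range poly) F" unfolding F_def by (intro poly_path_sum fr tm) auto
  have FE: "F t \<in> E" for t using poly_path_closed[OF Fpath, of t] by simp
  obtain h where h: "\<And>t. poly h t = poly (M (F t)) 0"
  proof -
    have "(\<lambda>t. poly (M (F t)) 0) \<in> range poly"
      by (intro poly_M_path fr Fpath fun_ring_const[OF fr])
    then obtain h where "(\<lambda>t. poly (M (F t)) 0) = poly h" by auto
    then show ?thesis using that by (metis (full_types))
  qed
  define F' where "F' u = (\<Sum>i\<le>q. scale (u ^ (q - i)) (f i))" for u
  have F'path: "poly_path (range poly) F'" unfolding F'_def by (intro poly_path_sum fr tm) auto
  have F'E: "F' t \<in> E" for t using poly_path_closed[OF F'path, of t] by simp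
  obtain h' where h': "\<And>t. poly h' t = poly (M (F' t)) 0"
  proof -
    have "(\<lambda>t. poly (M (F' t)) 0) \<in> range poly"
      by (intro poly_M_path fr F'path fun_ring_const[OF fr])
    then obtain h where "(\<lambda>t. poly (M (F' t)) 0) = poly h" by auto
    then show ?thesis using that by (metis (full_types))
  qed
  have FF': "F t = scale (t ^ q) (F' (inverse t))" if "t \<noteq> 0" for t
  proof -
    have "t ^ q * inverse t ^ (q - i) = t ^ i" if "i \<le> q" for i
    proof -
      have "t ^ q = t ^ i * t ^ (q - i)" using that by (simp flip: power_add)
      then show ?thesis using \<open>t \<noteq> 0\<close> by (simp add: power_inverse)
    qed
    then show ?thesis unfolding F_def F'_def scale_sum_right scale_mult[symmetric]
      by (intro sum.cong) auto
  qed
  have hh': "poly h t = t ^ (q * m) * poly h' (inverse t)" if "t \<noteq> 0" for t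
    using FF'[OF that] M_const_scale'[OF F'E, of "t ^ q" "inverse t"]
    by (simp add: h h' power_mult)
  have "F' 0 = f q"
  proof -
    have "F' 0 = (\<Sum>i\<le>q. if i = q then f q else 0)"
      unfolding F'_def by (intro sum.cong) (auto simp: scale_one power_0_left)
    then show ?thesis by simp
  qed
  then have h'0: "coeff h' 0 \<noteq> 0"
    using h'[of 0] M_const_one f(2) by (simp add: poly_0_coeff_0)
  have "monom 1 (degree h') * h = monom 1 (q * m) * reflect_poly h'"
  proof (rule ccontr)
    assume ne: "monom 1 (degree h') * h \<noteq> monom 1 (q * m) * reflect_poly h'"
    have "monom 1 (degree h') * h - monom 1 (q * m) * reflect_poly h' = 0"
      by (rule poly_zeroI_infinite[where S = "UNIV - {0}"])
        (use inf in \<open>auto simp: poly_monom hh' poly_reflect_poly_nz\<close>)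
    then show False using ne by simp
  qed
  then have eq: "monom 1 (degree h') * h = monom 1 (q * m) * reflect_poly h'" .
  have h'nz: "h' \<noteq> 0" using h'0 by auto
  then have "reflect_poly h' \<noteq> 0" by simp
  then have hnz: "h \<noteq> 0" using eq by auto
  have "degree (monom 1 (degree h') * h) = degree h' + degree h"
    using hnz by (simp add: degree_mult_eq degree_monom_eq)
  moreover have "degree (monom (1::'k) (q * m) * reflect_poly h') = q * m + degree h'"
    using h'nz h'0 by (simp add: degree_mult_eq degree_monom_eq)
  ultimately have deg: "degree h = q * m" using eq by simp
  have "poly_path (range poly) (\<lambda>t. adjoint (F t))" by (rule adjoint_path[OF fr Fpath])
  from path_expansion[OF this] obtain g L where g: "\<And>s. g s \<in> E" "\<And>s. s > L \<Longrightarrow> g s = 0"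
    "\<And>t. adjoint (F t) = finsum AE (\<lambda>s. scale (t ^ s) (g s)) {..L}" by auto
  have G: "adjoint (F t) = (\<Sum>s\<le>L. scale (t ^ s) (g s))" for t
    unfolding g(3) by (rule E_finsum) (auto intro!: E_closed g)
  have FG: "F t * adjoint (F t) = scale (poly h t) 1" for t
    using mult_adjoint[of "F t"] FE by (simp add: h)
  define N where "N = q + L + degree h"
  have FN: "F t = (\<Sum>i\<le>N. scale (t ^ i) (f i))" for t
    unfolding F_def by (rule sum.mono_neutral_left) (auto simp: N_def f)
  have GN: "adjoint (F t) = (\<Sum>i\<le>N. scale (t ^ i) (g i))" for t
    unfolding G by (rule sum.mono_neutral_left) (auto simp: N_def g)
  define conv where "conv s = (\<Sum>i\<le>s. f i * g (s - i))" for s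
  have conv: "F t * adjoint (F t) = (\<Sum>s\<le>2*N. scale (t ^ s) (conv s))" for t
  proof -
    have "F t * adjoint (F t) = (\<Sum>i\<le>N. \<Sum>l\<le>N. scale (t ^ (i + l)) (f i * g l))"
      unfolding GN unfolding FN sum_product
      by (intro sum.cong refl)
        (auto simp: scale_mult_left scale_mult_right power_add scale_mult intro: scale_commute)
    also have "\<dots> = (\<Sum>s\<le>2*N. \<Sum>i\<le>s. scale (t ^ (i + (s - i))) (f i * g (s - i)))"
    proof (rule sum_convolution)
      fix i l assume "i > N \<or> l > N"
      then have "f i = 0 \<or> g l = 0" using f(3)[of i] g(2)[of l] by (auto simp: N_def)
      then show "scale (t ^ (i + l)) (f i * g l) = 0" by auto
    qed
    also have "\<dots> = (\<Sum>s\<le>2*N. scale (t ^ s) (conv s))"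
      unfolding conv_def scale_sum_right by (intro sum.cong refl) auto
    finally show ?thesis .
  qed
  have hN: "scale (poly h t) 1 = (\<Sum>s\<le>2*N. scale (t ^ s) (scale (coeff h s) 1))" for t
  proof -
    have "poly h t = (\<Sum>s\<le>2*N. coeff h s * t ^ s)"
      unfolding poly_altdef by (rule sum.mono_neutral_left) (auto simp: N_def coeff_eq_0)
    then show ?thesis by (auto simp: scale_sum_left scale_mult intro!: sum.cong scale_commute)
  qed
  have convE: "conv s \<in> E" for s
  proof -
    have "(\<Sum>i\<in>I. f i * g (s - i)) \<in> E" if "finite I" for I
      using that by (induction I rule: finite_induct) (auto intro!: E_closed f g)
    then show ?thesis by (simp add: conv_def)
  qed
  have small: "scale (coeff h s) 1 = conv s" if "s \<le> 2 * N" for s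
  proof -
    define d where "d s = scale (-1) (conv s) + scale (coeff h s) 1" for s
    have dE: "d s \<in> E" for s unfolding d_def by (intro E_closed convE)
    have "d s = 0"
    proof -
      have "d s = \<zero>\<^bsub>AE\<^esub>"
      proof (rule vector_poly_zero[OF inf _ _ that])
        show "d s \<in> carrier AE" for s using dE by simp
        show "finsum AE (\<lambda>s. t ^ s \<odot>\<^bsub>AE\<^esub> d s) {..2 * N} = \<zero>\<^bsub>AE\<^esub>" for t
        proof -
          have "finsum AE (\<lambda>s. t ^ s \<odot>\<^bsub>AE\<^esub> d s) {..2 * N} = (\<Sum>s\<le>2*N. scale (t ^ s) (d s))"
            by (subst E_finsum) (auto intro!: E_closed dE)
          also have "\<dots> = scale (poly h t) 1 - F t * adjoint (F t)"
            unfolding conv hN d_def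
            by (simp add: scale_minus_left scale_one scale_diff_right sum_subtractf)
          finally show ?thesis by (simp add: FG)
        qed
      qed
      then show ?thesis by simp
    qed
    then show ?thesis by (simp add: d_def scale_minus_left scale_one)
  qed
  have "scale (coeff h s) 1 = conv s" for s
  proof (cases "s \<le> 2 * N")
    case False
    have "f i * g (s - i) = 0" if "i \<le> s" for i
    proof (cases "i \<le> q")
      case True
      then have "s - i > L" using False by (simp add: N_def)
      then show ?thesis by (simp add: g)
    qed (simp add: f)
    then have "conv s = 0" by (simp add: conv_def)
    moreover have "coeff h s = 0" using False by (intro coeff_eq_0) (simp add: N_def)
    ultimately show ?thesis by simp
  qed (rule small)
  moreover have "finite {l. g l \<noteq> 0}" by (rule finite_subset[of _ "{..L}"]) (use g(2) not_less in auto)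
  ultimately show ?thesis using hnz deg g(1) by (intro exI[of _ h] exI[of _ g]) (auto simp: conv_def)
qed

end

section \<open>Separable elements and the Frobenius\<close>

lemma prime_is_CHAR:
  assumes "prime p" "of_nat p = (0::'a::comm_ring_1)"
  shows "p = CHAR('a)"
proof -
  have "CHAR('a) dvd p" using assms(2) by (simp add: of_nat_eq_0_iff_char_dvd)
  then have "CHAR('a) = 1 \<or> CHAR('a) = p" using assms(1) by (auto simp: prime_nat_iff)
  moreover have "CHAR('a) \<noteq> 1" using of_nat_eq_0_iff_char_dvd[of 1, where ?'a = 'a] by auto
  ultimately show ?thesis by simp
qed

text \<open>
  The Frobenius applied to the coefficients; it kills \<open>b\<^sup>p\<close> if \<open>q\<close> kills \<open>b\<close>.
\<close>

definition frob_poly :: "nat \<Rightarrow> 'a::field poly \<Rightarrow> 'a poly" where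
  "frob_poly p q = (\<Sum>i\<le>degree q. monom (coeff q i ^ p) i)"

lemma frob_poly_power:
  fixes q :: "'a::field poly"
  assumes "prime p" "of_nat p = (0::'a)"
  shows "q ^ p = pcompose (frob_poly p q) (monom 1 p)"
proof -
  have p0: "of_nat p = (0 :: 'a poly)" using assms(2) by (simp add: of_nat_poly)
  have "q ^ p = (\<Sum>i\<le>degree q. monom (coeff q i) i) ^ p" by (simp add: poly_as_sum_of_monoms)
  also have "\<dots> = (\<Sum>i\<le>degree q. monom (coeff q i) i ^ p)" using prime_is_CHAR[OF assms(1) p0] assms(1) by (intro freshmans_dream_sum) auto
  also have "\<dots> = (\<Sum>i\<le>degree q. pcompose (monom (coeff q i ^ p) i) (monom 1 p))"
  proof (rule sum.cong)
    fix i
    have "pcompose (monom c i) r = Polynomial.smult c (r ^ i)" for c :: 'a and r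
      by (induction i) (auto simp: monom_Suc monom_0 pcompose_pCons)
    then show "monom (coeff q i) i ^ p = pcompose (monom (coeff q i ^ p) i) (monom 1 p)"
      by (simp add: monom_power smult_monom mult.commute)
  qed simp
  also have "\<dots> = pcompose (frob_poly p q) (monom 1 p)" by (simp add: frob_poly_def pcompose_sum)
  finally show ?thesis .
qed

lemma coeff_frob_poly: "p > 0 \<Longrightarrow> coeff (frob_poly p q) i = coeff q i ^ p"
  by (auto simp: frob_poly_def coeff_sum coeff_eq_0)

lemma degree_frob_poly: "p > 0 \<Longrightarrow> degree (frob_poly p q) = degree q"
proof (cases "q = 0")
  case False
  assume p: "p > 0"
  show ?thesis
  proof (rule antisym)
    show "degree (frob_poly p q) \<le> degree q" by (rule degree_le) (simp add: coeff_frob_poly[OF p] coeff_eq_0 p)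
    show "degree q \<le> degree (frob_poly p q)" by (rule le_degree) (use False in \<open>simp add: coeff_frob_poly[OF p]\<close>)
  qed
qed (simp add: frob_poly_def)

lemma pderiv_ne_0_iff: "pderiv (p :: 'a::field poly) \<noteq> 0 \<longleftrightarrow> (\<exists>k. coeff p k \<noteq> 0 \<and> of_nat k \<noteq> (0::'a))"
proof
  assume "pderiv p \<noteq> 0"
  then obtain k where "coeff (pderiv p) k \<noteq> 0" by (metis leading_coeff_0_iff)
  then show "\<exists>k. coeff p k \<noteq> 0 \<and> of_nat k \<noteq> (0::'a)" by (auto simp: coeff_pderiv simp del: of_nat_Suc)
next
  assume "\<exists>k. coeff p k \<noteq> 0 \<and> of_nat k \<noteq> (0::'a)"
  then obtain k where k: "coeff p k \<noteq> 0" "of_nat k \<noteq> (0::'a)" by blast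
  then obtain j where "k = Suc j" by (cases k) auto
  then have "coeff (pderiv p) j \<noteq> 0" using k by (simp add: coeff_pderiv)
  then show "pderiv p \<noteq> 0" by auto
qed

text \<open>
  Writing \<open>P = m\<^sup>i k\<close> and differentiating, \<open>i m' k\<close> is divisible by \<open>m\<close>, and both \<open>m'\<close> and \<open>i\<close> are
  prime to \<open>m\<close> as long as \<open>i < p\<close>.
\<close>

lemma prime_power_dvd_of_frobenius:
  fixes m P :: "'a::field poly"
  assumes pr: "prime_elem m" and m': "pderiv m \<noteq> 0" and dvd: "m dvd P" and P': "pderiv P = 0"
    and p: "prime p" "of_nat p = (0::'a)"
  shows "m ^ p dvd P"
proof -
  have ndvd: "\<not> m dvd pderiv m"
  proof
    assume "m dvd pderiv m"
    then have "degree m \<le> degree (pderiv m)" using m' by (rule dvd_imp_degree_le)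
    moreover have "degree m \<noteq> 0" using m' by (metis degree_eq_zeroE pderiv_pCons pderiv_0 pCons_0_0 add.right_neutral)
    ultimately show False using degree_pderiv_le[of m] by linarith
  qed
  have m0: "m \<noteq> 0" using pr by auto
  have "m ^ i dvd P" if "i \<le> p" "i \<ge> 1" for i
    using that(2,1)
  proof (induction i rule: dec_induct)
    case base
    then show ?case using dvd by simp
  next
    case (step i)
    have "m ^ i dvd P" by (rule step.IH) (use step in auto)
    then obtain k where k: "P = m ^ i * k" by (elim dvdE)
    obtain j where j: "i = Suc j" using step by (cases i) auto
    have "pderiv P = pderiv (m ^ Suc j) * k + m ^ Suc j * pderiv k"
      unfolding k j pderiv_mult by (simp only: mult.commute add.commute)
    also have "\<dots> = m ^ j * (Polynomial.smult (of_nat i) (pderiv m * k) + m * pderiv k)"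
      unfolding pderiv_power_Suc j by (simp add: distrib_left mult_ac del: of_nat_Suc)
    finally have "0 = m ^ j * (Polynomial.smult (of_nat i) (pderiv m * k) + m * pderiv k)"
      using P' by simp
    then have "Polynomial.smult (of_nat i) (pderiv m * k) + m * pderiv k = 0" using m0 by simp
    then have "Polynomial.smult (of_nat i) (pderiv m * k) = m * (- pderiv k)" by (simp add: eq_neg_iff_add_eq_0)
    then have d: "m dvd Polynomial.smult (of_nat i) (pderiv m * k)" by simp
    have "of_nat i \<noteq> (0::'a)"
    proof
      assume "of_nat i = (0::'a)"
      then have "p dvd i" by (simp add: of_nat_eq_0_iff_char_dvd prime_is_CHAR[OF p])
      then have "p \<le> i" using step by (intro dvd_imp_le) simp_all
      then show False using step by simp
    qed
    then have "m dvd pderiv m * k" using d by (simp add: dvd_smult_iff)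
    then have "m dvd k" using pr ndvd by (simp add: prime_elem_dvd_mult_iff)
    then show ?case unfolding k by (metis mult_dvd_mono dvd_refl power_Suc2)
  qed
  then show ?thesis using prime_gt_0_nat[OF p(1)] by simp
qed

locale division_family = subalgebra_family scale UNIV us m M
  for scale :: "'k::field \<Rightarrow> 'd::division_ring \<Rightarrow> 'd" and us m M
begin

abbreviation ev :: "'d \<Rightarrow> 'k poly \<Rightarrow> 'd" where "ev b p \<equiv> alg_eval AE b p"

lemma ev_superset: "degree p \<le> N \<Longrightarrow> ev b p = (\<Sum>i\<le>N. scale (coeff p i) (b ^ i))"
  by (rule E_alg_eval_superset) auto

lemma ev_simps: "ev b (p + q) = ev b p + ev b q" "ev b (p * q) = ev b p * ev b q"
  "ev b (Polynomial.smult c p) = scale c (ev b p)" "ev b 0 = 0" "ev b 1 = 1" "ev b [:c:] = scale c 1"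
  "ev b (- p) = - ev b p" "ev b (pcompose p q) = ev (ev b q) p"
  using alg_eval_add[of b p q] alg_eval_mult[of b p q] alg_eval_smult[of b c p] alg_eval_0[of b]
    alg_eval_1[of b] alg_eval_const[of b c] alg_eval_uminus[of b p] alg_eval_pcompose[of b p q]
  by (auto simp: scale_minus_left scale_one)

lemma ev_diff: "ev b (p - q) = ev b p - ev b q"
  using ev_simps(1)[of b p "- q"] by (simp add: ev_simps(7))

lemma ev_power: "ev b (p ^ j) = ev b p ^ j"
  by (induction j) (auto simp: ev_simps)

lemma ev_sum: "ev b (\<Sum>i\<in>I. f i) = (\<Sum>i\<in>I. ev b (f i))"
  by (induction I rule: infinite_finite_induct) (auto simp: ev_simps)

lemma ev_monom: "ev b (monom c j) = scale c (b ^ j)"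
proof -
  have "ev b (monom c j) = (\<Sum>i\<le>j. scale (coeff (monom c j) i) (b ^ i))"
    by (rule ev_superset) (rule degree_monom_le)
  also have "\<dots> = (\<Sum>i\<le>j. if i = j then scale c (b ^ j) else 0)" by (rule sum.cong) auto
  finally show ?thesis by simp
qed

lemma ev_M: "ev b (M b) = 0"
  using M_kill[of b] by simp

lemma fullD: "full AE m b \<Longrightarrow> ev b p = 0 \<Longrightarrow> degree p < m \<Longrightarrow> p = 0"
  by (auto simp: full_def)

lemma m_pos: "m > 0"
  by (rule degree_pos) simp

text \<open>
  There are no zero divisors in a division algebra, so one of two factors already kills \<open>b\<close>.
\<close>

lemma killing_degree_prime:
  assumes full: "full AE r b" and q: "ev b q = 0" "degree q = r" "r > 0"
  shows "prime_elem q"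
proof (rule field_poly_irreducible_imp_prime, rule irreducibleI)
  show "q \<noteq> 0" using q by auto
  show "\<not> q dvd 1" using q by (auto simp: is_unit_iff_degree \<open>q \<noteq> 0\<close>)
next
  fix u v assume uv: "q = u * v"
  have nz: "u \<noteq> 0" "v \<noteq> 0" using uv q by auto
  have deg: "degree u + degree v = r" using uv q nz by (simp add: degree_mult_eq)
  have "ev b u * ev b v = 0" using q(1) by (simp add: uv ev_simps)
  then have "ev b u = 0 \<or> ev b v = 0" by simp
  then have "degree u \<ge> r \<or> degree v \<ge> r" using full nz by (auto simp: full_def not_less[symmetric])
  then have "degree u = 0 \<or> degree v = 0" using deg by auto
  then show "u dvd 1 \<or> v dvd 1" using nz by (auto simp: is_unit_iff_degree)
qed

lemma killing_dvd:
  assumes full: "full AE r b" and q: "ev b q = 0" "degree q = r" "r > 0" and P: "ev b P = 0"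
  shows "q dvd P"
proof -
  have q0: "q \<noteq> 0" using q by auto
  have "ev b (P div q * q + P mod q) = ev b (P div q) * ev b q + ev b (P mod q)"
    by (simp only: ev_simps)
  then have "ev b (P mod q) = 0" using P q(1) by simp
  moreover have "P mod q = 0 \<or> degree (P mod q) < r" using degree_mod_less[OF q0, of P] q by simp
  ultimately have "P mod q = 0" using full by (auto simp: full_def)
  then show ?thesis by auto
qed

text \<open>
  The element \<open>b\<close> has degree \<open>r\<close> over the base field, with a separable minimal polynomial.
\<close>

definition sep_element :: "nat \<Rightarrow> 'd \<Rightarrow> bool" where
  "sep_element r b \<longleftrightarrow> full AE r b \<and> (\<exists>q. ev b q = 0 \<and> degree q = r \<and> pderiv q \<noteq> 0)"

text \<open>
  A polynomial \<open>h\<close> killing \<open>b\<^sup>p\<close> gives the polynomial \<open>h(\<lambda>\<^sup>p)\<close> with zero derivative killing \<open>b\<close>. By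
  separability, the \<open>p\<close>-th power of the minimal polynomial of \<open>b\<close> divides it, and \<open>deg h \<ge> r\<close>
  follows.
\<close>

lemma sep_element_frobenius:
  assumes s: "sep_element r b" and r: "r > 0" and p: "prime p" "of_nat p = (0::'k)"
  shows "sep_element r (b ^ p)"
proof -
  obtain q where full: "full AE r b" and q: "ev b q = 0" "degree q = r" "pderiv q \<noteq> 0"
    using s by (auto simp: sep_element_def)
  have p0: "p > 0" using prime_gt_0_nat[OF p(1)] .
  have pr: "prime_elem q" by (rule killing_degree_prime[OF full q(1,2) r])
  have evp: "ev (b ^ p) h = ev b (pcompose h (monom 1 p))" for h
    by (simp add: ev_simps ev_monom scale_one)
  have "full AE r (b ^ p)"
    unfolding full_def
  proof (intro allI impI)
    fix h assume h: "ev (b ^ p) h = \<zero>\<^bsub>AE\<^esub>" "degree h < r"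
    show "h = 0"
    proof (rule ccontr)
      assume h0: "h \<noteq> 0"
      let ?P = "pcompose h (monom 1 p)"
      have "q dvd ?P" by (rule killing_dvd[OF full q(1,2) r]) (use h evp in auto)
      moreover have "pderiv ?P = 0"
        using p by (simp add: pderiv_pcompose pderiv_monom)
      ultimately have "q ^ p dvd ?P" using prime_power_dvd_of_frobenius[OF pr q(3) _ _ p] by blast
      moreover have degP: "degree ?P = degree h * p" by (simp add: degree_monom_eq)
      moreover have "?P \<noteq> 0" using h0 p0 by (simp add: pcompose_eq_0_iff degree_monom_eq)
      ultimately have "degree (q ^ p) \<le> degree h * p" using dvd_imp_degree_le by metis
      then have "p * r \<le> degree h * p" using q pr by (simp add: degree_power_eq)
      then show False using h(2) p0 by (simp add: mult.commute)
    qed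
  qed
  moreover have "ev (b ^ p) (frob_poly p q) = 0"
    unfolding evp frob_poly_power[OF p, symmetric] ev_power using q p0 by simp
  moreover have "degree (frob_poly p q) = r" using q p0 by (simp add: degree_frob_poly)
  moreover have "pderiv (frob_poly p q) \<noteq> 0"
    using q(3) p0 unfolding pderiv_ne_0_iff by (auto simp: coeff_frob_poly)
  ultimately show ?thesis by (auto simp: sep_element_def)
qed

lemma sep_element_frobenius_power:
  assumes "sep_element r b" "r > 0" "prime p" "of_nat p = (0::'k)"
  shows "sep_element r (b ^ (p ^ s))"
proof (induction s)
  case (Suc s)
  have "b ^ (p ^ Suc s) = (b ^ (p ^ s)) ^ p" by (simp add: mult.commute flip: power_mult)
  then show ?case using sep_element_frobenius[OF Suc assms(2-4)] by simp
qed (use assms in simp)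

end

section \<open>Separability over the center\<close>

notation fps_nth (infixl "$$$" 75)

context division_family
begin

text \<open>
  A curve that is polynomial in the scalar parameter \<open>t\<close> is encoded by its expansion at \<open>t = 0\<close>. Power series
  multiply correctly because \<open>t\<close> is central, and they provide coefficient extraction for
  noncommutative coefficients.
\<close>

definition rep :: "('k \<Rightarrow> 'd) \<Rightarrow> 'd fps \<Rightarrow> bool" where
  "rep \<phi> F \<longleftrightarrow> (\<exists>L. (\<forall>l>L. F $$$ l = 0) \<and> (\<forall>t. \<phi> t = (\<Sum>l\<le>L. scale (t ^ l) (F $$$ l))))"

lemma repE_large:
  assumes "rep \<phi> F"
  obtains L where "\<And>N l. L \<le> N \<Longrightarrow> N < l \<Longrightarrow> F $$$ l = 0"
    "\<And>N t. L \<le> N \<Longrightarrow> \<phi> t = (\<Sum>l\<le>N. scale (t ^ l) (F $$$ l))"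
proof -
  obtain L where L: "\<And>l. l > L \<Longrightarrow> F $$$ l = 0" "\<And>t. \<phi> t = (\<Sum>l\<le>L. scale (t ^ l) (F $$$ l))"
    using assms by (auto simp: rep_def)
  have "\<phi> t = (\<Sum>l\<le>N. scale (t ^ l) (F $$$ l))" if "L \<le> N" for N t
    unfolding L(2) by (rule sum.mono_neutral_left) (use that L(1) in auto)
  then show ?thesis using L(1) that[of L] by auto
qed

lemma rep_add: assumes "rep \<phi> F" "rep \<psi> G" shows "rep (\<lambda>t. \<phi> t + \<psi> t) (F + G)"
proof -
  obtain L where L: "\<And>N l. L \<le> N \<Longrightarrow> N < l \<Longrightarrow> F $$$ l = 0"
    "\<And>N t. L \<le> N \<Longrightarrow> \<phi> t = (\<Sum>l\<le>N. scale (t ^ l) (F $$$ l))" using repE_large[OF assms(1)] by metis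
  obtain K where K: "\<And>N l. K \<le> N \<Longrightarrow> N < l \<Longrightarrow> G $$$ l = 0"
    "\<And>N t. K \<le> N \<Longrightarrow> \<psi> t = (\<Sum>l\<le>N. scale (t ^ l) (G $$$ l))" using repE_large[OF assms(2)] by metis
  show ?thesis unfolding rep_def
    by (rule exI[of _ "L + K"]) (auto simp: L(1)[of "L + K"] K(1)[of "L + K"] L(2)[of "L + K"] K(2)[of "L + K"]
        scale_add_right sum.distrib)
qed

lemma rep_mult: assumes "rep \<phi> F" "rep \<psi> G" shows "rep (\<lambda>t. \<phi> t * \<psi> t) (F * G)"
proof -
  obtain L where L: "\<And>N l. L \<le> N \<Longrightarrow> N < l \<Longrightarrow> F $$$ l = 0"
    "\<And>N t. L \<le> N \<Longrightarrow> \<phi> t = (\<Sum>l\<le>N. scale (t ^ l) (F $$$ l))" using repE_large[OF assms(1)] by metis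
  obtain K where K: "\<And>N l. K \<le> N \<Longrightarrow> N < l \<Longrightarrow> G $$$ l = 0"
    "\<And>N t. K \<le> N \<Longrightarrow> \<psi> t = (\<Sum>l\<le>N. scale (t ^ l) (G $$$ l))" using repE_large[OF assms(2)] by metis
  define N where "N = L + K"
  have FG0: "F $$$ i = 0 \<or> G $$$ l = 0" if "i > N \<or> l > N" for i l
    using that L(1)[of N i] K(1)[of N l] by (auto simp: N_def)
  have "\<phi> t * \<psi> t = (\<Sum>s\<le>2*N. scale (t ^ s) ((F * G) $$$ s))" for t
  proof -
    have "\<phi> t * \<psi> t = (\<Sum>i\<le>N. \<Sum>l\<le>N. scale (t ^ (i + l)) (F $$$ i * G $$$ l))"
      unfolding L(2)[of N, unfolded N_def, simplified, folded N_def] K(2)[of N, unfolded N_def, simplified, folded N_def] sum_product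
      by (intro sum.cong refl)
        (auto simp: scale_mult_left scale_mult_right power_add scale_mult intro: scale_commute)
    also have "\<dots> = (\<Sum>s\<le>2*N. \<Sum>i\<le>s. scale (t ^ (i + (s - i))) (F $$$ i * G $$$ (s - i)))"
    proof (rule sum_convolution)
      fix i l assume "i > N \<or> l > N"
      then have "F $$$ i = 0 \<or> G $$$ l = 0" by (rule FG0)
      then show "scale (t ^ (i + l)) (F $$$ i * G $$$ l) = 0" by auto
    qed
    also have "\<dots> = (\<Sum>s\<le>2*N. scale (t ^ s) ((F * G) $$$ s))"
      unfolding fps_mult_nth scale_sum_right by (intro sum.cong refl) (auto simp: atLeast0AtMost)
    finally show ?thesis .
  qed
  moreover have "(F * G) $$$ s = 0" if "s > 2 * N" for s
    unfolding fps_mult_nth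
  proof (rule sum.neutral, rule ballI)
    fix i assume "i \<in> {0..s}"
    then have "i > N \<or> s - i > N" using that by auto
    then show "F $$$ i * G $$$ (s - i) = 0" using FG0[of i "s - i"] by auto
  qed
  ultimately show ?thesis unfolding rep_def by blast
qed

lemma rep_const: "rep (\<lambda>t. x) (fps_const x)"
  unfolding rep_def by (rule exI[of _ 0]) (auto simp: scale_one)

lemma rep_power: "rep \<phi> F \<Longrightarrow> rep (\<lambda>t. \<phi> t ^ j) (F ^ j)"
  by (induction j) (use rep_const[of 1] in \<open>auto intro: rep_mult\<close>)

lemma rep_sum: "(\<And>i. i \<in> I \<Longrightarrow> rep (\<phi> i) (F i)) \<Longrightarrow> rep (\<lambda>t. \<Sum>i\<in>I. \<phi> i t) (\<Sum>i\<in>I. F i)"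
  by (induction I rule: infinite_finite_induct) (use rep_const[of 0] in \<open>auto intro: rep_add\<close>)

lemma rep_monom: "rep (\<lambda>t. scale (t ^ j) x) (fps_const x * fps_X ^ j)"
  unfolding rep_def
proof (intro exI[of _ j] conjI allI impI)
  fix l assume "l > j"
  then show "(fps_const x * fps_X ^ j) $$$ l = 0" by (simp add: fps_X_power_nth)
next
  fix t
  have "(\<Sum>l\<le>j. scale (t ^ l) ((fps_const x * fps_X ^ j) $$$ l)) = (\<Sum>l\<le>j. if l = j then scale (t ^ j) x else 0)"
    by (rule sum.cong) (auto simp: fps_X_power_nth)
  then show "scale (t ^ j) x = (\<Sum>l\<le>j. scale (t ^ l) ((fps_const x * fps_X ^ j) $$$ l))" by simp
qed

lemma rep_scalar: "rep (\<lambda>t. scale (poly p t) 1) (Abs_fps (\<lambda>l. scale (coeff p l) 1))"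
  unfolding rep_def
proof (intro exI[of _ "degree p"] conjI allI impI)
  fix t show "scale (poly p t) 1 = (\<Sum>l\<le>degree p. scale (t ^ l) (Abs_fps (\<lambda>l. scale (coeff p l) 1) $$$ l))"
    by (auto simp: poly_altdef scale_sum_left scale_mult intro!: sum.cong scale_commute)
qed (simp add: coeff_eq_0)

lemma rep_zero:
  assumes "rep \<phi> F" "\<And>t. \<phi> t = 0" shows "F $$$ s = 0"
proof -
  obtain L where L: "\<And>l. l > L \<Longrightarrow> F $$$ l = 0" "\<And>t. \<phi> t = (\<Sum>l\<le>L. scale (t ^ l) (F $$$ l))"
    using assms by (auto simp: rep_def)
  have "F $$$ s = \<zero>\<^bsub>AE\<^esub>" if "s \<le> L"
  proof (rule vector_poly_zero[OF inf _ _ that])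
    fix t
    have "finsum AE (\<lambda>s. t ^ s \<odot>\<^bsub>AE\<^esub> F $$$ s) {..L} = (\<Sum>l\<le>L. scale (t ^ l) (F $$$ l))"
      by (subst E_finsum) auto
    then show "finsum AE (\<lambda>s. t ^ s \<odot>\<^bsub>AE\<^esub> F $$$ s) {..L} = \<zero>\<^bsub>AE\<^esub>" using L(2)[of t] assms(2) by simp
  qed auto
  then show ?thesis using L(1) by (cases "s \<le> L") auto
qed

lemma M_coeff_line: "\<exists>p. \<forall>t. coeff (M (b + scale t x)) i = poly p t"
proof -
  have "(\<lambda>t. coeff (M (b + scale t x)) i) \<in> range poly"
    using M_coeff_path[OF fun_ring_poly line_path[of b x], of i] by simp
  then obtain p where "(\<lambda>t. coeff (M (b + scale t x)) i) = poly p" by blast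
  then show ?thesis by (intro exI[of _ p]) (simp add: fun_eq_iff)
qed

text \<open>
  The classical independence argument: in a shortest relation \<open>\<Sum>\<^sub>j b\<^sub>j x e\<^sub>j = 0\<close> normalised by \<open>e\<^sub>N = 1\<close>,
  subtracting the relation for \<open>x\<close> times \<open>y\<close> from that for \<open>x y\<close> shortens it. Hence all \<open>e\<^sub>j\<close>
  commute with every \<open>y\<close>, are scalars, and the relation at \<open>x = 1\<close> is one between the \<open>b\<^sub>j\<close>.
\<close>

lemma artin_whaples:
  fixes b e :: "nat \<Rightarrow> 'd" and N :: nat
  assumes central: "\<And>z. (\<And>x. z * x = x * z) \<Longrightarrow> \<exists>a. z = scale a 1"
    and ind: "\<And>a. (\<Sum>j<N. scale (a j) (b j)) = 0 \<Longrightarrow> \<forall>j<N. a j = 0"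
    and zero: "\<And>x. (\<Sum>j<N. b j * x * e j) = 0" and "j < N"
  shows "e j = 0"
  using ind zero \<open>j < N\<close>
proof (induction N arbitrary: e j)
  case (Suc N)
  have indN: "\<forall>j<N. a j = 0" if "(\<Sum>j<N. scale (a j) (b j)) = 0" for a
  proof -
    have "(\<Sum>j<Suc N. scale ((a(N := 0)) j) (b j)) = 0" using that by simp
    then have "\<forall>j<Suc N. (a(N := 0)) j = 0" by (rule Suc.prems(1))
    then show ?thesis by (metis fun_upd_other less_SucI less_irrefl)
  qed
  have eN: "e N = 0"
  proof (rule ccontr)
    assume ne: "e N \<noteq> 0"
    define e' where "e' j = e j * inverse (e N)" for j
    have e'N: "e' N = 1" using ne by (simp add: e'_def)
    have z: "(\<Sum>j<N. b j * x * e' j) + b N * x = 0" for x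
    proof -
      have "((\<Sum>j<N. b j * x * e j) + b N * x * e N) * inverse (e N) = 0" using Suc.prems(2)[of x] by simp
      then show ?thesis using ne by (simp add: distrib_right sum_distrib_right e'_def mult.assoc)
    qed
    have cent: "y * e' j = e' j * y" if "j < N" for y j
    proof -
      have "(\<Sum>j<N. b j * x * (y * e' j - e' j * y)) = 0" for x
      proof -
        have "(\<Sum>j<N. b j * x * (y * e' j - e' j * y)) =
          (\<Sum>j<N. b j * (x * y) * e' j) - (\<Sum>j<N. b j * x * e' j) * y"
          by (simp add: right_diff_distrib sum_subtractf sum_distrib_right mult.assoc)
        also have "\<dots> = ((\<Sum>j<N. b j * (x * y) * e' j) + b N * (x * y)) - ((\<Sum>j<N. b j * x * e' j) + b N * x) * y"
          by (simp add: distrib_right mult.assoc)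
        finally show ?thesis using z[of "x * y"] z[of x] by simp
      qed
      from Suc.IH[OF indN this that] show ?thesis by simp
    qed
    have "\<exists>a. e' j = scale a 1" if "j < N" for j using central[of "e' j"] cent[OF that] by metis
    then obtain a where a: "\<And>j. j < N \<Longrightarrow> e' j = scale (a j) 1" by metis
    have "(\<Sum>j<Suc N. scale ((a(N := 1)) j) (b j)) = (\<Sum>j<N. b j * 1 * e' j) + b N * 1"
      by (auto simp: a scale_mult_right scale_one intro!: sum.cong)
    also have "\<dots> = 0" by (rule z)
    finally have "\<forall>j<Suc N. (a(N := 1)) j = 0" by (rule Suc.prems(1))
    then show False by auto
  qed
  have z: "(\<Sum>j<N. b j * x * e j) = 0" for x using Suc.prems(2)[of x] eN by simp
  show ?case
  proof (cases "j = N")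
    case False
    then have "j < N" using Suc.prems(3) by simp
    from Suc.IH[OF indN z this] show ?thesis by simp
  qed (simp add: eN)
qed simp

text \<open>
  Here the base field is the full center. If all \<open>M b\<close> had derivative zero, then differentiating
  \<open>M (b + t x) (b + t x) = 0\<close> at \<open>t = 0\<close> would express
  \<open>\<Phi> x = \<Sum>\<^sub>i c\<^sub>i \<Sum>\<^sub>j\<^sub><\<^sub>i b\<^sup>j x b\<^bsup>i-1-j\<^esup>\<close> as a combination of powers \<open>b\<^sup>i\<close> with \<open>p\<close> dividing \<open>i\<close>.
  By \<open>artin_whaples\<close>, \<open>\<Phi>\<close> is not zero. But \<open>\<Phi> (x b) = \<Phi> x \<cdot> b\<close> is also a combination of such powers,
  which is impossible as the exponents are shifted by one.
\<close>

lemma separable_generic: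
  assumes central: "\<And>z. (\<And>x. z * x = x * z) \<Longrightarrow> \<exists>a. z = scale a 1"
  shows "\<exists>b k. coeff (M b) k \<noteq> 0 \<and> of_nat k \<noteq> (0::'k)"
proof (rule ccontr)
  assume "\<not> ?thesis"
  then have H: "coeff (M b) k = 0" if "of_nat k \<noteq> (0::'k)" for b k using that by blast
  obtain b where b: "full AE m b" using full_exists by auto
  have mm: "coeff (M x) m = 1" for x using M_top[of x] by simp
  have m0: "of_nat m = (0::'k)" using H[of m b] mm by fastforce
  define D where "D x i = (\<Sum>j<i. b ^ j * x * b ^ (i - 1 - j))" for x i
  define \<Phi> where "\<Phi> x = (\<Sum>i\<le>m. scale (coeff (M b) i) (D x i))" for x
  \<comment> \<open>The coefficients \<open>y i\<close> are minus the derivatives of the coefficients of \<open>M (b + t x)\<close> at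
    \<open>t = 0\<close>; the top one is constant, whence \<open>y m = 0\<close>.\<close>
  have span: "\<exists>y. (\<forall>i. of_nat i \<noteq> (0::'k) \<longrightarrow> y i = 0) \<and> y m = 0 \<and> \<Phi> x = (\<Sum>i\<le>m. scale (y i) (b ^ i))" for x
  proof -
    have "\<forall>i. \<exists>p. \<forall>t. coeff (M (b + scale t x)) i = poly p t" using M_coeff_line by blast
    then obtain p where p: "\<And>i t. coeff (M (b + scale t x)) i = poly (p i) t" by metis
    let ?P = "fps_const b + fps_const x * fps_X ^ 1"
    let ?C = "\<lambda>i. Abs_fps (\<lambda>l. scale (coeff (p i) l) 1)"
    have "rep (\<lambda>t. b + scale (t ^ 1) x) ?P" by (intro rep_add rep_const rep_monom)
    then have "rep (\<lambda>t. \<Sum>i\<le>m. scale (poly (p i) t) 1 * (b + scale (t ^ 1) x) ^ i) (\<Sum>i\<le>m. ?C i * ?P ^ i)"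
      by (intro rep_sum rep_mult rep_power rep_scalar)
    moreover have "(\<Sum>i\<le>m. scale (poly (p i) t) 1 * (b + scale (t ^ 1) x) ^ i) = 0" for t
    proof -
      have "ev (b + scale t x) (M (b + scale t x)) = (\<Sum>i\<le>m. scale (coeff (M (b + scale t x)) i) ((b + scale t x) ^ i))"
        by (rule ev_superset) (use M_degree in auto)
      then show ?thesis using ev_M[of "b + scale t x"] by (simp add: p scale_mult_left)
    qed
    ultimately have "(\<Sum>i\<le>m. ?C i * ?P ^ i) $$$ 1 = 0" by (rule rep_zero)
    moreover have P0: "(?P ^ i) $$$ 0 = b ^ i" for i by (induction i) auto
    moreover have P1: "(?P ^ i) $$$ 1 = D x i" for i
    proof (induction i)
      case 0
      then show ?case by (simp add: D_def)
    next
      case (Suc i)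
      have "?P ^ Suc i = ?P ^ i * ?P" by (rule power_Suc2)
      then have "(?P ^ Suc i) $$$ 1 = (?P ^ i) $$$ 0 * x + (?P ^ i) $$$ 1 * b"
        by (simp add: fps_mult_nth_1 del: power_Suc)
      also have "\<dots> = b ^ i * x + D x i * b" using Suc P0[of i] by simp
      also have "D x i * b = (\<Sum>j<i. b ^ j * x * b ^ (i - j))"
        unfolding D_def sum_distrib_right
      proof (rule sum.cong)
        fix j assume "j \<in> {..<i}"
        then have "b ^ (i - j) = b ^ (i - 1 - j) * b" by (metis Suc_diff_Suc diff_Suc_1' diff_right_commute lessThan_iff power_Suc2 diff_Suc_eq_diff_pred)
        then show "b ^ j * x * b ^ (i - 1 - j) * b = b ^ j * x * b ^ (i - j)" by (simp add: mult.assoc)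
      qed simp
      finally show ?case by (simp add: D_def add.commute)
    qed
    ultimately have s0: "(\<Sum>i\<le>m. scale (coeff (p i) 0) (D x i) + scale (coeff (p i) 1) (b ^ i)) = 0"
      by (simp add: fps_sum_nth fps_mult_nth_1 scale_mult_left del: One_nat_def power_Suc)
    have p0: "coeff (p i) 0 = coeff (M b) i" for i using p[of 0 i] by (simp add: poly_0_coeff_0)
    have p1: "coeff (p i) 1 = 0" if "of_nat i \<noteq> (0::'k)" for i
    proof -
      have "p i = 0" by (rule poly_eqI_infinite[OF inf]) (use H[OF that] p[of _ i] in auto)
      then show ?thesis by simp
    qed
    have pm: "coeff (p m) 1 = 0"
    proof -
      have "p m = 1" by (rule poly_eqI_infinite[OF inf]) (use mm p[of _ m] in auto)
      then show ?thesis by (simp add: coeff_eq_0)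
    qed
    have "\<Phi> x = (\<Sum>i\<le>m. scale (- coeff (p i) 1) (b ^ i))"
      using s0 by (simp add: \<Phi>_def p0 sum.distrib scale_minus_left sum_negf eq_neg_iff_add_eq_0)
    then show ?thesis using p1 pm by (intro exI[of _ "\<lambda>i. - coeff (p i) 1"]) auto
  qed
  define e where "e j = (\<Sum>i\<in>{Suc j..m}. scale (coeff (M b) i) (b ^ (i - 1 - j)))" for j
  have \<Phi>e: "\<Phi> x = (\<Sum>j<m. b ^ j * x * e j)" for x
  proof -
    have "\<Phi> x = (\<Sum>i\<le>m. \<Sum>j<i. b ^ j * x * scale (coeff (M b) i) (b ^ (i - 1 - j)))"
      by (simp add: \<Phi>_def D_def scale_sum_right scale_mult_right)
    also have "\<dots> = (\<Sum>i\<in>{..m}. \<Sum>j\<in>{j\<in>{..<m}. j < i}. b ^ j * x * scale (coeff (M b) i) (b ^ (i - 1 - j)))"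
      by (intro sum.cong refl) auto
    also have "\<dots> = (\<Sum>j\<in>{..<m}. \<Sum>i\<in>{i\<in>{..m}. j < i}. b ^ j * x * scale (coeff (M b) i) (b ^ (i - 1 - j)))"
      by (rule sum.swap_restrict) auto
    also have "\<dots> = (\<Sum>j<m. b ^ j * x * e j)"
      unfolding e_def sum_distrib_left by (intro sum.cong refl) auto
    finally show ?thesis .
  qed
  have "\<exists>x. \<Phi> x \<noteq> 0"
  proof (rule ccontr)
    assume "\<not> ?thesis"
    then have z: "(\<Sum>j<m. b ^ j * x * e j) = 0" for x using \<Phi>e by simp
    have ind: "\<forall>j<m. a j = 0" if "(\<Sum>j<m. scale (a j) (b ^ j)) = 0" for a
    proof -
      define p where "p = (\<Sum>j<m. monom (a j) j)"
      have cp: "coeff p i = (if i < m then a i else 0)" for i by (auto simp: p_def coeff_sum)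
      have "degree p \<le> m - 1" by (rule degree_le) (auto simp: cp)
      moreover have "ev b p = 0" using that by (simp add: p_def ev_sum ev_monom)
      ultimately have "p = 0" using fullD[OF b] m_pos by simp
      then show ?thesis using cp by (metis coeff_0)
    qed
    have "e (m - 1) = 0"
      by (rule artin_whaples[where N = m and b = "\<lambda>j. b ^ j", OF central ind z]) (use m_pos in auto)
    moreover have "e (m - 1) = 1" using m_pos mm[of b] by (simp add: e_def scale_one)
    ultimately show False by simp
  qed
  then obtain x where x: "\<Phi> x \<noteq> 0" ..
  have \<Phi>b: "\<Phi> (x * b) = \<Phi> x * b"
    by (simp add: \<Phi>_def D_def scale_mult_left sum_distrib_right mult.assoc power_commutes)
  obtain y where y: "\<And>i. of_nat i \<noteq> (0::'k) \<Longrightarrow> y i = 0" "y m = 0" "\<Phi> x = (\<Sum>i\<le>m. scale (y i) (b ^ i))"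
    using span[of x] by blast
  obtain y' where y': "\<And>i. of_nat i \<noteq> (0::'k) \<Longrightarrow> y' i = 0" "y' m = 0" "\<Phi> (x * b) = (\<Sum>i\<le>m. scale (y' i) (b ^ i))"
    using span[of "x * b"] by blast
  define P where "P = pCons 0 (\<Sum>i\<le>m. monom (y i) i) - (\<Sum>i\<le>m. monom (y' i) i)"
  have cP: "coeff P k = (if k = 0 then 0 else if k - 1 \<le> m then y (k - 1) else 0) - (if k \<le> m then y' k else 0)" for k
    by (cases k) (auto simp: P_def coeff_sum)
  have ym1: "y (m - 1) = 0"
    by (rule y(1)) (use m0 m_pos in \<open>simp add: of_nat_diff\<close>)
  have "coeff P k = 0" if "k \<ge> m" for k
  proof -
    have "k = m \<or> k = Suc m \<or> k > Suc m" using that by arith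
    then show ?thesis using ym1 y(2) y'(2) m_pos by (elim disjE) (auto simp: cP)
  qed
  then have degP: "P = 0 \<or> degree P < m" by (metis leading_coeff_0_iff not_less)
  have "ev b P = \<Phi> x * b - \<Phi> (x * b)"
  proof -
    have "pCons 0 (\<Sum>i\<le>m. monom (y i) i) = (\<Sum>i\<le>m. monom (y i) i) * monom 1 1"
      by (simp add: monom_altdef mult.commute)
    then show ?thesis unfolding P_def ev_diff y(3) y'(3)
      by (simp add: ev_simps ev_sum ev_monom scale_one)
  qed
  then have "ev b P = 0" using \<Phi>b by simp
  then have P0: "P = 0" using degP fullD[OF b] by blast
  have "y i = 0" if "i \<le> m" for i
  proof (cases "of_nat i = (0::'k)")
    case True
    have "of_nat (Suc i) \<noteq> (0::'k)" using True by simp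
    then have "y' (Suc i) = 0" by (rule y'(1))
    then show ?thesis using cP[of "Suc i"] P0 that by (simp split: if_splits)
  qed (rule y(1))
  then have "\<Phi> x = 0" unfolding y(3) by simp
  then show False using x by simp
qed

end

section \<open>The degree of a division algebra over a subfield of its center\<close>

context subalgebra_family
begin

lemma scale_of_nat: "scale (of_nat j) x = of_nat j * x"
  by (induction j) (auto simp: scale_add_left scale_one distrib_right)

end

context division_family
begin

text \<open>
  The largest \<open>q\<close>, a power of the characteristic exponent, such that every \<open>M b\<close> is a polynomial in
  \<open>\<lambda>\<^sup>q\<close>. By maximality, some \<open>M b\<close> is not a polynomial in \<open>\<lambda>\<^bsup>pq\<^esup>\<close>, so that as a polynomial in \<open>\<lambda>\<^sup>q\<close>
  it has a nonzero derivative.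
\<close>

lemma inseparable_exponent:
  "\<exists>q k. q > 0 \<and> (q = 1 \<or> (\<exists>p s. prime p \<and> of_nat p = (0::'k) \<and> q = p ^ s)) \<and>
     (\<forall>b k. coeff (M b) k \<noteq> 0 \<longrightarrow> q dvd k) \<and>
     (\<exists>b. coeff (M b) k \<noteq> 0 \<and> of_nat (k div q) \<noteq> (0::'k))"
proof -
  define S where "S q \<longleftrightarrow> q > 0 \<and> (q = 1 \<or> (\<exists>p s. prime p \<and> of_nat p = (0::'k) \<and> q = p ^ s)) \<and>
    (\<forall>b k. coeff (M b) k \<noteq> 0 \<longrightarrow> q dvd k)" for q :: nat
  have mm: "coeff (M x) m = 1" for x using M_top[of x] by simp
  have S1: "S 1" by (simp add: S_def)
  have Sle: "q \<le> m" if "S q" for q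
  proof -
    have "coeff (M 0) m \<noteq> 0" using mm[of 0] by simp
    then have "q dvd m" using that unfolding S_def by blast
    then show ?thesis using m_pos by (rule dvd_imp_le)
  qed
  define q where "q = Greatest S"
  have Sq: "S q" unfolding q_def by (rule GreatestI_nat[where k = 1 and b = m]) (use S1 Sle in auto)
  have max: "q' \<le> q" if "S q'" for q'
    unfolding q_def by (rule Greatest_le_nat[where b = m]) (use that Sle in auto)
  have q0: "q > 0" and qdvd: "\<And>b k. coeff (M b) k \<noteq> 0 \<Longrightarrow> q dvd k" using Sq by (auto simp: S_def)
  have "\<exists>b k. coeff (M b) k \<noteq> 0 \<and> of_nat (k div q) \<noteq> (0::'k)"
  proof (rule ccontr)
    assume "\<not> ?thesis"
    then have H: "of_nat (k div q) = (0::'k)" if "coeff (M b) k \<noteq> 0" for b k using that by blast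
    let ?c = "CHAR('k)"
    have cd: "?c dvd k div q" if "coeff (M b) k \<noteq> 0" for b k
      using H[OF that] by (simp add: of_nat_eq_0_iff_char_dvd)
    have "q dvd m" using qdvd[of 0 m] mm by simp
    then have mq: "m div q > 0" using m_pos q0 by (simp add: dvd_imp_le div_greater_zero_iff)
    have "?c \<noteq> 0" using cd[of 0 m] mm mq by auto
    then have pc: "prime ?c" by (intro prime_CHAR_semidom) simp 
    have "S (?c * q)"
      unfolding S_def
    proof (intro conjI disjI2 allI impI)
      show "?c * q > 0" using q0 \<open>?c \<noteq> 0\<close> by simp
      have "\<exists>s. q = ?c ^ s"
      proof (cases "q = 1")
        case True then show ?thesis by (intro exI[of _ 0]) simp
      next
        case False
        then obtain p s where ps: "prime p" "of_nat p = (0::'k)" "q = p ^ s" using Sq by (auto simp: S_def)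
        then have "?c dvd p" by (simp add: of_nat_eq_0_iff_char_dvd)
        then have "p = ?c" using ps(1) pc by (metis prime_nat_iff not_prime_1)
        then show ?thesis using ps by blast
      qed
      then obtain s where "q = ?c ^ s" ..
      then show "\<exists>p s. prime p \<and> of_nat p = (0::'k) \<and> ?c * q = p ^ s"
        using pc by (intro exI[of _ ?c] exI[of _ "Suc s"]) simp
      fix b k assume k: "coeff (M b) k \<noteq> 0"
      obtain r where r: "k = q * r" using qdvd[OF k] by (elim dvdE)
      have "?c dvd r" using cd[OF k] q0 by (simp add: r)
      then show "?c * q dvd k" by (auto simp: r)
    qed
    then have "?c * q \<le> q" by (rule max)
    moreover have "?c \<ge> 2" using pc by (rule prime_ge_2_nat)
    ultimately show False using q0 by simp
  qed
  then show ?thesis using Sq unfolding S_def by blast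
qed

text \<open>
  A weak substitute for being a nonempty Zariski open set that refers only to lines over the smaller
  field \<open>K\<close>. It is therefore also available for conditions that are polynomial over the center.
\<close>

definition dense :: "('d \<Rightarrow> bool) \<Rightarrow> bool" where
  "dense P \<longleftrightarrow> (\<exists>b. P b) \<and> (\<forall>a x. P a \<longrightarrow> finite {t. \<not> P (a + scale t x)})"

lemma dense_conj:
  assumes "dense P" "dense Q" shows "dense (\<lambda>b. P b \<and> Q b)"
  unfolding dense_def
proof (intro conjI allI impI)
  obtain a b where ab: "P a" "Q b" using assms by (auto simp: dense_def)
  have "finite {t. \<not> P (a + scale t (b - a))}" "finite {t. \<not> Q (b + scale t (a - b))}"
    using assms ab by (auto simp: dense_def)
  moreover have "finite ((\<lambda>t. 1 - t) ` {t. \<not> Q (b + scale t (a - b))})" using calculation(2) by simp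
  ultimately have "finite ({t. \<not> P (a + scale t (b - a))} \<union> (\<lambda>t. 1 - t) ` {t. \<not> Q (b + scale t (a - b))})"
    by simp
  then obtain t where t: "t \<notin> {t. \<not> P (a + scale t (b - a))} \<union> (\<lambda>t. 1 - t) ` {t. \<not> Q (b + scale t (a - b))}"
    using inf ex_new_if_finite by blast
  have "a + scale t (b - a) = b + scale (1 - t) (a - b)"
  proof -
    have "scale (1 - t) (a - b) = (a - b) - scale t (a - b)"
      using scale_add_left[of "1 - t" t "a - b"] by (simp add: scale_one algebra_simps)
    then show ?thesis by (simp add: scale_diff_right)
  qed
  moreover have "Q (b + scale (1 - t) (a - b))" 
  proof (rule ccontr)
    assume "\<not> ?thesis"
    then have "t \<in> (\<lambda>t. 1 - t) ` {t. \<not> Q (b + scale t (a - b))}" by (intro image_eqI[of _ _ "1 - t"]) auto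
    then show False using t by blast
  qed
  ultimately show "\<exists>b. P b \<and> Q b" using t by (intro exI[of _ "a + scale t (b - a)"]) auto
next
  fix a x assume "P a \<and> Q a"
  then have "finite {t. \<not> P (a + scale t x)}" "finite {t. \<not> Q (a + scale t x)}"
    using assms by (auto simp: dense_def)
  then have "finite ({t. \<not> P (a + scale t x)} \<union> {t. \<not> Q (a + scale t x)})" by simp
  then show "finite {t. \<not> (P (a + scale t x) \<and> Q (a + scale t x))}"
    by (rule rev_finite_subset) auto
qed

lemma polyfun_line:
  assumes "polyfun_on AE us f"
  shows "\<exists>p. \<forall>t. f (a + scale t x) = poly p t"
proof -
  have "(\<lambda>t. f (a + scale t x)) \<in> range poly"
    using polyfun_on_path[OF assms fun_ring_poly line_path[of a x]] by simp
  then obtain p where "(\<lambda>t. f (a + scale t x)) = poly p" by blast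
  then show ?thesis by (intro exI[of _ p]) (simp add: fun_eq_iff)
qed

lemma dense_polyfun:
  assumes f: "polyfun_on AE us f" "f b \<noteq> 0"
  shows "dense (\<lambda>b. f b \<noteq> 0)"
  unfolding dense_def
proof (intro conjI allI impI)
  fix a x assume a: "f a \<noteq> 0"
  obtain p where p: "\<And>t. f (a + scale t x) = poly p t" using polyfun_line[OF f(1)] by blast
  have "poly p 0 = f a" using p[of 0] by simp
  then have "p \<noteq> 0" using a by auto
  then show "finite {t. \<not> f (a + scale t x) \<noteq> 0}" using poly_roots_finite[of p] by (simp add: p)
qed (use f in blast)

end

text \<open>
  First-order expansion of \<open>(\<beta> + \<zeta> t\<^sup>q)\<^sup>j\<close> in \<open>t\<^sup>q\<close>.
\<close>

lemma curve_power_coeff: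
  fixes \<beta> \<zeta> :: "'a::ring_1" and q :: nat
  assumes q: "q > 0" and comm: "\<zeta> * \<beta> = \<beta> * \<zeta>"
  defines "P \<equiv> fps_const \<beta> + fps_const \<zeta> * fps_X ^ q"
  shows "(P ^ j) $$$ 0 = \<beta> ^ j" "0 < l \<Longrightarrow> l < q \<Longrightarrow> (P ^ j) $$$ l = 0"
    "(P ^ j) $$$ q = of_nat j * \<beta> ^ (j - 1) * \<zeta>"
proof -
  have mult: "(F * P) $$$ l = F $$$ l * \<beta> + (if l < q then 0 else F $$$ (l - q) * \<zeta>)" for F l
  proof -
    have "F * P = F * fps_const \<beta> + (F * fps_const \<zeta>) * fps_X ^ q"
      by (simp add: P_def distrib_left mult.assoc)
    then show ?thesis by (simp add: fps_X_power_mult_right_nth)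
  qed
  have all: "(P ^ j) $$$ 0 = \<beta> ^ j \<and> (\<forall>l. 0 < l \<longrightarrow> l < q \<longrightarrow> (P ^ j) $$$ l = 0) \<and>
     (P ^ j) $$$ q = of_nat j * \<beta> ^ (j - 1) * \<zeta>"
  proof (induction j)
    case 0
    then show ?case using q by auto
  next
    case (Suc j)
    have e: "P ^ Suc j = P ^ j * P" by (rule power_Suc2)
    have "of_nat j * \<beta> ^ (j - 1) * \<zeta> * \<beta> = of_nat j * \<beta> ^ j * \<zeta>"
      by (cases j) (auto simp: mult.assoc comm power_Suc2 simp del: power_Suc of_nat_Suc)
    then show ?case unfolding e mult using Suc q
      by (auto simp: power_commutes distrib_right)
  qed
  show "(P ^ j) $$$ 0 = \<beta> ^ j" "0 < l \<Longrightarrow> l < q \<Longrightarrow> (P ^ j) $$$ l = 0"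
    "(P ^ j) $$$ q = of_nat j * \<beta> ^ (j - 1) * \<zeta>" using all by auto
qed

lemma sum_multiples:
  fixes F :: "nat \<Rightarrow> 'x::comm_monoid_add"
  assumes "\<And>k. \<not> q dvd k \<Longrightarrow> F k = 0" "q > 0"
  shows "(\<Sum>k\<le>q * e. F k) = (\<Sum>j\<le>e. F (q * j))"
proof -
  have "(\<Sum>k\<le>q * e. F k) = (\<Sum>k\<in>(\<lambda>j. q * j) ` {..e}. F k)"
  proof (rule sum.mono_neutral_right)
    show "\<forall>k\<in>{..q * e} - (\<lambda>j. q * j) ` {..e}. F k = 0"
    proof
      fix k assume k: "k \<in> {..q * e} - (\<lambda>j. q * j) ` {..e}"
      have "\<not> q dvd k"
      proof
        assume "q dvd k"
        then obtain j where "k = q * j" by (elim dvdE)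
        then show False using k assms(2) by auto
      qed
      then show "F k = 0" by (rule assms(1))
    qed
  qed auto
  also have "\<dots> = (\<Sum>j\<le>e. F (q * j))"
    using assms(2) by (subst sum.reindex) (auto simp: inj_on_def)
  finally show ?thesis .
qed

text \<open>
  The division algebra over \<open>K\<close>, over its center \<open>C\<close> (a field type embedded by \<open>\<iota>\<close>), and the center
  over \<open>K\<close>.
\<close>

locale center_tower =
  K: division_family scale ws mK MK +
  C: division_family "\<lambda>z x. \<iota> z * x" us d MC +
  Z: subalgebra_family scale "{z. \<forall>x. z * x = x * z}" vs c MZ
  for scale :: "'k::field \<Rightarrow> 'd::division_ring \<Rightarrow> 'd" and ws mK MK
    and \<iota> :: "'c::field \<Rightarrow> 'd" and us d MC and vs c MZ +
  assumes \<iota>_add: "\<iota> (a + b) = \<iota> a + \<iota> b" and \<iota>_mult: "\<iota> (a * b) = \<iota> a * \<iota> b" and \<iota>_one: "\<iota> 1 = 1"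
    and \<iota>_range: "range \<iota> = {z. \<forall>x. z * x = x * z}"
begin

lemma \<iota>_zero: "\<iota> 0 = 0"
  using \<iota>_add[of 0 0] by simp

lemma \<iota>_eq_0: "\<iota> a = 0 \<Longrightarrow> a = 0"
  using \<iota>_mult[of a "inverse a"] \<iota>_one by (cases "a = 0") auto

lemma \<iota>_diff: "\<iota> (a - b) = \<iota> a - \<iota> b"
  using \<iota>_add[of "a - b" b] by simp

lemma \<iota>_power: "\<iota> (a ^ j) = \<iota> a ^ j"
  by (induction j) (auto simp: \<iota>_one \<iota>_mult)

lemma \<iota>_of_nat: "\<iota> (of_nat j) = of_nat j"
  by (induction j) (auto simp: \<iota>_zero \<iota>_one \<iota>_add)

lemma \<iota>_central: "\<iota> a * x = x * \<iota> a"
  using \<iota>_range by blast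

lemma central_\<iota>: "(\<And>x. z * x = x * z) \<Longrightarrow> \<exists>a. z = \<iota> a"
  using \<iota>_range by blast

lemma scale_central: "\<exists>a. scale t 1 = \<iota> a"
  by (rule central_\<iota>) (simp add: K.scale_mult_left K.scale_mult_right)

text \<open>
  The embedding of \<open>K\<close> into \<open>C\<close>.
\<close>

definition \<sigma> :: "'k \<Rightarrow> 'c" where "\<sigma> t = (SOME a. scale t 1 = \<iota> a)"

lemma \<sigma>: "scale t x = \<iota> (\<sigma> t) * x"
proof -
  have "scale t 1 = \<iota> (\<sigma> t)" unfolding \<sigma>_def by (rule someI_ex[OF scale_central])
  then show ?thesis using K.scale_as_mult[of t x] by simp
qed

lemma \<sigma>_inj: "inj \<sigma>"
proof (rule injI)
  fix s t assume "\<sigma> s = \<sigma> t"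
  then have "scale s 1 = scale t 1" by (simp add: \<sigma>)
  then have "scale (s - t) 1 = 0"
    using K.scale_add_left[of "s - t" t 1] by simp
  then show "s = t" using K.scale_eq_0[of "s - t" 1] by fastforce
qed

lemma Z_eval: "z \<in> {z. \<forall>x. z * x = x * z} \<Longrightarrow> alg_eval Z.AE z p = K.ev z p"
  using Z.E_alg_eval_superset[of z p "degree p"] K.ev_superset[of p "degree p" z] by simp

lemma center_full: "\<exists>z. (\<forall>x. z * x = x * z) \<and> full K.AE c z"
proof -
  obtain z where "z \<in> {z. \<forall>x. z * x = x * z}" "full Z.AE c z" using Z.full_exists by auto
  then show ?thesis using Z_eval by (intro exI[of _ z]) (auto simp: full_def)
qed

text \<open>
  The minimal polynomial of \<open>b\<close> over \<open>C\<close> divides its norm down to \<open>K\<close>, which has degree \<open>d c\<close>.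
\<close>

lemma degree_upper: "mK \<le> d * c"
proof -
  obtain b where b: "full K.AE mK b" using K.full_exists by auto
  define f where "f i = \<iota> (coeff (MC b) i)" for i
  have MCd: "degree (MC b) = d" "coeff (MC b) d = 1" using C.M_degree[of b] C.M_top[of b] by auto
  have "\<exists>(h::'k poly) g. h \<noteq> 0 \<and> degree h = d * c \<and> (\<forall>l. g l \<in> {z. \<forall>x. z * x = x * z}) \<and>
    finite {l. g l \<noteq> 0} \<and> (\<forall>s. scale (coeff h s) 1 = (\<Sum>i\<le>s. f i * g (s - i)))"
    by (rule Z.norm_multiple) (use MCd \<iota>_one \<iota>_zero \<iota>_range in \<open>auto simp: f_def coeff_eq_0 \<iota>_central\<close>)
  then obtain h :: "'k poly" and g where h: "h \<noteq> 0" "degree h = d * c"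
    and g: "\<And>l x. g l * x = x * g l" "finite {l. g l \<noteq> 0}"
    and hs: "\<And>s. scale (coeff h s) 1 = (\<Sum>i\<le>s. f i * g (s - i))"
    by blast
  obtain L where L: "\<And>l. l > L \<Longrightarrow> g l = 0"
  proof -
    obtain L where "{l. g l \<noteq> 0} \<subseteq> {..L}" using g(2) by (metis finite_nat_iff_bounded_le)
    then show ?thesis using that[of L] by (metis (mono_tags, lifting) atMost_iff linorder_not_le mem_Collect_eq subsetD)
  qed
  define N where "N = d + L + degree h"
  have "K.ev b h = (\<Sum>s\<le>2*N. scale (coeff h s) 1 * b ^ s)"
    using K.ev_superset[of h "2*N" b] by (simp add: N_def K.scale_mult_left)
  also have "\<dots> = (\<Sum>s\<le>2*N. \<Sum>i\<le>s. (f i * b ^ i) * (g (s - i) * b ^ (s - i)))"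
  proof (intro sum.cong refl)
    fix s
    have "f i * g (s - i) * b ^ s = (f i * b ^ i) * (g (s - i) * b ^ (s - i))" if "i \<le> s" for i
    proof -
      have "b ^ s = b ^ i * b ^ (s - i)" using that by (simp flip: power_add)
      then show ?thesis by (metis g(1) mult.assoc)
    qed
    then show "scale (coeff h s) 1 * b ^ s = (\<Sum>i\<le>s. (f i * b ^ i) * (g (s - i) * b ^ (s - i)))"
      unfolding hs sum_distrib_right by (intro sum.cong refl) auto
  qed
  also have "\<dots> = (\<Sum>i\<le>N. \<Sum>l\<le>N. (f i * b ^ i) * (g l * b ^ l))"
  proof (rule sum_convolution[symmetric])
    fix i l assume "i > N \<or> l > N"
    then have "f i = 0 \<or> g l = 0" using L[of l] MCd by (auto simp: N_def f_def coeff_eq_0 \<iota>_zero)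
    then show "(f i * b ^ i) * (g l * b ^ l) = 0" by auto
  qed
  also have "\<dots> = (\<Sum>i\<le>N. f i * b ^ i) * (\<Sum>l\<le>N. g l * b ^ l)"
    by (simp add: sum_product)
  also have "(\<Sum>i\<le>N. f i * b ^ i) = C.ev b (MC b)"
    using C.ev_superset[of "MC b" N b] MCd by (simp add: N_def f_def)
  finally have "K.ev b h = 0" using C.ev_M[of b] by simp
  then show ?thesis using K.fullD[OF b, of h] h by (metis not_less)
qed

lemma dense_C:
  assumes f: "polyfun_on C.AE us f" "f b \<noteq> 0"
  shows "K.dense (\<lambda>b. f b \<noteq> 0)"
  unfolding K.dense_def
proof (intro conjI allI impI)
  fix a x assume a: "f a \<noteq> 0"
  obtain p where p: "\<And>t. f (a + \<iota> t * x) = poly p t" using C.polyfun_line[OF f(1)] by blast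
  have "poly p 0 = f a" using p[of 0] by (simp add: \<iota>_zero)
  then have "p \<noteq> 0" using a by auto
  then have "finite (\<sigma> -` {s. poly p s = 0})"
    using poly_roots_finite[of p] \<sigma>_inj by (intro finite_vimageI)
  moreover have "{t. \<not> f (a + scale t x) \<noteq> 0} = \<sigma> -` {s. poly p s = 0}"
    by (auto simp: \<sigma> p)
  ultimately show "finite {t. \<not> f (a + scale t x) \<noteq> 0}" by simp
qed (use f in blast)

text \<open>
  As \<open>z\<close> is central, both sides lie in the commutative ring \<open>C[b]\<close>, so that the identity follows from
  the one for polynomials over \<open>C\<close>.
\<close>

lemma frobenius_central:
  assumes q: "q = 1 \<or> (\<exists>p s. prime p \<and> of_nat p = (0::'k) \<and> q = p ^ s)" and z: "\<And>x. z * x = x * z"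
  shows "(b + scale t z) ^ q = b ^ q + scale (t ^ q) (z ^ q)"
  using q
proof
  assume "\<exists>p s. prime p \<and> of_nat p = (0::'k) \<and> q = p ^ s"
  then obtain p s where p: "prime p" "of_nat p = (0::'k)" "q = p ^ s" by blast
  have "of_nat p = (0::'d)" using K.scale_of_nat[of p 1] p(2) by simp
  then have "of_nat p = (0::'c)" using \<iota>_of_nat[of p] \<iota>_eq_0 by metis
  then have p0: "of_nat p = (0::'c poly)" by (simp add: of_nat_poly)
  obtain z' where z': "z = \<iota> z'" using central_\<iota>[OF z] by blast
  let ?a = "\<sigma> t * z'"
  have a: "\<iota> ?a = scale t z" by (simp add: \<sigma> z' \<iota>_mult)
  have "b + scale t z = C.ev b (monom 1 1 + [:?a:])"
    by (simp add: C.ev_simps C.ev_monom a[unfolded \<iota>_mult] \<iota>_one \<iota>_mult)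
  then have "(b + scale t z) ^ q = C.ev b ((monom 1 1 + [:?a:]) ^ q)" by (simp add: C.ev_power)
  also have "(monom 1 1 + [:?a:]) ^ q = monom 1 q + [:?a ^ q:]"
    using freshmans_dream'[where ?'a = "'c poly", of q s "monom 1 1" "[:?a:]"] p(1,3) prime_is_CHAR[OF p(1) p0]
    by (simp add: monom_power poly_const_pow)
  also have "C.ev b \<dots> = b ^ q + \<iota> ?a ^ q"
    by (simp add: C.ev_simps C.ev_monom \<iota>_one \<iota>_power \<iota>_mult)
  finally show ?thesis unfolding a by (simp add: K.scale_power)
qed simp

text \<open>
  Let \<open>q\<close> be the exponent of \<open>inseparable_exponent\<close>, \<open>\<beta> = b\<^sup>q\<close> for a sufficiently general \<open>b\<close>, and
  \<open>\<zeta> = z\<^sup>q\<close> for a central \<open>z\<close> of degree \<open>c\<close>. Then \<open>\<beta>\<close> has degree \<open>e = deg\<^sub>K D / q\<close> over \<open>K\<close> with a separable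
  minimal polynomial \<open>G\<close>, and still has degree \<open>d\<close> over \<open>C\<close>. Expanding the relation for \<open>b + t z\<close>, whose
  \<open>q\<close>-th power is \<open>\<beta> + t\<^sup>q \<zeta>\<close>, up to order \<open>t\<^sup>q\<close> gives \<open>G'(\<beta>) \<zeta> \<in> K[\<beta>]\<close>. Hence, up to multiplication
  by a fixed power of \<open>y = G'(\<beta>)\<close>, the \<open>I d\<close> elements \<open>\<zeta>\<^sup>i \<beta>\<^sup>j\<close> with \<open>q i < c\<close> and \<open>j < d\<close> all lie in the
  \<open>e\<close>-dimensional space \<open>K[\<beta>]\<close>. They are independent, so \<open>I d \<le> e\<close>, and \<open>q I \<ge> c\<close>.
\<close>

lemma degree_lower: "d * c \<le> mK"
proof -
  obtain q k0 where qk: "q > 0 \<and> (q = 1 \<or> (\<exists>p s. prime p \<and> of_nat p = (0::'k) \<and> q = p ^ s)) \<and>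
     (\<forall>b k. coeff (MK b) k \<noteq> 0 \<longrightarrow> q dvd k) \<and>
     (\<exists>b. coeff (MK b) k0 \<noteq> 0 \<and> of_nat (k0 div q) \<noteq> (0::'k))"
    using K.inseparable_exponent by (elim exE)
  from qk have q: "q > 0" "q = 1 \<or> (\<exists>p s. prime p \<and> of_nat p = (0::'k) \<and> q = p ^ s)" by simp_all
  from qk have qdvd: "\<And>b k. coeff (MK b) k \<noteq> 0 \<Longrightarrow> q dvd k" by simp
  from qk have k0: "\<exists>b. coeff (MK b) k0 \<noteq> 0" "of_nat (k0 div q) \<noteq> (0::'k)" by blast+
  obtain k1 where k1: "\<exists>b. coeff (MC b) k1 \<noteq> 0" "of_nat k1 \<noteq> (0::'c)"
  proof -
    have "\<exists>b k. coeff (MC b) k \<noteq> 0 \<and> of_nat k \<noteq> (0::'c)"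
      by (rule C.separable_generic) (use central_\<iota> in simp)
    then show ?thesis using that by blast
  qed
  obtain gK where gK: "polyfun_on K.AE ws gK" "\<exists>b. gK b \<noteq> 0" "\<And>b. gK b \<noteq> 0 \<Longrightarrow> full K.AE mK b"
    using K.full_witness by auto
  obtain gC where gC: "polyfun_on C.AE us gC" "\<exists>b. gC b \<noteq> 0" "\<And>b. gC b \<noteq> 0 \<Longrightarrow> full C.AE d b"
    using C.full_witness by auto
  have "K.dense (\<lambda>b. (gK b \<noteq> 0 \<and> coeff (MK b) k0 \<noteq> 0) \<and> (gC b \<noteq> 0 \<and> coeff (MC b) k1 \<noteq> 0))"
  proof (intro K.dense_conj)
    show "K.dense (\<lambda>b. gK b \<noteq> 0)" using gK(2) K.dense_polyfun[OF gK(1)] by blast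
    show "K.dense (\<lambda>b. coeff (MK b) k0 \<noteq> 0)" using k0(1) K.dense_polyfun[OF K.M_coeff_polyfun] by blast
    show "K.dense (\<lambda>b. gC b \<noteq> 0)" using gC(2) dense_C[OF gC(1)] by blast
    show "K.dense (\<lambda>b. coeff (MC b) k1 \<noteq> 0)" using k1(1) dense_C[OF C.M_coeff_polyfun] by blast
  qed
  then obtain b where b: "full K.AE mK b" "coeff (MK b) k0 \<noteq> 0" "full C.AE d b" "coeff (MC b) k1 \<noteq> 0"
    using gK(3) gC(3) by (auto simp: K.dense_def)
  define \<beta> where "\<beta> = b ^ q"
  have sep: "C.sep_element d b"
    unfolding C.sep_element_def using b(3,4) k1(2) C.ev_M[of b] C.M_degree[of b]
    by (auto simp: pderiv_ne_0_iff intro!: exI[of _ "MC b"])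
  have fullC: "full C.AE d \<beta>"
  proof -
    have "C.sep_element d \<beta>" using q(2)
    proof
      assume "\<exists>p s. prime p \<and> of_nat p = (0::'k) \<and> q = p ^ s"
      then obtain p s where p: "prime p" "of_nat p = (0::'k)" "q = p ^ s" by blast
      have "of_nat p = (0::'d)" using K.scale_of_nat[of p 1] p(2) by simp
      then have "of_nat p = (0::'c)" using \<iota>_of_nat[of p] \<iota>_eq_0 by metis
      then show ?thesis using C.sep_element_frobenius_power[OF sep C.m_pos p(1)] p(3) by (simp add: \<beta>_def)
    qed (use sep in \<open>simp add: \<beta>_def\<close>)
    then show ?thesis by (simp add: C.sep_element_def)
  qed
  have MKtop: "coeff (MK x) mK = 1" "degree (MK x) = mK" for x using K.M_top[of x] K.M_degree[of x] by auto
  define e where "e = mK div q"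
  have qe: "q * e = mK" using qdvd[of 0 mK] MKtop by (simp add: e_def)
  have e0: "e > 0" using qe K.m_pos by (cases e) auto
  have fullK: "full K.AE e \<beta>"
    unfolding full_def
  proof (intro allI impI)
    fix h assume h: "K.ev \<beta> h = \<zero>\<^bsub>K.AE\<^esub>" "degree h < e"
    have "K.ev b (pcompose h (monom 1 q)) = 0"
      using h(1) by (simp add: K.ev_simps K.ev_monom K.scale_one \<beta>_def)
    moreover have "degree (pcompose h (monom 1 q)) < mK"
      using h(2) q(1) by (simp add: degree_monom_eq flip: qe)
    ultimately have "pcompose h (monom 1 q) = 0" by (rule K.fullD[OF b(1)])
    then show "h = 0" using q(1) by (simp add: pcompose_eq_0_iff degree_monom_eq)
  qed
  define G where "G = (\<Sum>j\<le>e. monom (coeff (MK b) (q * j)) j)"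
  have cG: "coeff G j = (if j \<le> e then coeff (MK b) (q * j) else 0)" for j by (simp add: G_def coeff_sum)
  have relG: "(\<Sum>j\<le>e. scale (coeff (MK x) (q * j)) ((x ^ q) ^ j)) = 0" for x
  proof -
    have "0 = K.ev x (MK x)" using K.ev_M[of x] by simp
    also have "\<dots> = (\<Sum>k\<le>q * e. scale (coeff (MK x) k) (x ^ k))"
      by (rule K.ev_superset) (simp add: qe MKtop)
    also have "\<dots> = (\<Sum>j\<le>e. scale (coeff (MK x) (q * j)) (x ^ (q * j)))"
    proof (rule sum_multiples)
      fix k assume "\<not> q dvd k"
      then have "coeff (MK x) k = 0" using qdvd by blast
      then show "scale (coeff (MK x) k) (x ^ k) = 0" by simp
    qed (rule q(1))
    finally show ?thesis by (simp add: power_mult)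
  qed
  have evG: "K.ev \<beta> G = 0"
    using relG[of b] by (simp add: G_def K.ev_sum K.ev_monom \<beta>_def)
  have degG: "degree G = e"
  proof (rule antisym)
    show "degree G \<le> e" by (rule degree_le) (simp add: cG)
    show "e \<le> degree G" by (rule le_degree) (simp add: cG qe MKtop)
  qed
  define y where "y = K.ev \<beta> (pderiv G)"
  have y0: "y \<noteq> 0"
  proof
    assume "y = 0"
    moreover have "degree (pderiv G) < e" using degree_pderiv_le[of G] degG e0 by linarith
    ultimately have "pderiv G = 0" using fullK by (auto simp: full_def y_def)
    moreover have "pderiv G \<noteq> 0"
    proof -
      have "k0 \<le> mK" using b(2) MKtop(2)[of b] by (metis le_degree)
      moreover obtain j where j: "k0 = q * j" using qdvd[OF b(2)] by (elim dvdE)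
      ultimately have "j \<le> e" using q(1) qe by (metis mult_le_cancel1)
      then show ?thesis unfolding pderiv_ne_0_iff
        using j b(2) k0(2) q(1) by (intro exI[of _ j]) (simp add: cG)
    qed
    ultimately show False by simp
  qed
  obtain z where z: "\<And>x. z * x = x * z" "full K.AE c z" using center_full by blast
  define \<zeta> where "\<zeta> = z ^ q"
  have \<zeta>: "\<zeta> * x = x * \<zeta>" for x unfolding \<zeta>_def
    by (induction q) (auto simp: mult.assoc z(1), metis mult.assoc z(1))
  have "\<exists>N. y * \<zeta> = K.ev \<beta> N"
  proof -
    have "\<forall>j. \<exists>p. \<forall>t. coeff (MK (b + scale t z)) (q * j) = poly p t" using K.M_coeff_line by blast
    then obtain p where p: "\<And>j t. coeff (MK (b + scale t z)) (q * j) = poly (p j) t" by metis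
    let ?P = "fps_const \<beta> + fps_const \<zeta> * fps_X ^ q"
    let ?C = "\<lambda>i. Abs_fps (\<lambda>l. scale (coeff (p i) l) 1)"
    have "K.rep (\<lambda>t. \<beta> + scale (t ^ q) \<zeta>) ?P" by (intro K.rep_add K.rep_const K.rep_monom)
    then have "K.rep (\<lambda>t. \<Sum>j\<le>e. scale (poly (p j) t) 1 * (\<beta> + scale (t ^ q) \<zeta>) ^ j) (\<Sum>j\<le>e. ?C j * ?P ^ j)"
      by (intro K.rep_sum K.rep_mult K.rep_power K.rep_scalar)
    moreover have "(\<Sum>j\<le>e. scale (poly (p j) t) 1 * (\<beta> + scale (t ^ q) \<zeta>) ^ j) = 0" for t
      using relG[of "b + scale t z"] frobenius_central[OF q(2) z(1), of b t]
      by (simp add: p \<beta>_def \<zeta>_def K.scale_mult_left)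
    ultimately have z0: "(\<Sum>j\<le>e. ?C j * ?P ^ j) $$$ q = 0" by (rule K.rep_zero)
    have cq: "(?C j * ?P ^ j) $$$ q = scale (coeff (p j) 0) (of_nat j * \<beta> ^ (j - 1) * \<zeta>) + scale (coeff (p j) q) (\<beta> ^ j)" for j
    proof -
      note cpc = curve_power_coeff[OF q(1) \<zeta>]
      have "(?C j * ?P ^ j) $$$ q = (\<Sum>i\<in>{0..q}. ?C j $$$ i * (?P ^ j) $$$ (q - i))" by (rule fps_mult_nth)
      also have "\<dots> = (\<Sum>i\<in>{0,q}. ?C j $$$ i * (?P ^ j) $$$ (q - i))"
        by (rule sum.mono_neutral_right) (auto simp: cpc(2))
      also have "\<dots> = ?C j $$$ 0 * (?P ^ j) $$$ q + ?C j $$$ q * (?P ^ j) $$$ 0"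
        using q(1) by simp
      finally show ?thesis unfolding cpc(1,3) by (simp add: K.scale_mult_left)
    qed
    have p0: "coeff (p j) 0 = coeff (MK b) (q * j)" for j using p[of 0 j] by (simp add: poly_0_coeff_0)
    have "y = (\<Sum>j\<le>e. scale (coeff (MK b) (q * j)) (of_nat j * \<beta> ^ (j - 1)))"
    proof -
      have "pderiv G = (\<Sum>j\<le>e. monom (of_nat j * coeff (MK b) (q * j)) (j - 1))"
        by (simp add: G_def pderiv_sum pderiv_monom)
      then show ?thesis unfolding y_def
        by (simp add: K.ev_sum K.ev_monom mult.commute[of "of_nat _"] K.scale_mult K.scale_of_nat)
    qed
    then have "y * \<zeta> = (\<Sum>j\<le>e. scale (coeff (p j) 0) (of_nat j * \<beta> ^ (j - 1) * \<zeta>))"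
      by (simp add: p0 sum_distrib_right K.scale_mult_left)
    also have "\<dots> = - (\<Sum>j\<le>e. scale (coeff (p j) q) (\<beta> ^ j))"
      using z0 unfolding fps_sum_nth cq sum.distrib by (simp add: eq_neg_iff_add_eq_0)
    also have "\<dots> = K.ev \<beta> (- (\<Sum>j\<le>e. monom (coeff (p j) q) j))"
      by (simp add: K.ev_simps K.ev_sum K.ev_monom)
    finally show ?thesis by blast
  qed
  then obtain Nz where Nz: "y * \<zeta> = K.ev \<beta> Nz" by blast
  \<comment> \<open>The number of \<open>i\<close> with \<open>q i < c\<close>, that is \<open>c / q\<close> rounded up.\<close>
  define I where "I = (c + q - 1) div q"
  have c0: "c > 0" by (rule Z.degree_pos) simp
  have I: "c \<le> q * I" "q * (I - 1) < c" "I > 0"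
  proof -
    have "q * I + (c + q - 1) mod q = c + q - 1" by (simp add: I_def)
    moreover have "(c + q - 1) mod q < q" using q(1) by simp
    ultimately show 1: "c \<le> q * I" by linarith
    then show "I > 0" using c0 by (cases I) auto
    have "q * I \<le> c + q - 1" by (simp add: I_def)
    then show "q * (I - 1) < c" using q(1) c0 by (simp add: diff_mult_distrib2)
  qed
  have "I * d \<le> e"
  proof (rule ccontr)
    assume "\<not> I * d \<le> e"
    then have card: "card {..<e} < card ({..<I} \<times> {..<d})" by simp
    \<comment> \<open>The polynomial of degree less than \<open>e\<close> whose value at \<open>\<beta>\<close> is \<open>\<zeta>\<^sup>i \<beta>\<^sup>j y\<^sup>I\<close>.\<close>
    define R where "R ij = (Nz ^ fst ij * pderiv G ^ (I - fst ij) * monom 1 (snd ij)) mod G" for ij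
    have G0: "G \<noteq> 0" using degG e0 by auto
    have degR: "degree (R ij) < e" for ij
      using degree_mod_less[OF G0, of "Nz ^ fst ij * pderiv G ^ (I - fst ij) * monom 1 (snd ij)"] degG e0
      by (auto simp: R_def)
    have evmod: "K.ev \<beta> (r mod G) = K.ev \<beta> r" for r
    proof -
      have "K.ev \<beta> (r div G * G + r mod G) = K.ev \<beta> (r div G) * K.ev \<beta> G + K.ev \<beta> (r mod G)"
        by (simp only: K.ev_simps)
      then show ?thesis by (simp add: evG)
    qed
    have \<zeta>p: "\<zeta> ^ i * x = x * \<zeta> ^ i" for i x
      by (induction i) (auto simp: mult.assoc, metis \<zeta> mult.assoc)
    have commz: "(y * \<zeta>) ^ i = \<zeta> ^ i * y ^ i" for i
    proof (induction i)
      case (Suc i)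
      have "(y * \<zeta>) ^ Suc i = y * \<zeta> ^ Suc i * y ^ i" by (simp add: Suc mult.assoc)
      also have "\<dots> = \<zeta> ^ Suc i * y ^ Suc i" by (simp only: \<zeta>p[of "Suc i" y, symmetric] power_Suc[of y] mult.assoc)
      finally show ?case .
    qed simp
    have evR: "K.ev \<beta> (R (i, j)) = \<zeta> ^ i * \<beta> ^ j * y ^ I" if "i < I" for i j
    proof -
      have "K.ev \<beta> (R (i, j)) = K.ev \<beta> (monom 1 j * (Nz ^ i * pderiv G ^ (I - i)))"
        by (simp add: R_def evmod mult.commute)
      also have "\<dots> = \<beta> ^ j * ((y * \<zeta>) ^ i * y ^ (I - i))"
        by (simp add: K.ev_simps K.ev_power K.ev_monom K.scale_one y_def[symmetric] Nz)
      also have "\<dots> = \<beta> ^ j * (\<zeta> ^ i * (y ^ i * y ^ (I - i)))" by (simp add: commz mult.assoc)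
      also have "y ^ i * y ^ (I - i) = y ^ I" using that by (simp flip: power_add)
      also have "\<beta> ^ j * (\<zeta> ^ i * y ^ I) = \<zeta> ^ i * \<beta> ^ j * y ^ I"
      proof -
        have "\<beta> ^ j * \<zeta> ^ i = \<zeta> ^ i * \<beta> ^ j"
          by (induction i) (auto simp: mult.assoc, metis \<zeta> mult.assoc)
        then show ?thesis by (metis mult.assoc)
      qed
      finally show ?thesis .
    qed
    obtain a where a: "\<exists>ij\<in>{..<I} \<times> {..<d}. a ij \<noteq> 0"
      "\<And>l. l < e \<Longrightarrow> (\<Sum>ij\<in>{..<I} \<times> {..<d}. a ij * coeff (R ij) l) = 0"
      using homogeneous_system_nontrivial[OF _ _ card, of "\<lambda>ij l. coeff (R ij) l"] by auto
    have "(\<Sum>ij\<in>{..<I} \<times> {..<d}. Polynomial.smult (a ij) (R ij)) = 0"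
    proof (rule poly_eqI)
      fix l show "coeff (\<Sum>ij\<in>{..<I} \<times> {..<d}. Polynomial.smult (a ij) (R ij)) l = coeff 0 l"
        using a(2)[of l] coeff_eq_0[OF less_le_trans[OF degR, of l]]
        by (cases "l < e") (auto simp: coeff_sum not_less)
    qed
    then have "K.ev \<beta> (\<Sum>ij\<in>{..<I} \<times> {..<d}. Polynomial.smult (a ij) (R ij)) = 0" by (simp add: K.ev_simps)
    then have "(\<Sum>ij\<in>{..<I} \<times> {..<d}. scale (a ij) (K.ev \<beta> (R ij))) = 0"
      by (simp add: K.ev_sum K.ev_simps)
    also have "(\<Sum>ij\<in>{..<I} \<times> {..<d}. scale (a ij) (K.ev \<beta> (R ij))) =
      (\<Sum>i<I. \<Sum>j<d. scale (a (i,j)) (\<zeta> ^ i * \<beta> ^ j * y ^ I))"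
      unfolding sum.cartesian_product by (intro sum.cong refl) (auto simp: evR)
    also have "\<dots> = (\<Sum>i<I. \<Sum>j<d. scale (a (i,j)) (\<zeta> ^ i) * \<beta> ^ j) * y ^ I"
      by (simp add: sum_distrib_right K.scale_mult_left)
    finally have "(\<Sum>i<I. \<Sum>j<d. scale (a (i,j)) (\<zeta> ^ i) * \<beta> ^ j) = 0" using y0 by simp
    then have sum0: "(\<Sum>j<d. (\<Sum>i<I. scale (a (i,j)) (\<zeta> ^ i)) * \<beta> ^ j) = 0"
      by (subst (asm) sum.swap) (simp add: sum_distrib_right)
    have "\<exists>w. (\<Sum>i<I. scale (a (i,j)) (\<zeta> ^ i)) = \<iota> w" for j
    proof (rule central_\<iota>)
      fix x
      have "\<zeta> ^ i * x = x * \<zeta> ^ i" for i by (induction i) (auto simp: mult.assoc, metis \<zeta> mult.assoc)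
      then show "(\<Sum>i<I. scale (a (i,j)) (\<zeta> ^ i)) * x = x * (\<Sum>i<I. scale (a (i,j)) (\<zeta> ^ i))"
        by (simp add: sum_distrib_left sum_distrib_right K.scale_mult_left K.scale_mult_right)
    qed
    then obtain w where w: "\<And>j. (\<Sum>i<I. scale (a (i,j)) (\<zeta> ^ i)) = \<iota> (w j)" by metis
    define W where "W = (\<Sum>j<d. monom (w j) j)"
    have cW: "coeff W j = (if j < d then w j else 0)" for j by (auto simp: W_def coeff_sum)
    have "degree W \<le> d - 1" by (rule degree_le) (auto simp: cW)
    then have "degree W < d" using C.m_pos by linarith
    moreover have "C.ev \<beta> W = 0" using sum0 by (simp add: W_def C.ev_sum C.ev_monom w)
    ultimately have "W = 0" using fullC by (auto simp: full_def)
    then have w0: "w j = 0" if "j < d" for j using cW[of j] that by simp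
    have "a (i, j) = 0" if "i < I" "j < d" for i j
    proof -
      define V where "V = (\<Sum>i<I. monom (a (i,j)) (q * i))"
      have "degree V \<le> q * (I - 1)"
        unfolding V_def
        by (intro degree_sum_le) (use degree_monom_le order_trans in \<open>fastforce intro: order_trans[OF degree_monom_le]\<close>)+
      then have "degree V < c" using I(2) by simp
      moreover have "K.ev z V = 0"
        using w[of j] w0[OF that(2)] by (simp add: V_def K.ev_sum K.ev_monom \<zeta>_def \<iota>_zero power_mult)
      ultimately have "V = 0" using z(2) by (auto simp: full_def)
      then have "0 = coeff V (q * i)" by simp
      also have "\<dots> = (\<Sum>i'<I. if i' = i then a (i, j) else 0)"
        unfolding V_def coeff_sum by (rule sum.cong) (use q(1) in auto)
      finally show ?thesis using that by simp
    qed
    then show False using a(1) by auto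
  qed
  then have "q * (I * d) \<le> mK" using qe by (metis mult_le_mono2)
  moreover have "c * d \<le> q * I * d" using I(1) by (rule mult_le_mono1)
  ultimately show ?thesis by (metis le_trans mult.assoc mult.commute)
qed

theorem degree_tower: "mK = d * c"
  using degree_upper degree_lower by simp

end

section \<open>The degree of a matrix algebra\<close>

lemma matrix_algebra_simps [simp]:
  "carrier (matrix_algebra scale k) = carrier_mat k k" "X \<otimes>\<^bsub>matrix_algebra scale k\<^esub> Y = X * Y"
  "\<one>\<^bsub>matrix_algebra scale k\<^esub> = 1\<^sub>m k" "\<zero>\<^bsub>matrix_algebra scale k\<^esub> = 0\<^sub>m k k"
  "X \<oplus>\<^bsub>matrix_algebra scale k\<^esub> Y = X + Y" "c \<odot>\<^bsub>matrix_algebra scale k\<^esub> X = map_mat (scale c) X"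
  by (simp_all add: matrix_algebra_def)

lemma mat_entry_mult:
  assumes "X \<in> carrier_mat k k" "Y \<in> carrier_mat k k" "r < k" "j < k"
  shows "(X * Y) $$ (r, j) = (\<Sum>i<k. X $$ (r, i) * Y $$ (i, j))"
  using assms by (auto simp: scalar_prod_def lessThan_atLeast0 intro!: sum.cong)

context scalar_ring
begin

lemma matrix_assoc_algebra: "assoc_algebra class_ring (matrix_algebra scale k)"
proof (rule assoc_algebraI)
  show "ring (matrix_algebra scale k)"
  proof (rule ringI)
    show "abelian_group (matrix_algebra scale k)"
    proof (rule abelian_groupI)
      fix X assume "X \<in> carrier (matrix_algebra scale k)"
      then show "\<exists>Y\<in>carrier (matrix_algebra scale k). Y \<oplus>\<^bsub>matrix_algebra scale k\<^esub> X = \<zero>\<^bsub>matrix_algebra scale k\<^esub>"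
        by (intro bexI[of _ "- X"]) auto
    qed (auto simp: comm_add_mat)
    show "Group.monoid (matrix_algebra scale k)"
      by (rule monoidI) auto
  qed (auto simp: add_mult_distrib_mat mult_add_distrib_mat)
  fix c d :: 'k and X Y assume X: "X \<in> carrier (matrix_algebra scale k)"
  show "c \<odot>\<^bsub>matrix_algebra scale k\<^esub> X \<in> carrier (matrix_algebra scale k)" using X by simp
  show "(c + d) \<odot>\<^bsub>matrix_algebra scale k\<^esub> X = c \<odot>\<^bsub>matrix_algebra scale k\<^esub> X \<oplus>\<^bsub>matrix_algebra scale k\<^esub> d \<odot>\<^bsub>matrix_algebra scale k\<^esub> X"
    using X by (auto simp: scale_add_left)
  show "(c * d) \<odot>\<^bsub>matrix_algebra scale k\<^esub> X = c \<odot>\<^bsub>matrix_algebra scale k\<^esub> (d \<odot>\<^bsub>matrix_algebra scale k\<^esub> X)"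
    using X by (auto simp: scale_mult)
  show "1 \<odot>\<^bsub>matrix_algebra scale k\<^esub> X = X" using X by (auto simp: scale_one)
  assume Y: "Y \<in> carrier (matrix_algebra scale k)"
  show "c \<odot>\<^bsub>matrix_algebra scale k\<^esub> (X \<oplus>\<^bsub>matrix_algebra scale k\<^esub> Y) = c \<odot>\<^bsub>matrix_algebra scale k\<^esub> X \<oplus>\<^bsub>matrix_algebra scale k\<^esub> c \<odot>\<^bsub>matrix_algebra scale k\<^esub> Y"
    using X Y by (auto simp: scale_add_right)
  show "(c \<odot>\<^bsub>matrix_algebra scale k\<^esub> X) \<otimes>\<^bsub>matrix_algebra scale k\<^esub> Y = c \<odot>\<^bsub>matrix_algebra scale k\<^esub> (X \<otimes>\<^bsub>matrix_algebra scale k\<^esub> Y)"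
    using X Y by (auto simp: scalar_prod_def scale_mult_left scale_sum_right intro!: eq_matI sum.cong)
  show "X \<otimes>\<^bsub>matrix_algebra scale k\<^esub> (c \<odot>\<^bsub>matrix_algebra scale k\<^esub> Y) = c \<odot>\<^bsub>matrix_algebra scale k\<^esub> (X \<otimes>\<^bsub>matrix_algebra scale k\<^esub> Y)"
    using X Y by (auto simp: scalar_prod_def scale_mult_right scale_sum_right intro!: eq_matI sum.cong)
qed

end

text \<open>
  The matrix sending \<open>e\<^sub>0 \<mapsto> e\<^sub>1 \<mapsto> \<dots> \<mapsto> e\<^bsub>k-1\<^esub> \<mapsto> e\<^sub>0 a\<close> on the right vector space \<open>D\<^sup>k\<close>.
\<close>

definition companion :: "nat \<Rightarrow> 'd::ring_1 \<Rightarrow> 'd mat" where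
  "companion k a = mat k k (\<lambda>(r, j). if Suc j < k then (if r = Suc j then 1 else 0) else (if r = 0 then a else 0))"

text \<open>
  Multiplying \<open>X\<close> by this matrix unit from the right moves the first column of \<open>X\<close> to column \<open>i\<close>. In
  this way columns of matrices are assembled by algebra operations.
\<close>

definition unit_column :: "nat \<Rightarrow> nat \<Rightarrow> 'd::ring_1 mat" where
  "unit_column k i = mat k k (\<lambda>(r, j). if r = 0 \<and> j = i then 1 else 0)"

text \<open>
  The generic families of \<open>D\<close> and of \<open>M\<^sub>k(D)\<close>, both over \<open>K\<close>.
\<close>

locale matrix_family =
  K: division_family scale ws mK MK +
  A: generic_algebra "matrix_algebra scale k" us m M
  for scale :: "'k::field \<Rightarrow> 'd::division_ring \<Rightarrow> 'd" and ws mK MK and k :: nat and us m M +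
  assumes k_pos: "0 < k"
begin

abbreviation "MA \<equiv> matrix_algebra scale k"

lemma finsum_entry:
  assumes "finite S" "\<And>s. s \<in> S \<Longrightarrow> f s \<in> carrier_mat k k" "r < k" "j < k"
  shows "finsum MA f S $$ (r, j) = (\<Sum>s\<in>S. f s $$ (r, j))"
  using assms(1,2)
proof (induction S rule: finite_induct)
  case empty
  then show ?case using A.fs_empty[of f] assms(3,4) by simp
next
  case (insert s S)
  have F: "finsum MA f S \<in> carrier MA" by (rule A.fs_closed) (use insert in auto)
  have "finsum MA f (insert s S) = f s \<oplus>\<^bsub>MA\<^esub> finsum MA f S" by (rule A.fs_insert) (use insert in auto)
  then show ?case using insert F assms(3,4) by simp
qed

lemma pow_closed: "X \<in> carrier_mat k k \<Longrightarrow> X [^]\<^bsub>MA\<^esub> (i::nat) \<in> carrier_mat k k"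
  using A.nat_pow_closed[of X i] by simp

lemma pow_dims: "X \<in> carrier_mat k k \<Longrightarrow> dim_row (X [^]\<^bsub>MA\<^esub> (i::nat)) = k"
  "X \<in> carrier_mat k k \<Longrightarrow> dim_col (X [^]\<^bsub>MA\<^esub> (i::nat)) = k"
  using pow_closed[of X i] by auto

lemma pow_add: "X \<in> carrier_mat k k \<Longrightarrow> X [^]\<^bsub>MA\<^esub> (i + j :: nat) = X [^]\<^bsub>MA\<^esub> i * X [^]\<^bsub>MA\<^esub> j"
  using A.nat_pow_mult[of X i j] by simp

lemma alg_eval_entry:
  assumes "X \<in> carrier_mat k k" "r < k" "j < k" "degree p \<le> N"
  shows "alg_eval MA X p $$ (r, j) = (\<Sum>i\<le>N. scale (coeff p i) ((X [^]\<^bsub>MA\<^esub> i) $$ (r, j)))"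
proof -
  have "alg_eval MA X p $$ (r, j) = (\<Sum>i\<le>degree p. scale (coeff p i) ((X [^]\<^bsub>MA\<^esub> i) $$ (r, j)))"
    unfolding alg_eval_def by (subst finsum_entry) (use assms pow_closed[of X] pow_dims[of X] in auto)
  also have "\<dots> = (\<Sum>i\<le>N. scale (coeff p i) ((X [^]\<^bsub>MA\<^esub> i) $$ (r, j)))"
    by (rule sum.mono_neutral_left) (use assms in \<open>auto simp: coeff_eq_0\<close>)
  finally show ?thesis .
qed

text \<open>
  The matrix with columns \<open>e\<^sub>0, X e\<^sub>0, \<dots>, X\<^bsup>k-1\<^esup> e\<^sub>0\<close>; it is invertible iff \<open>e\<^sub>0\<close> is a cyclic vector.
\<close>

definition cyclic_columns :: "'d mat \<Rightarrow> 'd mat" where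
  "cyclic_columns X = mat k k (\<lambda>(r, i). (X [^]\<^bsub>MA\<^esub> i) $$ (r, 0))"

lemma cyclic_columns_closed [simp]: "cyclic_columns X \<in> carrier_mat k k"
  by (simp add: cyclic_columns_def)

text \<open>
  A polynomial in \<open>X\<close> commutes with \<open>X\<close>, so if it kills the cyclic vector \<open>e\<^sub>0\<close>, it kills every
  \<open>X\<^sup>i e\<^sub>0\<close>.
\<close>

lemma alg_eval_eq_0I:
  assumes X: "X \<in> carrier_mat k k" and F: "F \<in> carrier_mat k k" "cyclic_columns X * F = 1\<^sub>m k"
    and col: "\<And>r. r < k \<Longrightarrow> alg_eval MA X p $$ (r, 0) = 0"
  shows "alg_eval MA X p = 0\<^sub>m k k"
proof -
  let ?Z = "alg_eval MA X p"
  have Z: "?Z \<in> carrier_mat k k" using A.alg_eval_closed[of X p] X by simp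
  have comm: "?Z * X [^]\<^bsub>MA\<^esub> i = X [^]\<^bsub>MA\<^esub> i * ?Z" for i :: nat
  proof (induction i)
    case 0
    then show ?case using Z by simp
  next
    case (Suc i)
    have 1: "?Z * X = X * ?Z" using A.alg_eval_commute[of X p] X by simp
    have "?Z * (X [^]\<^bsub>MA\<^esub> i * X) = (X [^]\<^bsub>MA\<^esub> i * ?Z) * X"
      using assoc_mult_mat[OF Z pow_closed[OF X, of i] X] Suc by simp
    also have "\<dots> = X [^]\<^bsub>MA\<^esub> i * (X * ?Z)"
      using assoc_mult_mat[OF pow_closed[OF X, of i] Z X] 1 by simp
    also have "\<dots> = (X [^]\<^bsub>MA\<^esub> i * X) * ?Z"
      using assoc_mult_mat[OF pow_closed[OF X, of i] X Z] by simp
    finally show ?case by simp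
  qed
  have "?Z * cyclic_columns X = 0\<^sub>m k k"
  proof (rule eq_matI)
    fix r i assume "r < dim_row (0\<^sub>m k k)" "i < dim_col (0\<^sub>m k k)"
    then have ri: "r < k" "i < k" by auto
    have "(?Z * cyclic_columns X) $$ (r, i) = (?Z * X [^]\<^bsub>MA\<^esub> i) $$ (r, 0)"
      unfolding mat_entry_mult[OF Z cyclic_columns_closed ri] mat_entry_mult[OF Z pow_closed[OF X] ri(1) k_pos]
      by (intro sum.cong refl) (use ri in \<open>simp add: cyclic_columns_def\<close>)
    also have "\<dots> = 0"
      unfolding comm mat_entry_mult[OF pow_closed[OF X] Z ri(1) k_pos] by (simp add: col)
    finally show "(?Z * cyclic_columns X) $$ (r, i) = 0\<^sub>m k k $$ (r, i)" using ri by simp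
  qed (use Z in \<open>auto simp: cyclic_columns_def\<close>)
  then have "?Z * (cyclic_columns X * F) = 0\<^sub>m k k * F"
    using assoc_mult_mat[OF Z cyclic_columns_closed F(1), of X] by simp
  then show ?thesis using Z F by simp
qed

lemma companion_closed [simp]: "companion k a \<in> carrier_mat k k"
  by (simp add: companion_def)

lemma companion_column:
  assumes "r < k"
  shows "(companion k a [^]\<^bsub>MA\<^esub> (i::nat)) $$ (r, 0) = (if r = i mod k then a ^ (i div k) else 0)"
  using assms
proof (induction i arbitrary: r)
  case 0
  then show ?case using k_pos by simp
next
  case (Suc i)
  let ?B = "companion k a"
  have "?B [^]\<^bsub>MA\<^esub> Suc i = ?B * ?B [^]\<^bsub>MA\<^esub> i"
    using A.nat_pow_Suc2[of ?B i] by simp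
  then have "(?B [^]\<^bsub>MA\<^esub> Suc i) $$ (r, 0) = (\<Sum>j<k. ?B $$ (r, j) * (?B [^]\<^bsub>MA\<^esub> i) $$ (j, 0))"
    using mat_entry_mult[OF companion_closed pow_closed[OF companion_closed] Suc.prems k_pos] by simp
  also have "\<dots> = (\<Sum>j<k. if j = i mod k then ?B $$ (r, i mod k) * a ^ (i div k) else 0)"
    by (intro sum.cong refl) (simp add: Suc.IH)
  also have "\<dots> = ?B $$ (r, i mod k) * a ^ (i div k)" using k_pos by simp
  also have "\<dots> = (if r = Suc i mod k then a ^ (Suc i div k) else 0)"
  proof (cases "Suc (i mod k) < k")
    case True
    then have "Suc i mod k = Suc (i mod k)" "Suc i div k = i div k"
      by (auto simp: mod_Suc div_Suc)
    then show ?thesis using True Suc.prems by (simp add: companion_def)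
  next
    case False
    then have "Suc (i mod k) = k" using mod_less_divisor[OF k_pos, of i] by linarith
    then have "Suc i mod k = 0" "Suc i div k = Suc (i div k)"
      by (auto simp: mod_Suc div_Suc)
    then show ?thesis using False Suc.prems k_pos by (simp add: companion_def)
  qed
  finally show ?case .
qed

lemma companion_cyclic: "cyclic_columns (companion k a) = 1\<^sub>m k"
  by (rule eq_matI) (auto simp: cyclic_columns_def companion_column)

text \<open>
  Since \<open>X\<^bsup>kj+r\<^esup> e\<^sub>0 = e\<^sub>r a\<^sup>j\<close>, the first column collects the coefficients of \<open>p\<close> by residue classes
  modulo \<open>k\<close>.
\<close>

lemma companion_eval_column:
  assumes r: "r < k"
  shows "alg_eval MA (companion k a) p $$ (r, 0) = K.ev a (\<Sum>j\<le>degree p. monom (coeff p (k * j + r)) j)"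
proof -
  let ?N = "degree p"
  let ?M = "k * ?N + k"
  have kN: "?N \<le> ?M" using k_pos by (simp add: trans_le_add1)
  have "alg_eval MA (companion k a) p $$ (r, 0) =
    (\<Sum>i\<le>?M. scale (coeff p i) (if r = i mod k then a ^ (i div k) else 0))"
    by (subst alg_eval_entry[where N = ?M]) (use r k_pos in \<open>auto simp: companion_column intro!: sum.cong kN\<close>)
  also have "\<dots> = (\<Sum>i\<in>(\<lambda>j. k * j + r) ` {..?N}. scale (coeff p i) (if r = i mod k then a ^ (i div k) else 0))"
  proof (rule sum.mono_neutral_right)
    show "(\<lambda>j. k * j + r) ` {..?N} \<subseteq> {..?M}"
      using r by (auto intro!: add_mono)
    show "\<forall>i\<in>{..?M} - (\<lambda>j. k * j + r) ` {..?N}. scale (coeff p i) (if r = i mod k then a ^ (i div k) else 0) = 0"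
    proof
      fix i assume i: "i \<in> {..?M} - (\<lambda>j. k * j + r) ` {..?N}"
      show "scale (coeff p i) (if r = i mod k then a ^ (i div k) else 0) = 0"
      proof (cases "r = i mod k")
        case True
        then have "i = k * (i div k) + r" by simp
        then have "\<not> i div k \<le> ?N" using i by (metis DiffD2 atMost_iff image_eqI)
        then have "i > ?N" using div_le_dividend[of i k] by linarith
        then show ?thesis by (simp add: coeff_eq_0)
      qed simp
    qed
  qed simp
  also have "\<dots> = (\<Sum>j\<le>?N. scale (coeff p (k * j + r)) (a ^ j))"
    by (subst sum.reindex) (use r k_pos in \<open>auto simp: inj_on_def\<close>)
  also have "\<dots> = K.ev a (\<Sum>j\<le>?N. monom (coeff p (k * j + r)) j)"
    by (simp add: K.ev_sum K.ev_monom)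
  finally show ?thesis .
qed

lemma companion_full:
  assumes a: "full K.AE mK a"
  shows "full MA (k * mK) (companion k a)"
  unfolding full_def
proof (intro allI impI)
  fix p assume p: "alg_eval MA (companion k a) p = \<zero>\<^bsub>MA\<^esub>" "degree p < k * mK"
  show "p = 0"
  proof (rule poly_eqI)
    fix i
    define r where "r = i mod k"
    have r: "r < k" using k_pos by (simp add: r_def)
    let ?q = "\<Sum>j\<le>degree p. monom (coeff p (k * j + r)) j"
    have cq: "coeff ?q j = coeff p (k * j + r)" for j
    proof (cases "j \<le> degree p")
      case False
      then have "degree p < k * j + r" using k_pos
        by (metis add_lessD1 le_add1 less_le_trans mult_le_mono1 nat_mult_1 not_less Suc_leI One_nat_def)
      then show ?thesis using False by (simp add: coeff_sum coeff_eq_0)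
    qed (simp add: coeff_sum)
    have "K.ev a ?q = 0"
      using companion_eval_column[OF r, of a p] p(1) r k_pos by simp
    moreover have "degree ?q < mK"
    proof (rule degree_lessI)
      show "?q \<noteq> 0 \<or> mK > 0" using K.m_pos by simp
      show "\<forall>j\<ge>mK. coeff ?q j = 0"
      proof (intro allI impI)
        fix j assume "mK \<le> j"
        then have "k * mK \<le> k * j + r" by (simp add: trans_le_add1)
        then show "coeff ?q j = 0" unfolding cq using p(2) by (intro coeff_eq_0) linarith
      qed
    qed
    ultimately have "?q = 0" using K.fullD[OF a] by blast
    then have "coeff p (k * (i div k) + r) = 0" using cq[of "i div k"] by simp
    then show "coeff p i = coeff 0 i" by (simp add: r_def)
  qed
qed

lemma degree_matrix_lower: "k * mK \<le> m"
proof (rule ccontr)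
  assume "\<not> k * mK \<le> m"
  obtain a where a: "full K.AE mK a" using K.full_exists by auto
  let ?B = "companion k a"
  have "alg_eval MA ?B (M ?B) = \<zero>\<^bsub>MA\<^esub>" "degree (M ?B) = m" "coeff (M ?B) m = 1"
    using A.M_kill[of ?B] A.M_degree[of ?B] A.M_top[of ?B] by auto
  then show False using companion_full[OF a] \<open>\<not> k * mK \<le> m\<close> by (auto simp: full_def)
qed

lemma poly_path_finsum:
  assumes "fun_ring Q" "finite I" "\<And>i. i \<in> I \<Longrightarrow> A.poly_path Q (\<phi> i)"
  shows "A.poly_path Q (\<lambda>t. finsum MA (\<lambda>i. \<phi> i t) I)"
  using assms(2,3)
proof (induction I rule: finite_induct)
  case empty
  have "(\<lambda>t. finsum MA (\<lambda>i. \<phi> i t) {}) = (\<lambda>t. \<zero>\<^bsub>MA\<^esub>)" using A.fs_empty by simp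
  then show ?case using A.poly_path_const[OF assms(1), of "\<zero>\<^bsub>MA\<^esub>"] by simp
next
  case (insert i I)
  have "finsum MA (\<lambda>i. \<phi> i t) (insert i I) = \<phi> i t \<oplus>\<^bsub>MA\<^esub> finsum MA (\<lambda>i. \<phi> i t) I" for t
    by (rule A.fs_insert) (use insert A.poly_path_closed[OF insert.prems] in \<open>auto simp del: matrix_algebra_simps\<close>)
  then show ?case
    using A.poly_path_add[OF assms(1), of "\<phi> i" "\<lambda>t. finsum MA (\<lambda>i. \<phi> i t) I"] insert by simp
qed

lemma cyclic_columns_path:
  assumes Q: "fun_ring Q" and \<phi>: "A.poly_path Q \<phi>"
  shows "A.poly_path Q (\<lambda>t. cyclic_columns (\<phi> t))"
proof -
  have U: "unit_column k i \<in> carrier_mat k k" for i by (simp add: unit_column_def)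
  have "cyclic_columns X = finsum MA (\<lambda>i. X [^]\<^bsub>MA\<^esub> i \<otimes>\<^bsub>MA\<^esub> unit_column k i) {..<k}"
    if X: "X \<in> carrier_mat k k" for X
  proof (rule eq_matI)
    have XU: "X [^]\<^bsub>MA\<^esub> i * unit_column k i \<in> carrier_mat k k" for i :: nat
      by (rule mult_carrier_mat[OF pow_closed[OF X] U])
    have F: "finsum MA (\<lambda>i. X [^]\<^bsub>MA\<^esub> i \<otimes>\<^bsub>MA\<^esub> unit_column k i) {..<k} \<in> carrier MA"
      by (rule A.fs_closed) (use XU in auto)
    then show "dim_row (cyclic_columns X) = dim_row (finsum MA (\<lambda>i. X [^]\<^bsub>MA\<^esub> i \<otimes>\<^bsub>MA\<^esub> unit_column k i) {..<k})"
      "dim_col (cyclic_columns X) = dim_col (finsum MA (\<lambda>i. X [^]\<^bsub>MA\<^esub> i \<otimes>\<^bsub>MA\<^esub> unit_column k i) {..<k})"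
      by (auto simp: cyclic_columns_def)
    fix r j assume "r < dim_row (finsum MA (\<lambda>i. X [^]\<^bsub>MA\<^esub> i \<otimes>\<^bsub>MA\<^esub> unit_column k i) {..<k})"
      "j < dim_col (finsum MA (\<lambda>i. X [^]\<^bsub>MA\<^esub> i \<otimes>\<^bsub>MA\<^esub> unit_column k i) {..<k})"
    then have rj: "r < k" "j < k" using F by auto
    have e: "(X [^]\<^bsub>MA\<^esub> i * unit_column k i) $$ (r, j) = (if i = j then (X [^]\<^bsub>MA\<^esub> i) $$ (r, 0) else 0)" for i
    proof -
      have "(X [^]\<^bsub>MA\<^esub> i * unit_column k i) $$ (r, j) =
        (\<Sum>l<k. if l = 0 then (if i = j then (X [^]\<^bsub>MA\<^esub> i) $$ (r, 0) else 0) else 0)"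
        unfolding mat_entry_mult[OF pow_closed[OF X] U rj]
        by (intro sum.cong refl) (use rj in \<open>auto simp: unit_column_def\<close>)
      then show ?thesis using k_pos by simp
    qed
    have "finsum MA (\<lambda>i. X [^]\<^bsub>MA\<^esub> i \<otimes>\<^bsub>MA\<^esub> unit_column k i) {..<k} $$ (r, j) =
      (\<Sum>i<k. (X [^]\<^bsub>MA\<^esub> i \<otimes>\<^bsub>MA\<^esub> unit_column k i) $$ (r, j))"
      by (rule finsum_entry) (use rj XU in auto)
    then show "cyclic_columns X $$ (r, j) = finsum MA (\<lambda>i. X [^]\<^bsub>MA\<^esub> i \<otimes>\<^bsub>MA\<^esub> unit_column k i) {..<k} $$ (r, j)"
      using rj by (simp add: e cyclic_columns_def)
  qed
  then have "(\<lambda>t. cyclic_columns (\<phi> t)) = (\<lambda>t. finsum MA (\<lambda>i. \<phi> t [^]\<^bsub>MA\<^esub> i \<otimes>\<^bsub>MA\<^esub> unit_column k i) {..<k})"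
    using A.poly_path_closed[OF \<phi>] by auto
  moreover have "A.poly_path Q (\<lambda>t. finsum MA (\<lambda>i. \<phi> t [^]\<^bsub>MA\<^esub> i \<otimes>\<^bsub>MA\<^esub> unit_column k i) {..<k})"
    by (intro poly_path_finsum Q A.poly_path_mult A.poly_path_pow \<phi> A.poly_path_const) (use U in auto)
  ultimately show ?thesis by simp
qed

text \<open>
  Cyclicity of \<open>e\<^sub>0\<close> is an open condition, expressed by the reduced norm of \<open>cyclic_columns\<close>, and it
  holds for companion matrices.
\<close>

lemma full_cyclic_exists: "\<exists>X\<in>carrier_mat k k. full MA m X \<and> poly (M (cyclic_columns X)) 0 \<noteq> 0"
proof (rule ccontr)
  assume neg: "\<not> ?thesis"
  note fr = fun_ring_poly[where ?'a = 'k]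
  have "poly (M (cyclic_columns (companion k (0::'d)))) 0 = 0"
  proof (rule A.polynomial_identity[where f = "\<lambda>X. poly (M (cyclic_columns X)) 0" and h = "\<lambda>_. 0"])
    fix a x assume "a \<in> carrier MA" "x \<in> carrier MA"
    then show "(\<lambda>t. poly (M (cyclic_columns (a \<oplus>\<^bsub>MA\<^esub> t \<odot>\<^bsub>MA\<^esub> x))) 0) \<in> range poly"
      by (intro A.poly_M_path fr cyclic_columns_path A.line_path fun_ring_const[OF fr])
    show "(\<lambda>t. 0) \<in> range (poly :: 'k poly \<Rightarrow> _)" by (rule fun_ring_const[OF fr])
  next
    fix b assume "b \<in> carrier MA" "full MA m b"
    then show "poly (M (cyclic_columns b)) 0 = 0" using neg by auto
  qed simp
  then show False using A.M_const_one by (simp add: companion_cyclic)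
qed

text \<open>
  For a full \<open>X\<close> with cyclic vector \<open>e\<^sub>0\<close>, solve \<open>X\<^sup>k e\<^sub>0 = - \<Sum>\<^sub>i\<^sub><\<^sub>k X\<^sup>i e\<^sub>0 f\<^sub>i\<close> and let \<open>h\<close> be the norm of
  \<open>\<Sum>\<^sub>i f\<^sub>i \<lambda>\<^sup>i\<close> down to \<open>K\<close>. Multiplying the relation by \<open>X\<^sup>l\<close> from the left and by the coefficients
  \<open>g\<^sub>l\<close> of the cofactor from the right gives \<open>h(X) e\<^sub>0 = 0\<close>, hence \<open>h(X) = 0\<close>.
\<close>

lemma degree_matrix_upper: "m \<le> k * mK"
proof -
  obtain X where X: "X \<in> carrier_mat k k" "full MA m X" "poly (M (cyclic_columns X)) 0 \<noteq> 0"
    using full_cyclic_exists by blast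
  let ?Y = "cyclic_columns X"
  let ?c = "poly (M ?Y) 0"
  define F where "F = inverse ?c \<odot>\<^bsub>MA\<^esub> A.adjoint ?Y"
  have adj: "A.adjoint ?Y \<in> carrier MA" by (rule A.adjoint_closed) simp
  have F: "F \<in> carrier_mat k k" using adj by (simp add: F_def)
  have YF: "?Y * F = 1\<^sub>m k"
  proof -
    have "?Y \<otimes>\<^bsub>MA\<^esub> F = inverse ?c \<odot>\<^bsub>MA\<^esub> (?c \<odot>\<^bsub>MA\<^esub> \<one>\<^bsub>MA\<^esub>)"
      unfolding F_def using A.sm_mult2[of ?Y "A.adjoint ?Y" "inverse ?c"] A.mult_adjoint[of ?Y] adj by simp
    also have "\<dots> = (inverse ?c * ?c) \<odot>\<^bsub>MA\<^esub> \<one>\<^bsub>MA\<^esub>" by (rule A.sm_assoc[symmetric]) simp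
    also have "\<dots> = \<one>\<^bsub>MA\<^esub>" using X(3) A.sm_one[of "\<one>\<^bsub>MA\<^esub>"] by simp
    finally show ?thesis by simp
  qed
  define f where "f i = (if i = k then 1 else if i < k then - (\<Sum>l<k. F $$ (i, l) * (X [^]\<^bsub>MA\<^esub> k) $$ (l, 0)) else 0)" for i
  have rel: "(\<Sum>i\<le>k. (X [^]\<^bsub>MA\<^esub> i) $$ (r, 0) * f i) = 0" if r: "r < k" for r
  proof -
    have "(\<Sum>i<k. (X [^]\<^bsub>MA\<^esub> i) $$ (r, 0) * f i) =
      - (\<Sum>i<k. \<Sum>l<k. ?Y $$ (r, i) * F $$ (i, l) * (X [^]\<^bsub>MA\<^esub> k) $$ (l, 0))"
      unfolding sum_negf[symmetric] using r
      by (intro sum.cong refl) (auto simp: f_def cyclic_columns_def sum_distrib_left mult.assoc sum_negf)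
    also have "(\<Sum>i<k. \<Sum>l<k. ?Y $$ (r, i) * F $$ (i, l) * (X [^]\<^bsub>MA\<^esub> k) $$ (l, 0)) =
      (\<Sum>l<k. (\<Sum>i<k. ?Y $$ (r, i) * F $$ (i, l)) * (X [^]\<^bsub>MA\<^esub> k) $$ (l, 0))"
      by (subst sum.swap) (simp add: sum_distrib_right)
    also have "\<dots> = (\<Sum>l<k. (?Y * F) $$ (r, l) * (X [^]\<^bsub>MA\<^esub> k) $$ (l, 0))"
      by (intro sum.cong refl) (use mat_entry_mult[OF cyclic_columns_closed F r] in auto)
    also have "\<dots> = (\<Sum>l<k. if l = r then (X [^]\<^bsub>MA\<^esub> k) $$ (r, 0) else 0)"
      unfolding YF using r by (intro sum.cong refl) auto
    also have "\<dots> = (X [^]\<^bsub>MA\<^esub> k) $$ (r, 0)" using r by simp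
    finally show ?thesis by (simp add: lessThan_Suc_atMost[symmetric] f_def)
  qed
  obtain h :: "'k poly" and g where h: "h \<noteq> 0" "degree h = k * mK" "finite {l. g l \<noteq> 0}"
    "\<And>s. scale (coeff h s) 1 = (\<Sum>i\<le>s. f i * g (s - i))"
    using K.norm_multiple[of f k] by (auto simp: f_def)
  obtain L where L: "\<And>l. l > L \<Longrightarrow> g l = 0"
    using h(3) finite_nat_set_iff_bounded_le[of "{l. g l \<noteq> 0}"] not_less by blast
  define N where "N = k + L + degree h"
  have "alg_eval MA X h = 0\<^sub>m k k"
  proof (rule alg_eval_eq_0I[OF X(1) F YF])
    fix r assume r: "r < k"
    have "alg_eval MA X h $$ (r, 0) = (\<Sum>s\<le>2*N. scale (coeff h s) ((X [^]\<^bsub>MA\<^esub> s) $$ (r, 0)))"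
      by (rule alg_eval_entry) (use X r k_pos in \<open>auto simp: N_def\<close>)
    also have "\<dots> = (\<Sum>s\<le>2*N. \<Sum>i\<le>s. (X [^]\<^bsub>MA\<^esub> (i + (s - i))) $$ (r, 0) * f i * g (s - i))"
    proof (intro sum.cong refl)
      fix s
      have "scale (coeff h s) ((X [^]\<^bsub>MA\<^esub> s) $$ (r, 0)) = (X [^]\<^bsub>MA\<^esub> s) $$ (r, 0) * scale (coeff h s) 1"
        by (simp add: K.scale_mult_right)
      then show "scale (coeff h s) ((X [^]\<^bsub>MA\<^esub> s) $$ (r, 0)) =
        (\<Sum>i\<le>s. (X [^]\<^bsub>MA\<^esub> (i + (s - i))) $$ (r, 0) * f i * g (s - i))"
        by (auto simp: h(4) sum_distrib_left mult.assoc intro!: sum.cong)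
    qed
    also have "\<dots> = (\<Sum>i\<le>N. \<Sum>l\<le>N. (X [^]\<^bsub>MA\<^esub> (i + l)) $$ (r, 0) * f i * g l)"
    proof (rule sum_convolution[symmetric])
      fix i l assume "i > N \<or> l > N"
      then have "f i = 0 \<or> g l = 0" using L[of l] by (auto simp: f_def N_def)
      then show "(X [^]\<^bsub>MA\<^esub> (i + l)) $$ (r, 0) * f i * g l = 0" by auto
    qed
    also have "\<dots> = (\<Sum>l\<le>N. (\<Sum>i\<le>N. (X [^]\<^bsub>MA\<^esub> (i + l)) $$ (r, 0) * f i) * g l)"
      by (subst sum.swap) (simp add: sum_distrib_right)
    also have "\<dots> = 0"
    proof (intro sum.neutral ballI)
      fix l
      have "(\<Sum>i\<le>N. (X [^]\<^bsub>MA\<^esub> (i + l)) $$ (r, 0) * f i) = (\<Sum>i\<le>k. (X [^]\<^bsub>MA\<^esub> (l + i)) $$ (r, 0) * f i)"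
        by (rule sum.mono_neutral_cong_right) (auto simp: N_def f_def add.commute)
      also have "\<dots> = (\<Sum>i\<le>k. \<Sum>j<k. (X [^]\<^bsub>MA\<^esub> l) $$ (r, j) * ((X [^]\<^bsub>MA\<^esub> i) $$ (j, 0) * f i))"
        unfolding pow_add[OF X(1)] mat_entry_mult[OF pow_closed[OF X(1)] pow_closed[OF X(1)] r k_pos]
        by (simp add: sum_distrib_right mult.assoc)
      also have "\<dots> = (\<Sum>j<k. (X [^]\<^bsub>MA\<^esub> l) $$ (r, j) * (\<Sum>i\<le>k. (X [^]\<^bsub>MA\<^esub> i) $$ (j, 0) * f i))"
        by (subst sum.swap) (simp add: sum_distrib_left)
      also have "\<dots> = 0" by (simp add: rel)
      finally show "(\<Sum>i\<le>N. (X [^]\<^bsub>MA\<^esub> (i + l)) $$ (r, 0) * f i) * g l = 0" by simp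
    qed
    finally show "alg_eval MA X h $$ (r, 0) = 0" .
  qed
  then have "\<not> degree h < m" using X(2) h(1) by (auto simp: full_def)
  then show ?thesis using h(2) by simp
qed

theorem degree_matrix: "m = k * mK"
  using degree_matrix_upper degree_matrix_lower by simp

end

section \<open>Characters of a matrix algebra\<close>

lemma divisor_of_prime_power:
  fixes \<pi> :: "'a::algebraic_semidom"
  assumes "prime_elem \<pi>" "p * q = \<pi> ^ N"
  shows "\<exists>v r. v dvd 1 \<and> p = v * \<pi> ^ r"
  using assms(2)
proof (induction N arbitrary: p q)
  case 0
  then have "p dvd 1" by (intro dvdI[of _ _ q]) simp
  then show ?case by (intro exI[of _ p] exI[of _ 0]) simp
next
  case (Suc N)
  have nz: "\<pi> \<noteq> 0" using assms(1) by auto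
  have "\<pi> dvd p * q" using Suc.prems by simp
  then have "\<pi> dvd p \<or> \<pi> dvd q" using assms(1) by (simp add: prime_elem_dvd_mult_iff)
  then show ?case
  proof
    assume "\<pi> dvd p"
    then obtain p' where p': "p = \<pi> * p'" by (elim dvdE)
    have "p' * q = \<pi> ^ N" using Suc.prems nz by (simp add: p' mult.assoc)
    then obtain v r where "v dvd 1" "p' = v * \<pi> ^ r" using Suc.IH by blast
    then show ?thesis by (intro exI[of _ v] exI[of _ "Suc r"]) (simp add: p' ac_simps)
  next
    assume "\<pi> dvd q"
    then obtain q' where q': "q = \<pi> * q'" by (elim dvdE)
    have "p * q' = \<pi> ^ N" using Suc.prems nz by (simp add: q' mult.left_commute)
    then show ?thesis by (rule Suc.IH)
  qed
qed

text \<open>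
  Compare the leading coefficients of \<open>P(a t) = P(a) P(t)\<close> as polynomials in \<open>t\<close>.
\<close>

lemma multiplicative_poly_is_power:
  fixes P :: "'k::field poly"
  assumes inf: "infinite (UNIV :: 'k set)" and mult: "\<And>a b. poly P (a * b) = poly P a * poly P b"
    and one: "poly P 1 = 1"
  shows "poly P a = a ^ degree P"
proof -
  have "pcompose P [:0, a:] = Polynomial.smult (poly P a) P"
    by (rule poly_eqI_infinite[OF inf]) (simp add: poly_pcompose mult)
  then have "coeff (pcompose P [:0, a:]) (degree P) = poly P a * lead_coeff P" by simp
  moreover have "coeff (pcompose P [:0, a:]) (degree P) = lead_coeff P * a ^ degree P"
    using pcompose_linear_top[of P "degree P" 0 a] by simp
  moreover have "P \<noteq> 0" using one by auto
  ultimately show ?thesis by simp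
qed

definition eval2 :: "'k::comm_ring_1 poly poly \<Rightarrow> 'k \<Rightarrow> 'k \<Rightarrow> 'k" where
  "eval2 P s l = poly (poly P [:l:]) s"

text \<open>
  In \<open>'k poly poly poly\<close> the outermost variable is \<open>\<lambda>\<close> (argument \<open>l\<close>), followed by \<open>u\<close>, with \<open>s\<close> the
  innermost one. The order matters: irreducibility is proved for polynomials that are monic in \<open>\<lambda>\<close>.
\<close>

definition eval3 :: "'k::comm_ring_1 poly poly poly \<Rightarrow> 'k \<Rightarrow> 'k \<Rightarrow> 'k \<Rightarrow> 'k" where
  "eval3 P s u l = eval2 (poly P [:[:l:]:]) s u"

lemma eval2_simps [simp]:
  "eval2 (P + R) s l = eval2 P s l + eval2 R s l" "eval2 (P * R) s l = eval2 P s l * eval2 R s l"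
  "eval2 (P - R) s l = eval2 P s l - eval2 R s l" "eval2 0 s l = 0" "eval2 1 s l = 1"
  "eval2 (P ^ j) s l = eval2 P s l ^ j" "eval2 [:[:c:]:] s l = c" "eval2 [:0, 1:] s l = l" "eval2 [:[:0, 1:]:] s l = s"
  "eval2 (pCons 0 1) s l = l" "eval2 (pCons (pCons 0 1) 0) s l = s" "eval2 [:f:] s l = poly f s"
  by (simp_all add: eval2_def)

lemma eval3_simps [simp]:
  "eval3 (P + R) s u l = eval3 P s u l + eval3 R s u l" "eval3 (P * R) s u l = eval3 P s u l * eval3 R s u l"
  "eval3 (P - R) s u l = eval3 P s u l - eval3 R s u l" "eval3 0 s u l = 0" "eval3 1 s u l = 1"
  "eval3 (P ^ j) s u l = eval3 P s u l ^ j" "eval3 [:[:[:c:]:]:] s u l = c" "eval3 [:0, 1:] s u l = l"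
  "eval3 (pCons 0 1) s u l = l" "eval3 [:C:] s u l = eval2 C s u" "eval3 (monom C j) s u l = eval2 C s u * l ^ j"
  by (simp_all add: eval3_def poly_monom)

lemma eval3_sum: "eval3 (\<Sum>i\<in>I. P i) s u l = (\<Sum>i\<in>I. eval3 (P i) s u l)"
  by (induction I rule: infinite_finite_induct) auto

lemma eval2_zeroI:
  fixes P :: "'k::field poly poly"
  assumes inf: "infinite (UNIV :: 'k set)" and "\<And>s l. eval2 P s l = 0"
  shows "P = 0"
proof (rule poly_zeroI_infinite)
  show "infinite (range (\<lambda>l::'k. [:l:]))" using inf by (subst finite_image_iff) (auto simp: inj_on_def)
  fix t assume "t \<in> range (\<lambda>l::'k. [:l:])"
  then obtain l where t: "t = [:l:]" by auto
  have "poly P t = 0"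
    by (rule poly_eqI_infinite[OF inf]) (use assms(2) in \<open>simp add: t eval2_def\<close>)
  then show "poly P t = 0" .
qed

lemma eval2_eqI:
  fixes P R :: "'k::field poly poly"
  assumes "infinite (UNIV :: 'k set)" "\<And>s l. eval2 P s l = eval2 R s l"
  shows "P = R"
  using eval2_zeroI[of "P - R"] assms by simp

lemma eval3_eqI:
  fixes P R :: "'k::field poly poly poly"
  assumes inf: "infinite (UNIV :: 'k set)" and eq: "\<And>s u l. eval3 P s u l = eval3 R s u l"
  shows "P = R"
proof -
  have "P - R = 0"
  proof (rule poly_zeroI_infinite)
    show "infinite (range (\<lambda>l::'k. [:[:l:]:]))" using inf by (subst finite_image_iff) (auto simp: inj_on_def)
    fix t assume "t \<in> range (\<lambda>l::'k. [:[:l:]:])"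
    then obtain l where t: "t = [:[:l:]:]" by auto
    show "poly (P - R) t = 0"
      by (rule eval2_zeroI[OF inf]) (use eq in \<open>simp add: t eval3_def\<close>)
  qed
  then show ?thesis by simp
qed

lemma fun_ring_poly_compose: "fun_ring Q \<Longrightarrow> a \<in> Q \<Longrightarrow> (\<lambda>x. poly p (a x)) \<in> Q"
  by (induction p) (auto intro!: fun_ring_intros)

lemma fun_ring_eval2_compose: "fun_ring Q \<Longrightarrow> a \<in> Q \<Longrightarrow> b \<in> Q \<Longrightarrow> (\<lambda>x. eval2 P (a x) (b x)) \<in> Q"
  by (induction P) (auto simp: eval2_def intro!: fun_ring_intros fun_ring_poly_compose)

abbreviation "bivariate \<equiv> range (\<lambda>P (x, y). eval2 P x y)"
abbreviation "trivariate \<equiv> range (\<lambda>P (x, y, z). eval3 P x y z)"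

lemma fun_ring_bivariate: "fun_ring (bivariate :: ('k::comm_ring_1 \<times> 'k \<Rightarrow> 'k) set)"
  unfolding fun_ring_def
proof (intro conjI allI ballI)
  fix c :: 'k show "(\<lambda>_. c) \<in> bivariate" by (rule image_eqI[of _ _ "[:[:c:]:]"]) auto
next
  fix f g :: "'k \<times> 'k \<Rightarrow> 'k" assume "f \<in> bivariate" "g \<in> bivariate"
  then obtain p q where "f = (\<lambda>(x, y). eval2 p x y)" "g = (\<lambda>(x, y). eval2 q x y)" by auto
  then show "(\<lambda>w. f w + g w) \<in> bivariate" "(\<lambda>w. f w * g w) \<in> bivariate"
    by (auto simp: image_iff fun_eq_iff intro: exI[of _ "p + q"] exI[of _ "p * q"])
qed

lemma bivariate_vars: "(\<lambda>w. fst w) \<in> (bivariate :: ('k::comm_ring_1 \<times> 'k \<Rightarrow> 'k) set)"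
  "(\<lambda>w. snd w) \<in> (bivariate :: ('k::comm_ring_1 \<times> 'k \<Rightarrow> 'k) set)"
proof -
  show "(\<lambda>w. fst w) \<in> (bivariate :: ('k \<times> 'k \<Rightarrow> 'k) set)"
    by (rule image_eqI[of _ _ "[:[:0,1:]:]"]) (auto simp: fun_eq_iff)
  show "(\<lambda>w. snd w) \<in> (bivariate :: ('k \<times> 'k \<Rightarrow> 'k) set)"
    by (rule image_eqI[of _ _ "[:0,1:]"]) (auto simp: fun_eq_iff)
qed

lemma fun_ring_trivariate: "fun_ring (trivariate :: ('k::comm_ring_1 \<times> 'k \<times> 'k \<Rightarrow> 'k) set)"
  unfolding fun_ring_def
proof (intro conjI allI ballI)
  fix c :: 'k show "(\<lambda>_. c) \<in> trivariate" by (rule image_eqI[of _ _ "[:[:[:c:]:]:]"]) auto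
next
  fix f g :: "'k \<times> 'k \<times> 'k \<Rightarrow> 'k" assume "f \<in> trivariate" "g \<in> trivariate"
  then obtain p q where "f = (\<lambda>(x, y, z). eval3 p x y z)" "g = (\<lambda>(x, y, z). eval3 q x y z)" by auto
  then show "(\<lambda>w. f w + g w) \<in> trivariate" "(\<lambda>w. f w * g w) \<in> trivariate"
    by (auto simp: image_iff fun_eq_iff intro: exI[of _ "p + q"] exI[of _ "p * q"])
qed

lemma trivariate_vars: "(\<lambda>w. fst w) \<in> (trivariate :: ('k::comm_ring_1 \<times> 'k \<times> 'k \<Rightarrow> 'k) set)"
  "(\<lambda>w. fst (snd w)) \<in> (trivariate :: ('k::comm_ring_1 \<times> 'k \<times> 'k \<Rightarrow> 'k) set)"
  "(\<lambda>w. snd (snd w)) \<in> (trivariate :: ('k::comm_ring_1 \<times> 'k \<times> 'k \<Rightarrow> 'k) set)"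
proof -
  show "(\<lambda>w. fst w) \<in> (trivariate :: ('k \<times> 'k \<times> 'k \<Rightarrow> 'k) set)"
    by (rule image_eqI[of _ _ "[:[:[:0,1:]:]:]"]) (auto simp: fun_eq_iff)
  show "(\<lambda>w. fst (snd w)) \<in> (trivariate :: ('k \<times> 'k \<times> 'k \<Rightarrow> 'k) set)"
    by (rule image_eqI[of _ _ "[:[:0,1:]:]"]) (auto simp: fun_eq_iff)
  show "(\<lambda>w. snd (snd w)) \<in> (trivariate :: ('k \<times> 'k \<times> 'k \<Rightarrow> 'k) set)"
    by (rule image_eqI[of _ _ "[:0,1:]"]) (auto simp: fun_eq_iff)
qed

text \<open>
  A unit as leading coefficient cannot vanish under the specialisation of \<open>s\<close> and \<open>u\<close>, so the degree
  in \<open>\<lambda>\<close> is preserved.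
\<close>

lemma eval3_constant_degree:
  fixes P :: "'k::field poly poly poly"
  assumes inf: "infinite (UNIV :: 'k set)" and lc: "lead_coeff P dvd 1" and const: "\<And>l. eval3 P s 0 l = \<kappa>"
  shows "degree P = 0"
proof -
  define h where "h C = eval2 C s 0" for C :: "'k poly poly"
  define p where "p = map_poly h P"
  have ev: "poly p l = eval3 P s 0 l" for l
    unfolding p_def by (induction P) (auto simp: h_def map_poly_pCons eval3_def eval2_def)
  obtain v where "1 = lead_coeff P * v" using lc by (elim dvdE)
  then have "1 = eval2 (lead_coeff P) s 0 * eval2 v s 0" by (metis eval2_simps(2,5))
  then have nz: "h (lead_coeff P) \<noteq> 0" by (auto simp: h_def)
  have "p = [:\<kappa>:]" by (rule poly_eqI_infinite[OF inf]) (simp add: ev const)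
  moreover have "coeff p (degree P) = h (lead_coeff P)"
    unfolding p_def by (rule coeff_map_poly) (simp add: h_def)
  ultimately show ?thesis using nz by (cases "degree P") auto
qed

text \<open>
  The factors of a monic polynomial have units as leading coefficients, so by \<open>eval3_constant_degree\<close>
  it suffices to consider \<open>u = 0\<close>. The substitution \<open>s = \<lambda>\<^sup>k - t\<close> turns \<open>f(\<lambda>\<^sup>k - s)\<close> into \<open>f(t)\<close>, whose
  factors do not involve \<open>\<lambda>\<close>, and of these one is constant by irreducibility of \<open>f\<close>.
\<close>

lemma specialised_irreducible:
  fixes P :: "'k::field poly poly poly"
  assumes inf: "infinite (UNIV :: 'k set)" and lc: "lead_coeff P = 1" "degree P > 0"
    and f: "irreducible f" and sp: "\<And>s l. eval3 P s 0 l = poly f (l ^ k - s)"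
  shows "irreducible P"
proof (rule irreducibleI)
  show "P \<noteq> 0" using lc by auto
  show "\<not> P dvd 1" using lc(2) by (auto simp: is_unit_poly_iff)
  fix A B assume AB: "P = A * B"
  have lcAB: "lead_coeff A * lead_coeff B = 1" using lc(1) by (simp add: AB lead_coeff_mult)
  then have u: "lead_coeff A dvd 1" "lead_coeff B dvd 1" by (metis dvd_triv_left, metis dvd_triv_right)
  have "\<exists>A'. \<forall>t l. eval2 A' t l = eval3 A (l ^ k - t) 0 l" for A :: "'k poly poly poly"
  proof -
    have "(\<lambda>w. eval3 A (snd w ^ k - fst w) 0 (snd w)) \<in> bivariate"
    proof (induction A)
      case 0
      then show ?case using fun_ring_const[OF fun_ring_bivariate, of 0] by simp
    next
      case (pCons C A)
      have "(\<lambda>w. eval2 C (snd w ^ k - fst w) 0 + snd w * eval3 A (snd w ^ k - fst w) 0 (snd w)) \<in> bivariate"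
        by (intro fun_ring_intros fun_ring_eval2_compose bivariate_vars fun_ring_bivariate pCons.IH)
      moreover have "eval3 (pCons C A) (snd w ^ k - fst w) 0 (snd w) =
        eval2 C (snd w ^ k - fst w) 0 + snd w * eval3 A (snd w ^ k - fst w) 0 (snd w)" for w :: "'k \<times> 'k"
        by (simp add: eval3_def) (simp add: eval2_def)
      ultimately show ?case by simp
    qed
    then obtain A' where A': "(\<lambda>w. eval3 A (snd w ^ k - fst w) 0 (snd w)) = (\<lambda>(x, y). eval2 A' x y)" by auto
    have "eval2 A' t l = eval3 A (l ^ k - t) 0 l" for t l
      using fun_cong[OF A', of "(t, l)"] by simp
    then show ?thesis by blast
  qed
  \<comment> \<open>The specialisation \<open>u = 0\<close>, \<open>s = \<lambda>\<^sup>k - t\<close>.\<close>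
  then have "\<forall>A :: 'k poly poly poly. \<exists>A'. \<forall>t l. eval2 A' t l = eval3 A (l ^ k - t) 0 l" by blast
  from choice[OF this] obtain \<Phi> where \<Phi>: "\<And>(A :: 'k poly poly poly) t l. eval2 (\<Phi> A) t l = eval3 A (l ^ k - t) 0 l" by blast
  have prod: "\<Phi> A * \<Phi> B = [:f:]"
    by (rule eval2_eqI[OF inf]) (use sp in \<open>simp add: \<Phi> AB\<close>)
  have f0: "f \<noteq> 0" using f by auto
  have nz: "\<Phi> A \<noteq> 0" "\<Phi> B \<noteq> 0" using prod f0 by auto
  have "degree (\<Phi> A) + degree (\<Phi> B) = 0"
    using degree_mult_eq[OF nz] by (simp add: prod)
  then have "degree (\<Phi> A) = 0" "degree (\<Phi> B) = 0" by auto
  then obtain a b where ab: "\<Phi> A = [:a:]" "\<Phi> B = [:b:]" by (metis degree_eq_zeroE)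
  have "f = a * b" using prod by (auto simp: ab mult.commute)
  then have cases: "a dvd 1 \<or> b dvd 1" using irreducibleD[OF f] by blast
  have unit: "C dvd 1" if c: "c dvd 1" "\<Phi> C = [:c:]" "lead_coeff C dvd 1" for C c
  proof -
    obtain \<kappa> where \<kappa>: "c = [:\<kappa>:]" using c(1) unfolding is_unit_poly_iff by blast
    have "eval3 C 0 0 l = \<kappa>" for l using \<Phi>[of C "l ^ k" l] by (simp add: c(2) \<kappa>)
    then have "degree C = 0" by (rule eval3_constant_degree[OF inf c(3)])
    then obtain e where "C = [:e:]" by (rule degree_eq_zeroE)
    then show ?thesis using c(3) by (simp add: is_unit_poly_iff)
  qed
  show "A dvd 1 \<or> B dvd 1" using cases unit u ab by blast
qed

lemma trivariate_unit:
  fixes v :: "'k::field poly poly poly"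
  assumes "v dvd 1" shows "\<exists>\<kappa>. \<forall>s u l. eval3 v s u l = \<kappa>"
proof -
  obtain a where a: "v = [:a:]" "a dvd 1" using assms unfolding is_unit_poly_iff by blast
  obtain b where b: "a = [:b:]" "b dvd 1" using a(2) unfolding is_unit_poly_iff by blast
  obtain c where c: "b = [:c:]" using b(2) unfolding is_unit_poly_iff by blast
  show ?thesis by (simp add: a b c)
qed

context matrix_family
begin

lemma scalar_shift_full:
  assumes "full K.AE mK a"
  shows "full K.AE mK (a + scale s 1)"
  unfolding full_def
proof (intro allI impI)
  fix p assume p: "K.ev (a + scale s 1) p = \<zero>\<^bsub>K.AE\<^esub>" "degree p < mK"
  have "K.ev a [:s, 1:] = a + scale s 1"
    using K.alg_eval_linear[of a s 1] by (simp add: K.scale_one add.commute)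
  then have "K.ev a (pcompose p [:s, 1:]) = 0" using p(1) by (simp add: K.ev_simps)
  then have "pcompose p [:s, 1:] = 0" using p(2) by (intro K.fullD[OF assms]) (auto simp: degree_pcompose)
  then show "p = 0" by (rule pcompose_eq_0) simp
qed

text \<open>
  If \<open>f\<close> is the minimal polynomial of the corner entry, then \<open>f(\<lambda>\<^sup>k)\<close> kills the companion matrix and has
  the degree of the matrix algebra. The shift of the corner by \<open>s\<close> is covered by \<open>M_affine\<close>.
\<close>

lemma companion_min_poly:
  assumes a: "full K.AE mK a"
  shows "poly (M (companion k (a + scale s 1))) l = poly (MK a) (l ^ k - s)"
proof -
  let ?a = "a + scale s 1"
  let ?B = "companion k ?a"
  let ?f = "MK ?a"
  define p where "p = (\<Sum>j\<le>mK. monom (coeff ?f j) (k * j))"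
  have degf: "degree ?f = mK" using K.M_degree[of ?a] by simp
  have pl: "poly p l = poly ?f (l ^ k)" for l
    unfolding p_def poly_sum poly_monom poly_altdef[of ?f] degf by (simp add: power_mult)
  have cp: "coeff p (k * j + r) = (if r = 0 then coeff ?f j else 0)" if r: "r < k" for j r
  proof (cases "r = 0")
    case True
    have "coeff p (k * j) = (\<Sum>i\<le>mK. if i = j then coeff ?f j else 0)"
      unfolding p_def coeff_sum by (rule sum.cong) (use k_pos in auto)
    then show ?thesis using True degf by (auto simp: coeff_eq_0)
  next
    case False
    have "k * i \<noteq> k * j + r" for i
    proof
      assume "k * i = k * j + r"
      then have "(k * j + r) mod k = 0" by (metis mod_mult_self1_is_0)
      then show False using r False by simp
    qed
    then have "coeff p (k * j + r) = 0" by (simp add: p_def coeff_sum)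
    then show ?thesis using False by simp
  qed
  have degp: "degree p \<le> m"
    unfolding p_def
  proof (rule degree_sum_le)
    fix j assume "j \<in> {..mK}"
    then have "k * j \<le> m" by (simp add: degree_matrix)
    then show "degree (monom (coeff ?f j) (k * j)) \<le> m" using degree_monom_le le_trans by blast
  qed simp
  have "alg_eval MA ?B p = 0\<^sub>m k k"
  proof (rule alg_eval_eq_0I[where F = "1\<^sub>m k"])
    show "cyclic_columns ?B * 1\<^sub>m k = 1\<^sub>m k" by (simp add: companion_cyclic)
    fix r assume r: "r < k"
    have "(\<Sum>j\<le>degree p. monom (coeff p (k * j + r)) j) = (if r = 0 then ?f else 0)"
    proof (rule poly_eqI)
      fix i
      have "coeff (\<Sum>j\<le>degree p. monom (coeff p (k * j + r)) j) i = (if i \<le> degree p then coeff p (k * i + r) else 0)"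
        by (simp add: coeff_sum)
      also have "\<dots> = coeff p (k * i + r)"
      proof (cases "i \<le> degree p")
        case False
        moreover have "i \<le> k * i" using k_pos by simp
        ultimately have "degree p < k * i + r" by linarith
        then show ?thesis by (simp add: coeff_eq_0)
      qed simp
      finally show "coeff (\<Sum>j\<le>degree p. monom (coeff p (k * j + r)) j) i = coeff (if r = 0 then ?f else 0) i"
        by (simp add: cp[OF r])
    qed
    then show "alg_eval MA ?B p $$ (r, 0) = 0"
      using companion_eval_column[OF r, of ?a p] K.ev_M[of ?a] by (simp add: K.ev_simps)
  qed auto
  moreover have "full MA m ?B"
    using companion_full[OF scalar_shift_full[OF a]] by (simp add: degree_matrix)
  moreover have "coeff p m = 1"
    using cp[OF k_pos, of mK] K.M_top[of ?a] by (simp add: degree_matrix)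
  ultimately have "p = M ?B"
    using A.full_unique[of ?B p] degp by simp
  then have "poly (M ?B) l = poly ?f (l ^ k)" using pl by simp
  moreover have "poly (MK (s \<odot>\<^bsub>K.AE\<^esub> \<one>\<^bsub>K.AE\<^esub> \<oplus>\<^bsub>K.AE\<^esub> 1 \<odot>\<^bsub>K.AE\<^esub> a)) (s + 1 * (l ^ k - s)) = 1 ^ mK * poly (MK a) (l ^ k - s)"
    by (rule K.M_affine) simp
  then have "poly ?f (l ^ k) = poly (MK a) (l ^ k - s)" by (simp add: K.scale_one add.commute)
  ultimately show ?thesis by simp
qed

lemma companion_shift:
  "companion k (a + scale s 1) = companion k a \<oplus>\<^bsub>MA\<^esub> s \<odot>\<^bsub>MA\<^esub> unit_column k (k - 1)"
  by (rule eq_matI) (use k_pos in \<open>auto simp: companion_def unit_column_def\<close>)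

text \<open>
  The line, with parameter \<open>u\<close>, from the companion matrix with corner \<open>a + s\<close> to \<open>X\<close>. The
  parameter \<open>s\<close> is needed for irreducibility: \<open>f(\<lambda>\<^sup>k)\<close> itself may factor.
\<close>

definition pencil :: "'d \<Rightarrow> 'd mat \<Rightarrow> 'k \<Rightarrow> 'k \<Rightarrow> 'd mat" where
  "pencil a X s u = companion k (a + scale s 1) \<oplus>\<^bsub>MA\<^esub> u \<odot>\<^bsub>MA\<^esub> (X \<oplus>\<^bsub>MA\<^esub> (-1) \<odot>\<^bsub>MA\<^esub> companion k (a + scale s 1))"

lemma pencil_ends:
  assumes "X \<in> carrier MA"
  shows "pencil a X s 0 = companion k (a + scale s 1)" "pencil a X s 1 = X"
  unfolding pencil_def by (rule A.line_end; use assms in simp)+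

lemma pencil_path:
  assumes Q: "fun_ring Q" and su: "\<sigma> \<in> Q" "\<upsilon> \<in> Q" and X: "X \<in> carrier MA"
  shows "A.poly_path Q (\<lambda>w. pencil a X (\<sigma> w) (\<upsilon> w))"
  unfolding pencil_def companion_shift
  by (intro A.poly_path_add A.poly_path_smult A.poly_path_const Q su X fun_ring_const[OF Q])
    (auto simp: unit_column_def)

lemma pencil_generic_poly:
  assumes X: "X \<in> carrier MA"
  shows "\<exists>P. lead_coeff P = 1 \<and> degree P = m \<and> (\<forall>s u l. eval3 P s u l = poly (M (pencil a X s u)) l)"
proof -
  have "\<exists>C. \<forall>s u. eval2 C s u = coeff (M (pencil a X s u)) j" for j
  proof -
    have "(\<lambda>w. coeff (M (pencil a X (fst w) (snd w))) j) \<in> (bivariate :: ('k \<times> 'k \<Rightarrow> 'k) set)"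
      by (intro A.M_coeff_path fun_ring_bivariate pencil_path bivariate_vars X)
    then obtain C where C: "(\<lambda>w. coeff (M (pencil a X (fst w) (snd w))) j) = (\<lambda>(x, y). eval2 C x y)" by auto
    have "eval2 C s u = coeff (M (pencil a X s u)) j" for s u using fun_cong[OF C, of "(s, u)"] by simp
    then show ?thesis by blast
  qed
  then obtain C where C: "\<And>j s u. eval2 (C j) s u = coeff (M (pencil a X s u)) j" by metis
  have closed: "pencil a X s u \<in> carrier MA" for s u
    using X by (simp add: pencil_def)
  define P where "P = monom 1 m + (\<Sum>j<m. monom (C j) j)"
  have cP: "coeff P i = (if i = m then 1 else if i < m then C i else 0)" for i
    by (auto simp: P_def coeff_sum)
  have "degree P = m"
    by (rule antisym, rule degree_le, auto simp: cP, rule le_degree, simp add: cP)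
  moreover have "eval3 P s u l = poly (M (pencil a X s u)) l" for s u l
  proof -
    have "poly (M (pencil a X s u)) l = (\<Sum>j\<le>m. coeff (M (pencil a X s u)) j * l ^ j)"
      using A.M_degree[OF closed, of s u] by (simp add: poly_altdef)
    then show ?thesis using A.M_top[OF closed, of s u]
      by (simp add: P_def eval3_sum C lessThan_Suc_atMost[symmetric])
  qed
  ultimately show ?thesis by (intro exI[of _ P]) (simp add: cP)
qed

lemma character_scalar:
  assumes \<chi>: "algebra_character MA \<chi>"
  shows "\<exists>N. \<forall>c. \<chi> (c \<odot>\<^bsub>MA\<^esub> \<one>\<^bsub>MA\<^esub>) = c ^ N"
proof -
  note fr = fun_ring_poly[where ?'a = 'k]
  have "(\<lambda>c. \<chi> (c \<odot>\<^bsub>MA\<^esub> \<one>\<^bsub>MA\<^esub>)) \<in> range poly"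
    by (rule A.polynomial_function_path[OF _ fr])
      (use \<chi> in \<open>auto simp: algebra_character_def simp del: matrix_algebra_simps
        intro!: A.poly_path_smult A.poly_path_const fr fun_ring_poly_id\<close>)
  then obtain P where P: "\<And>c. \<chi> (c \<odot>\<^bsub>MA\<^esub> \<one>\<^bsub>MA\<^esub>) = poly P c" by (auto simp: fun_eq_iff)
  have "poly P c = c ^ degree P" for c
  proof (rule multiplicative_poly_is_power[OF A.inf])
    fix a b
    have "(a * b) \<odot>\<^bsub>MA\<^esub> \<one>\<^bsub>MA\<^esub> = (a \<odot>\<^bsub>MA\<^esub> \<one>\<^bsub>MA\<^esub>) \<otimes>\<^bsub>MA\<^esub> (b \<odot>\<^bsub>MA\<^esub> \<one>\<^bsub>MA\<^esub>)"
      by (simp add: A.sm_mult1 A.sm_assoc del: matrix_algebra_simps)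
    then show "poly P (a * b) = poly P a * poly P b"
      using \<chi> by (simp add: P[symmetric] algebra_character_def del: matrix_algebra_simps)
    show "poly P 1 = 1" using \<chi>
      by (simp add: P[symmetric] algebra_character_def A.sm_one del: matrix_algebra_simps)
  qed
  then show ?thesis using P by auto
qed

text \<open>
  Over \<open>K[s, u, \<lambda>]\<close> the polynomial \<open>\<chi>(\<lambda> - X)\<close>, for \<open>X\<close> in the pencil, divides \<open>\<chi>(M X(\<lambda>) \<cdot> 1)\<close> by
  \<open>M_quotient\<close>. The latter is a power of the prime \<open>M X\<close> because \<open>\<chi>\<close> restricted to scalars is a power
  map.
\<close>

lemma character_pencil:
  assumes \<chi>: "algebra_character MA \<chi>" and X: "X \<in> carrier MA" and a: "full K.AE mK a"
  shows "\<exists>\<kappa> r. \<forall>s u l. \<chi> (l \<odot>\<^bsub>MA\<^esub> \<one>\<^bsub>MA\<^esub> \<oplus>\<^bsub>MA\<^esub> (-1) \<odot>\<^bsub>MA\<^esub> pencil a X s u) =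
    \<kappa> * poly (M (pencil a X s u)) l ^ r"
proof -
  note fr = fun_ring_trivariate[where ?'k = 'k]
  have closed: "pencil a X s u \<in> carrier MA" for s u
    using X by (simp add: pencil_def)
  have \<chi>poly: "polynomial_function MA \<chi>" and \<chi>mult: "\<And>a b. a \<in> carrier MA \<Longrightarrow> b \<in> carrier MA \<Longrightarrow> \<chi> (a \<otimes>\<^bsub>MA\<^esub> b) = \<chi> a * \<chi> b"
    using \<chi> by (auto simp: algebra_character_def)
  obtain N where N: "\<And>c. \<chi> (c \<odot>\<^bsub>MA\<^esub> \<one>\<^bsub>MA\<^esub>) = c ^ N" using character_scalar[OF \<chi>] by blast
  obtain P where P: "lead_coeff P = 1" "degree P = m" "\<And>s u l. eval3 P s u l = poly (M (pencil a X s u)) l"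
    using pencil_generic_poly[OF X] by blast
  have path: "A.poly_path trivariate (\<lambda>w. pencil a X (fst w) (fst (snd w)))"
    by (intro pencil_path fr trivariate_vars X)
  have "(\<lambda>w. \<chi> (snd (snd w) \<odot>\<^bsub>MA\<^esub> \<one>\<^bsub>MA\<^esub> \<oplus>\<^bsub>MA\<^esub> (-1) \<odot>\<^bsub>MA\<^esub> pencil a X (fst w) (fst (snd w)))) \<in> trivariate"
    by (intro A.polynomial_function_path[OF \<chi>poly fr] A.poly_path_add A.poly_path_smult A.poly_path_const
      path fr trivariate_vars fun_ring_const[OF fr] A.one_closed)
  then obtain p where p: "(\<lambda>w. \<chi> (snd (snd w) \<odot>\<^bsub>MA\<^esub> \<one>\<^bsub>MA\<^esub> \<oplus>\<^bsub>MA\<^esub> (-1) \<odot>\<^bsub>MA\<^esub> pencil a X (fst w) (fst (snd w)))) = (\<lambda>(x, y, z). eval3 p x y z)"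
    by auto
  have p: "eval3 p s u l = \<chi> (l \<odot>\<^bsub>MA\<^esub> \<one>\<^bsub>MA\<^esub> \<oplus>\<^bsub>MA\<^esub> (-1) \<odot>\<^bsub>MA\<^esub> pencil a X s u)" for s u l
    using fun_cong[OF p, of "(s, u, l)"] by simp
  have "(\<lambda>w. \<chi> (alg_eval MA (pencil a X (fst w) (fst (snd w))) (synthetic_div (M (pencil a X (fst w) (fst (snd w)))) (snd (snd w))))) \<in> trivariate"
    by (intro A.polynomial_function_path[OF \<chi>poly fr] A.quotient_path path fr trivariate_vars)
  then obtain q where q: "(\<lambda>w. \<chi> (alg_eval MA (pencil a X (fst w) (fst (snd w))) (synthetic_div (M (pencil a X (fst w) (fst (snd w)))) (snd (snd w))))) = (\<lambda>(x, y, z). eval3 q x y z)"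
    by auto
  have q: "eval3 q s u l = \<chi> (alg_eval MA (pencil a X s u) (synthetic_div (M (pencil a X s u)) l))" for s u l
    using fun_cong[OF q, of "(s, u, l)"] by simp
  have "p * q = P ^ N"
  proof (rule eval3_eqI[OF A.inf])
    fix s u l
    have "eval3 (p * q) s u l = \<chi> ((l \<odot>\<^bsub>MA\<^esub> \<one>\<^bsub>MA\<^esub> \<oplus>\<^bsub>MA\<^esub> (-1) \<odot>\<^bsub>MA\<^esub> pencil a X s u) \<otimes>\<^bsub>MA\<^esub>
      alg_eval MA (pencil a X s u) (synthetic_div (M (pencil a X s u)) l))"
      unfolding eval3_simps p q
      by (rule \<chi>mult[symmetric]) (use closed[of s u] in \<open>auto simp del: matrix_algebra_simps\<close>)
    also have "\<dots> = poly (M (pencil a X s u)) l ^ N"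
      unfolding A.M_quotient[OF closed] N ..
    finally show "eval3 (p * q) s u l = eval3 (P ^ N) s u l" by (simp add: P)
  qed
  moreover have "prime_elem P"
  proof -
    have "prime_elem (MK a)"
      by (rule K.killing_degree_prime[OF a K.ev_M _ K.m_pos]) (use K.M_degree[of a] in simp)
    then have "irreducible (MK a)" by (rule prime_elem_imp_irreducible)
    moreover have "m > 0" using k_pos K.m_pos by (simp add: degree_matrix)
    ultimately have "irreducible P"
      by (intro specialised_irreducible[OF A.inf P(1), where f = "MK a" and k = k])
        (use P in \<open>auto simp: pencil_ends[OF X] companion_min_poly[OF a] simp del: matrix_algebra_simps\<close>)
    then show ?thesis by (simp add: prime_elem_iff_irreducible)
  qed
  ultimately have "\<exists>v r. v dvd 1 \<and> p = v * P ^ r" by (rule divisor_of_prime_power[rotated])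
  then obtain v r where v: "v dvd 1" "p = v * P ^ r" by (elim exE conjE)
  obtain \<kappa> where "\<And>s u l. eval3 v s u l = \<kappa>" using trivariate_unit[OF v(1)] by blast
  then have "\<chi> (l \<odot>\<^bsub>MA\<^esub> \<one>\<^bsub>MA\<^esub> \<oplus>\<^bsub>MA\<^esub> (-1) \<odot>\<^bsub>MA\<^esub> pencil a X s u) =
    \<kappa> * poly (M (pencil a X s u)) l ^ r" for s u l
    unfolding p[symmetric] v(2) by (simp add: P)
  then show ?thesis by blast
qed

text \<open>
  Exponent and scalar obtained from \<open>character_pencil\<close> might depend on \<open>X\<close>. Every pencil starts at the
  same companion matrix, however, and the degree in \<open>\<lambda>\<close> at that end determines the exponent, the
  leading coefficient the scalar; for the pencil ending in the zero matrix the scalar is \<open>\<chi>(1) = 1\<close>.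
\<close>

theorem character_is_norm_power:
  assumes \<chi>: "algebra_character MA \<chi>"
  shows "\<exists>r. \<forall>X\<in>carrier MA. \<chi> X = ((-1) ^ m * coeff (M X) 0) ^ r"
proof -
  obtain a where a: "full K.AE mK a" using K.full_exists by auto
  let ?B = "companion k (a + scale 0 1)"
  have "\<forall>X\<in>carrier MA. \<exists>\<kappa> r. \<forall>s u l. \<chi> (l \<odot>\<^bsub>MA\<^esub> \<one>\<^bsub>MA\<^esub> \<oplus>\<^bsub>MA\<^esub> (-1) \<odot>\<^bsub>MA\<^esub> pencil a X s u) =
    \<kappa> * poly (M (pencil a X s u)) l ^ r"
    using character_pencil[OF \<chi> _ a] by blast
  then obtain \<kappa> r where *: "\<And>X s u l. X \<in> carrier MA \<Longrightarrow> \<chi> (l \<odot>\<^bsub>MA\<^esub> \<one>\<^bsub>MA\<^esub> \<oplus>\<^bsub>MA\<^esub> (-1) \<odot>\<^bsub>MA\<^esub> pencil a X s u) =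
    \<kappa> X * poly (M (pencil a X s u)) l ^ r X"
    by metis
  have \<chi>X: "\<chi> (l \<odot>\<^bsub>MA\<^esub> \<one>\<^bsub>MA\<^esub> \<oplus>\<^bsub>MA\<^esub> (-1) \<odot>\<^bsub>MA\<^esub> X) = \<kappa> X * poly (M X) l ^ r X" if "X \<in> carrier MA" for X l
    using *[OF that, of l 0 1] pencil_ends(2)[OF that] by simp
  have \<chi>B: "\<chi> (l \<odot>\<^bsub>MA\<^esub> \<one>\<^bsub>MA\<^esub> \<oplus>\<^bsub>MA\<^esub> (-1) \<odot>\<^bsub>MA\<^esub> ?B) = \<kappa> X * poly (M ?B) l ^ r X" if "X \<in> carrier MA" for X l
    using *[OF that, of l 0 0] pencil_ends(1)[OF that, of a 0] by simp
  let ?O = "\<zero>\<^bsub>MA\<^esub>"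
  have B: "?B \<in> carrier MA" by simp
  have m0: "m > 0" using k_pos K.m_pos by (simp add: degree_matrix)
  have "\<kappa> ?O = 1"
  proof -
    have "1 \<odot>\<^bsub>MA\<^esub> \<one>\<^bsub>MA\<^esub> \<oplus>\<^bsub>MA\<^esub> (-1) \<odot>\<^bsub>MA\<^esub> ?O = \<one>\<^bsub>MA\<^esub>"
      by (rule eq_matI) (auto simp: K.scale_one)
    then have "\<kappa> ?O * poly (M ?O) 1 ^ r ?O = \<chi> \<one>\<^bsub>MA\<^esub>" using \<chi>X[of ?O 1] by simp
    then show ?thesis using \<chi> A.M_zero[of 1] by (simp add: algebra_character_def del: matrix_algebra_simps)
  qed
  have same: "\<kappa> X = 1 \<and> r X = r ?O" if X: "X \<in> carrier MA" for X
  proof -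
    have "Polynomial.smult (\<kappa> X) (M ?B ^ r X) = Polynomial.smult (\<kappa> ?O) (M ?B ^ r ?O)"
      by (rule poly_eqI_infinite[OF A.inf]) (simp only: poly_smult poly_power \<chi>B[OF X, symmetric] \<chi>B[OF A.zero_closed, symmetric])
    then have eq: "Polynomial.smult (\<kappa> X) (M ?B ^ r X) = M ?B ^ r ?O" by (simp only: \<open>\<kappa> ?O = 1\<close> smult_1_left)
    have lc: "lead_coeff (M ?B ^ j) = 1" for j using A.M_monic[OF B] by (simp add: lead_coeff_power)
    have deg: "degree (M ?B ^ j) = j * m" for j
      using A.M_degree[OF B] A.M_monic[OF B] by (subst degree_power_eq) auto
    have "\<kappa> X \<noteq> 0"
    proof
      assume "\<kappa> X = 0"
      then have "M ?B ^ r ?O = 0" using eq by (simp only: smult_0_left)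
      then show False using lc[of "r ?O"] by (simp only: coeff_0 zero_neq_one)
    qed
    then have "r X * m = r ?O * m" using arg_cong[OF eq, of degree] deg by simp
    moreover have "\<kappa> X = 1" using arg_cong[OF eq, of lead_coeff] by (simp only: lead_coeff_smult lc mult_1_right)
    ultimately show ?thesis using m0 by simp
  qed
  have "\<chi> X = ((-1) ^ m * coeff (M X) 0) ^ r ?O" if X: "X \<in> carrier MA" for X
  proof -
    let ?X = "(-1) \<odot>\<^bsub>MA\<^esub> X"
    have cX: "?X \<in> carrier MA" using X by simp
    have "0 \<odot>\<^bsub>MA\<^esub> \<one>\<^bsub>MA\<^esub> \<oplus>\<^bsub>MA\<^esub> (-1) \<odot>\<^bsub>MA\<^esub> ?X = X"
      using X A.sm_assoc[of X "-1" "-1"] A.sm_one[of X] A.sm_zero[of "\<one>\<^bsub>MA\<^esub>"]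
      by (simp del: matrix_algebra_simps)
    then have "\<chi> X = poly (M ?X) 0 ^ r ?O" using \<chi>X[OF cX, of 0] same[OF cX] by simp
    then show ?thesis using A.M_const_scale[OF X, of "-1"] by (simp add: poly_0_coeff_0 del: matrix_algebra_simps)
  qed
  then show ?thesis by blast
qed

end

section \<open>Degrees and characters in terms of the general element\<close>

lemma generic_algebra_exists:
  fixes A :: "('k::field, 'a) module"
  assumes inf: "infinite (UNIV :: 'k set)" and "assoc_algebra class_ring A" "ordered_basis A us"
  shows "\<exists>M. generic_algebra A us (alg_degree A us) M \<and>
    (\<forall>b\<in>carrier A. reduced_norm A us b = (-1) ^ alg_degree A us * coeff (M b) 0)"
proof -
  interpret based_algebra A us
    by (intro based_algebra.intro based_algebra_axioms.intro assms)
  show ?thesis using generic_min_poly[OF inf]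
    by (auto intro!: generic_algebra.intro generic_algebra_axioms.intro based_algebra_axioms inf)
qed

lemma division_family_exists:
  fixes scale :: "'k::field \<Rightarrow> 'd::division_ring \<Rightarrow> 'd"
  assumes "infinite (UNIV :: 'k set)" "assoc_algebra class_ring (type_algebra scale)"
    "ordered_basis (type_algebra scale) us"
  shows "\<exists>M. division_family scale us (alg_degree (type_algebra scale) us) M"
  using generic_algebra_exists[OF assms] assms(2)
  by (auto intro!: division_family.intro subalgebra_family.intro scalar_ring.intro simp: type_algebra_UNIV)

lemma ordered_basis_exists:
  fixes A :: "('k::field, 'a) module"
  assumes "vectorspace class_ring A" "vectorspace.fin_dim class_ring A"
  shows "\<exists>us. ordered_basis A us"
proof -
  interpret vectorspace "class_ring :: 'k ring" A by fact
  obtain \<beta> where \<beta>: "finite \<beta>" "basis \<beta>" using finite_basis_exists[OF assms(2)] by blast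
  obtain us where "set us = \<beta>" "distinct us" using finite_distinct_list[OF \<beta>(1)] by blast
  then show ?thesis using \<beta>(2) by (auto simp: ordered_basis_def)
qed

lemma ring_subset_algebra:
  fixes scale :: "'k::field \<Rightarrow> 'd::ring_1 \<Rightarrow> 'd"
  assumes "scalar_ring scale" "1 \<in> E" "\<And>x y. x \<in> E \<Longrightarrow> y \<in> E \<Longrightarrow> x + y \<in> E"
    "\<And>x y. x \<in> E \<Longrightarrow> y \<in> E \<Longrightarrow> x * y \<in> E" "\<And>c x. x \<in> E \<Longrightarrow> scale c x \<in> E"
  shows "assoc_algebra class_ring ((type_algebra scale)\<lparr>carrier := E\<rparr>)"
proof -
  interpret scalar_ring scale by fact
  have zero: "0 \<in> E" using assms(5)[OF assms(2), of 0] by simp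
  have neg: "- x \<in> E" if "x \<in> E" for x
    using assms(5)[OF that, of "-1"] by (simp add: scale_minus_left scale_one)
  show ?thesis
  proof (rule assoc_algebraI)
    show "ring ((type_algebra scale)\<lparr>carrier := E\<rparr>)"
    proof (rule ringI)
      show "abelian_group ((type_algebra scale)\<lparr>carrier := E\<rparr>)"
      proof (rule abelian_groupI)
        fix x assume "x \<in> carrier ((type_algebra scale)\<lparr>carrier := E\<rparr>)"
        then show "\<exists>y\<in>carrier ((type_algebra scale)\<lparr>carrier := E\<rparr>).
          y \<oplus>\<^bsub>(type_algebra scale)\<lparr>carrier := E\<rparr>\<^esub> x = \<zero>\<^bsub>(type_algebra scale)\<lparr>carrier := E\<rparr>\<^esub>"
          by (intro bexI[of _ "- x"]) (auto intro: neg)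
      qed (auto simp: add.assoc add.commute zero assms(3))
      show "Group.monoid ((type_algebra scale)\<lparr>carrier := E\<rparr>)"
        by (rule monoidI) (auto simp: mult.assoc assms)
    qed (auto simp: algebra_simps)
  qed (auto simp: assms(5) scale_add_left scale_add_right scale_mult scale_one scale_mult_left scale_mult_right)
qed

theorem theorem6p2p1:
  fixes scale :: "'k::field \<Rightarrow> 'd::division_ring \<Rightarrow> 'd"
    and \<iota> :: "'c::field \<Rightarrow> 'd"
    and d c :: nat
  assumes "infinite (UNIV :: 'k set)"
    and "assoc_algebra class_ring (type_algebra scale)"
    and "vectorspace.fin_dim class_ring (type_algebra scale)"
    and "\<iota> \<in> ring_iso class_ring (center_algebra scale)"
    and "ordered_basis (type_algebra (\<lambda>z x. \<iota> z * x)) us"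
    and "alg_degree (type_algebra (\<lambda>z x. \<iota> z * x)) us = d"
    and "ordered_basis (center_algebra scale) vs"
    and "alg_degree (center_algebra scale) vs = c"
  shows "(\<forall>k\<ge>1. \<forall>ws. ordered_basis (matrix_algebra scale k) ws \<longrightarrow>
            alg_degree (matrix_algebra scale k) ws = d * k * c) \<and>
         (\<forall>k\<ge>1. \<forall>ws \<chi>. ordered_basis (matrix_algebra scale k) ws \<longrightarrow>
            algebra_character (matrix_algebra scale k) \<chi> \<longrightarrow>
            (\<exists>r::nat. \<forall>X \<in> carrier (matrix_algebra scale k).
               \<chi> X = reduced_norm (matrix_algebra scale k) ws X ^ r))"
proof -
  let ?Z = "{z. \<forall>x. z * x = x * z} :: 'd set"
  interpret S: scalar_ring scale by (rule scalar_ring.intro) (rule assms(2))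
  have Z: "center_algebra scale = (type_algebra scale)\<lparr>carrier := ?Z\<rparr>"
    by (simp add: center_algebra_def)
  have hom: "\<iota> \<in> Ring.ring_hom class_ring (center_algebra scale)"
    and bij: "bij_betw \<iota> (carrier class_ring) (carrier (center_algebra scale))"
    using assms(4) by (auto simp: ring_iso_def)
  have \<iota>_add: "\<iota> (x + y) = \<iota> x + \<iota> y" and \<iota>_mult: "\<iota> (x * y) = \<iota> x * \<iota> y" and \<iota>_one: "\<iota> 1 = 1" for x y
    using ring_hom_add[OF hom, of x y] ring_hom_mult[OF hom, of x y] ring_hom_one[OF hom]
    by (simp_all add: Z)
  have \<iota>_range: "range \<iota> = ?Z"
    using bij by (simp add: bij_betw_def Z)
  have \<iota>_central: "\<iota> z * x = x * \<iota> z" for z x using \<iota>_range by blast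
  have scale_central: "scale a 1 \<in> ?Z" for a by (simp add: S.scale_mult_left S.scale_mult_right)
  \<comment> \<open>The generic family of \<open>D\<close> over \<open>C\<close> requires an infinite center; \<open>K\<close> embeds into it.\<close>
  have infC: "infinite (UNIV :: 'c set)"
  proof
    assume "finite (UNIV :: 'c set)"
    then have "finite ?Z" using \<iota>_range by (metis finite_imageI)
    then have "finite (range (\<lambda>a. scale a 1))" by (rule finite_subset[rotated]) (use scale_central in blast)
    moreover have "inj (\<lambda>a. scale a 1)"
    proof (rule injI)
      fix a b assume "scale a 1 = scale b 1"
      then have "scale (a - b) 1 = 0" using S.scale_add_left[of a "- b" 1] by (simp add: S.scale_minus_left)
      then show "a = b" using S.scale_eq_0[of "a - b" 1] by auto
    qed
    ultimately show False using assms(1) finite_imageD by blast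
  qed
  have "scalar_ring (\<lambda>z x. \<iota> z * x)"
  proof (rule scalar_ring.intro, rule assoc_algebraI)
    show "ring (type_algebra (\<lambda>z x. \<iota> z * x))"
    proof (rule ringI)
      show "abelian_group (type_algebra (\<lambda>z x. \<iota> z * x))"
        by (rule abelian_groupI) (auto simp: add.assoc add.commute intro: exI[of _ "- x" for x] right_minus)
      show "Group.monoid (type_algebra (\<lambda>z x. \<iota> z * x))" by (rule monoidI) (auto simp: mult.assoc)
    qed (auto simp: algebra_simps)
  next
    fix z x y
    show "x \<otimes>\<^bsub>type_algebra (\<lambda>z x. \<iota> z * x)\<^esub> (z \<odot>\<^bsub>type_algebra (\<lambda>z x. \<iota> z * x)\<^esub> y) =
      z \<odot>\<^bsub>type_algebra (\<lambda>z x. \<iota> z * x)\<^esub> (x \<otimes>\<^bsub>type_algebra (\<lambda>z x. \<iota> z * x)\<^esub> y)"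
      by (simp add: mult.assoc[symmetric] \<iota>_central)
  qed (auto simp: \<iota>_add \<iota>_mult \<iota>_one algebra_simps)
  then have asC: "assoc_algebra class_ring (type_algebra (\<lambda>z x. \<iota> z * x))" by (rule scalar_ring.asc)
  obtain MC where MC: "division_family (\<lambda>z x. \<iota> z * x) us d MC"
    using division_family_exists[OF infC asC assms(5)] assms(6) by auto
  have "assoc_algebra class_ring (center_algebra scale)"
    unfolding Z
  proof (rule ring_subset_algebra)
    show "scalar_ring scale" by (rule S.scalar_ring_axioms)
    fix x y :: 'd assume xy: "x \<in> ?Z" "y \<in> ?Z"
    have "x * y * w = w * (x * y)" for w
    proof -
      have comm: "x * w = w * x" "y * w = w * y" using xy by blast+
      show ?thesis by (metis comm mult.assoc)
    qed
    then show "x * y \<in> ?Z" by simp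
    show "x + y \<in> ?Z" using xy by (simp add: distrib_left distrib_right)
    show "scale a x \<in> ?Z" for a using xy by (simp add: S.scale_mult_left S.scale_mult_right)
  qed simp
  then obtain MZ where "generic_algebra (center_algebra scale) vs c MZ"
    using generic_algebra_exists[OF assms(1) _ assms(7)] assms(8) by blast
  then have MZ: "subalgebra_family scale ?Z vs c MZ"
    unfolding Z by (intro subalgebra_family.intro S.scalar_ring_axioms)
  have "vectorspace class_ring (type_algebra scale)"
    using assms(2) by (rule assoc_algebra.axioms)
  then obtain bs where bs: "ordered_basis (type_algebra scale) bs"
    using ordered_basis_exists assms(3) by blast
  define mK where "mK = alg_degree (type_algebra scale) bs"
  obtain MK where MK: "division_family scale bs mK MK"
    using division_family_exists[OF assms(1,2) bs] by (auto simp: mK_def)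
  interpret center_tower scale bs mK MK \<iota> us d MC vs c MZ
    by (intro center_tower.intro center_tower_axioms.intro MK MC MZ \<iota>_add \<iota>_mult \<iota>_one \<iota>_range)
  have main: "\<exists>M. matrix_family scale bs mK MK k ws (alg_degree (matrix_algebra scale k) ws) M \<and>
    (\<forall>X\<in>carrier (matrix_algebra scale k). reduced_norm (matrix_algebra scale k) ws X =
       (-1) ^ alg_degree (matrix_algebra scale k) ws * coeff (M X) 0)"
    if k: "k \<ge> 1" and ws: "ordered_basis (matrix_algebra scale k) ws" for k ws
  proof -
    obtain M where M: "generic_algebra (matrix_algebra scale k) ws (alg_degree (matrix_algebra scale k) ws) M"
      "\<forall>X\<in>carrier (matrix_algebra scale k). reduced_norm (matrix_algebra scale k) ws X =
       (-1) ^ alg_degree (matrix_algebra scale k) ws * coeff (M X) 0"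
      using generic_algebra_exists[OF assms(1) S.matrix_assoc_algebra ws] by blast
    have "matrix_family scale bs mK MK k ws (alg_degree (matrix_algebra scale k) ws) M"
      by (intro matrix_family.intro matrix_family_axioms.intro MK M(1)) (use k in simp)
    then show ?thesis using M(2) by blast
  qed
  show ?thesis
  proof (intro conjI allI impI)
    fix k ws assume "k \<ge> (1::nat)" "ordered_basis (matrix_algebra scale k) ws"
    then obtain M where "matrix_family scale bs mK MK k ws (alg_degree (matrix_algebra scale k) ws) M"
      using main by blast
    then show "alg_degree (matrix_algebra scale k) ws = d * k * c"
      using matrix_family.degree_matrix degree_tower by fastforce
  next
    fix k ws \<chi> assume k: "k \<ge> (1::nat)" "ordered_basis (matrix_algebra scale k) ws"
      and \<chi>: "algebra_character (matrix_algebra scale k) \<chi>"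
    obtain M where M: "matrix_family scale bs mK MK k ws (alg_degree (matrix_algebra scale k) ws) M"
      "\<forall>X\<in>carrier (matrix_algebra scale k). reduced_norm (matrix_algebra scale k) ws X =
       (-1) ^ alg_degree (matrix_algebra scale k) ws * coeff (M X) 0"
      using main[OF k] by blast
    show "\<exists>r. \<forall>X\<in>carrier (matrix_algebra scale k). \<chi> X = reduced_norm (matrix_algebra scale k) ws X ^ r"
      using matrix_family.character_is_norm_power[OF M(1) \<chi>] M(2) by simp
  qed
qed

end
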